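(* Let $E$ be a digraph, $K$ a field, and let $x\in X\setminus E^\infty_{rat.}$ (so that the isotropy group $G_x$ is trivial and $KG_x\simeq K$). Let $K$ be the unique simple $KG_x$-module, on which $KG_x\simeq K$ acts by left multiplication. Then for all $\underline a\in(K^* )^{E^1}$, $$\mathrm{Ind}_x(K)\simeq V^{\underline a}_{[x],K}$$ as left $A_K(G_E)$-modules.
   Context: Paths. $E=(E^0,E^1,s,r)$ is a directed graph. A vertex is regular if it emits at least one and only finitely many edges. A finite path is $p=e_1\cdots e_n$ with $r(e_i)=s(e_{i+1})$, $|p|=n$, $s(p)=s(e_1)$, $r(p)=r(e_n)$; vertices are trivial paths of length $0$. $F(E)$ is the set of finite paths and $E^\infty$ the set of infinite paths. A closed path is a nontrivial finite path $c$ with $s(c)=r(c)$; it is simple if $c\neq d^m$ for every closed path $d\neq c$ and every $m$. $X=E^\infty\cup\{p\in F(E): r(p)\text{ is not regular}\}$. Elements $x,y\in X$ are tail-equivalent ($x\sim y$) if $x=\mu x'$, $y=\nu x'$ for some $\mu,\nu\in F(E)$, $x'\in X$; $[x]$ is the class of $x$. $E^\infty_{rat.}$ is the set of rational infinite paths, i.e. those tail-equivalent to $c^\infty=ccc\cdots$ for some simple closed path $c$. Groupoid. $G_E=\{(\mu x',|\mu|-|\nu|,\nu x'):\mu,\nu\in F(E),\ x'\in X,\ \mu x',\nu x'\in X\}$ is a groupoid with $(x,k,y)(y,l,z)=(x,k+l,z)$ and $(x,k,y)^{-1}=(y,-k,x)$. Its unit space is identified with $X$, and $s(x,k,y)=x$,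 $r(x,k,y)=y$. For $r(\mu)=r(\nu)$, $Z_{(\mu,\nu)}=\{(\mu x,|\mu|-|\nu|,\nu x)\in G_E\}$. $A_K(G_E)$ is the $K$-span of the indicator functions $1_{Z_{(\mu,\nu)}}$ with convolution product. The Leavitt path algebra $L_K(E)$ is isomorphic to $A_K(G_E)$ via $\mu\nu^*\mapsto 1_{Z_{(\mu,\nu)}}$, and left $L_K(E)$-modules are regarded as $A_K(G_E)$-modules through this isomorphism. Induction. For $x\in X$, $G_x=\{\alpha\in G_E:s(\alpha)=r(\alpha)=x\}$ is the isotropy group and $L_x=\{\alpha\in G_E:r(\alpha)=x\}$. $KL_x$ is the vector space with basis $L_x$; it is an $A_K(G_E)$-$KG_x$-bimodule with $G_x$ acting by right multiplication and $f\cdot t=\sum_{y\in L_x}f(yt^{-1})y$ for $f\in A_K(G_E)$, $t\in L_x$. For a $KG_x$-module $V$, $\mathrm{Ind}_x(V)=KL_x\otimes_{KG_x}V$. Twisted Chen modules. $V_{[x],K}$ is the $K$-vector space with basis $[x]$ and left $L_K(E)$-action $v.p=\delta_{v,s(p)}p$, $e.p=\delta_{r(e),s(p)}ep$, $e^*.p=p'$ if $p=ep'$ and $0$ otherwise ($v\in E^0$, $e\in E^1$, $p\in[x]$). For $\underline a=(a_e)_{e\in E^1}\in(K^* )^{E^1}$, $\sigma_{\underline a}$ is the automorphism of $L_K(E)$ with $v\mapsto v$, $e\mapsto a_ee$, $e^*\mapsto a_e^{-1}e^*$. $V^{\underline a}_{[x],K}$ is the same vector space with the action in which $z\in L_K(E)$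 sends $p$ to $\sigma_{\underline a}(z).p$. *)

theory Defs
  imports
    Complex_Main
    "HOL-Library.Stream"
    "HOL-Library.Poly_Mapping"
    "HOL-Library.Function_Algebras"
    "HOL-Library.Indicator_Function"
    "HOL-Algebra.Module"
    "HOL-Algebra.QuotRing"
    "HOL-Algebra.Generated_Groups"
    "HOL-Algebra.Free_Abelian_Groups"
    "Graph_Theory.Arc_Walk"
begin

alias keys = Poly_Mapping.keys
alias lookup = Poly_Mapping.lookup

section \<open>Paths\<close>

text \<open>
  Directed graphs are the \<^locale>\<open>wf_digraph\<close>s of Graph Theory (arbitrary vertex and arc sets,
  loops and parallel arcs allowed); \<^const>\<open>tail\<close> is the source map and \<^const>\<open>head\<close> the range map.
  A finite path is its initial vertex together with its list of arcs, so that the trivial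
  path at \<open>v\<close> is \<open>(v, [])\<close>.
\<close>

type_synonym ('v, 'e) fpath = "'v \<times> 'e list"

datatype ('v, 'e) path = FinPath "('v, 'e) fpath" | InfPath "'e stream"

definition finite_paths :: "('v, 'e) pre_digraph \<Rightarrow> ('v, 'e) fpath set" where
  "finite_paths E = {(u, es). \<exists>v. pre_digraph.awalk E u es v}"

abbreviation plength :: "('v, 'e) fpath \<Rightarrow> nat" where
  "plength \<mu> \<equiv> length (snd \<mu>)"

definition fsource :: "('v, 'e) fpath \<Rightarrow> 'v" where
  "fsource \<mu> = fst \<mu>"

definition frange :: "('v, 'e) pre_digraph \<Rightarrow> ('v, 'e) fpath \<Rightarrow> 'v" where
  "frange E \<mu> = (if snd \<mu> = [] then fst \<mu> else head E (last (snd \<mu>)))"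

definition arc_path :: "('v, 'e) pre_digraph \<Rightarrow> 'e \<Rightarrow> ('v, 'e) fpath" where
  "arc_path E e = (tail E e, [e])"

definition infinite_paths :: "('v, 'e) pre_digraph \<Rightarrow> 'e stream set" where
  "infinite_paths E =
     {w. \<forall>i. w !! i \<in> arcs E \<and> head E (w !! i) = tail E (w !! Suc i)}"

definition regular :: "('v, 'e) pre_digraph \<Rightarrow> 'v \<Rightarrow> bool" where
  "regular E v \<longleftrightarrow> v \<in> verts E \<and> out_arcs E v \<noteq> {} \<and> finite (out_arcs E v)"

definition boundary_paths :: "('v, 'e) pre_digraph \<Rightarrow> ('v, 'e) path set" where
  "boundary_paths E =
     InfPath ` infinite_paths E \<union> FinPath ` {p \<in> finite_paths E. \<not> regular E (frange E p)}"

fun source :: "('v, 'e) pre_digraph \<Rightarrow> ('v, 'e) path \<Rightarrow> 'v" where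
  "source E (FinPath p) = fsource p"
| "source E (InfPath w) = tail E (shd w)"

text \<open>The concatenation is meaningful only if \<open>frange E \<mu> = source E p\<close>.\<close>

fun conc :: "('v, 'e) fpath \<Rightarrow> ('v, 'e) path \<Rightarrow> ('v, 'e) path" where
  "conc \<mu> (FinPath p) = FinPath (fst \<mu>, snd \<mu> @ snd p)"
| "conc \<mu> (InfPath w) = InfPath (snd \<mu> @- w)"

definition tail_equiv ::
  "('v, 'e) pre_digraph \<Rightarrow> ('v, 'e) path \<Rightarrow> ('v, 'e) path \<Rightarrow> bool" where
  "tail_equiv E x y \<longleftrightarrow> x \<in> boundary_paths E \<and> y \<in> boundary_paths E \<and>
     (\<exists>\<mu>\<in>finite_paths E. \<exists>\<nu>\<in>finite_paths E. \<exists>x'\<in>boundary_paths E.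
        frange E \<mu> = source E x' \<and> frange E \<nu> = source E x' \<and>
        x = conc \<mu> x' \<and> y = conc \<nu> x')"

definition tail_class :: "('v, 'e) pre_digraph \<Rightarrow> ('v, 'e) path \<Rightarrow> ('v, 'e) path set" where
  "tail_class E x = {y. tail_equiv E x y}"

definition closed_path :: "('v, 'e) pre_digraph \<Rightarrow> ('v, 'e) fpath \<Rightarrow> bool" where
  "closed_path E c \<longleftrightarrow> c \<in> finite_paths E \<and> snd c \<noteq> [] \<and> fsource c = frange E c"

definition path_power :: "('v, 'e) fpath \<Rightarrow> nat \<Rightarrow> ('v, 'e) fpath" where
  "path_power d m = (fst d, concat (replicate m (snd d)))"

definition simple_closed_path :: "('v, 'e) pre_digraph \<Rightarrow> ('v, 'e) fpath \<Rightarrow> bool" where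
  "simple_closed_path E c \<longleftrightarrow> closed_path E c \<and>
     (\<forall>d m. closed_path E d \<and> d \<noteq> c \<longrightarrow> c \<noteq> path_power d m)"

definition rational_paths :: "('v, 'e) pre_digraph \<Rightarrow> ('v, 'e) path set" where
  "rational_paths E = {x \<in> InfPath ` infinite_paths E.
     \<exists>c. simple_closed_path E c \<and> tail_equiv E x (InfPath (Stream.cycle (snd c)))}"


section \<open>The path groupoid\<close>

type_synonym ('v, 'e) garrow = "('v, 'e) path \<times> int \<times> ('v, 'e) path"

definition gpd :: "('v, 'e) pre_digraph \<Rightarrow> ('v, 'e) garrow set" where
  "gpd E = {(conc \<mu> x', int (plength \<mu>) - int (plength \<nu>), conc \<nu> x') | \<mu> \<nu> x'.
     \<mu> \<in> finite_paths E \<and> \<nu> \<in> finite_paths E \<and> x' \<in> boundary_paths E \<and>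
     frange E \<mu> = source E x' \<and> frange E \<nu> = source E x' \<and>
     conc \<mu> x' \<in> boundary_paths E \<and> conc \<nu> x' \<in> boundary_paths E}"

definition gsource :: "('v, 'e) garrow \<Rightarrow> ('v, 'e) path" where
  "gsource \<alpha> = fst \<alpha>"

definition grange :: "('v, 'e) garrow \<Rightarrow> ('v, 'e) path" where
  "grange \<alpha> = snd (snd \<alpha>)"

text \<open>The product \<open>gmult \<alpha> \<beta>\<close> is meaningful only if \<open>grange \<alpha> = gsource \<beta>\<close>.\<close>

definition gmult :: "('v, 'e) garrow \<Rightarrow> ('v, 'e) garrow \<Rightarrow> ('v, 'e) garrow" where
  "gmult \<alpha> \<beta> = (gsource \<alpha>, fst (snd \<alpha>) + fst (snd \<beta>), grange \<beta>)"

definition ginv :: "('v, 'e) garrow \<Rightarrow> ('v, 'e) garrow" where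
  "ginv \<alpha> = (grange \<alpha>, - fst (snd \<alpha>), gsource \<alpha>)"

definition gunit :: "('v, 'e) path \<Rightarrow> ('v, 'e) garrow" where
  "gunit x = (x, 0, x)"

definition isotropy :: "('v, 'e) pre_digraph \<Rightarrow> ('v, 'e) path \<Rightarrow> ('v, 'e) garrow monoid" where
  "isotropy E x = \<lparr>carrier = {\<alpha> \<in> gpd E. gsource \<alpha> = x \<and> grange \<alpha> = x},
     monoid.mult = gmult, monoid.one = gunit x\<rparr>"

definition arrows_to :: "('v, 'e) pre_digraph \<Rightarrow> ('v, 'e) path \<Rightarrow> ('v, 'e) garrow set" where
  "arrows_to E x = {\<alpha> \<in> gpd E. grange \<alpha> = x}"

definition Zset ::
  "('v, 'e) pre_digraph \<Rightarrow> ('v, 'e) fpath \<Rightarrow> ('v, 'e) fpath \<Rightarrow> ('v, 'e) garrow set" where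
  "Zset E \<mu> \<nu> = {(conc \<mu> x, int (plength \<mu>) - int (plength \<nu>), conc \<nu> x) | x.
     x \<in> boundary_paths E \<and> frange E \<mu> = source E x \<and> frange E \<nu> = source E x} \<inter> gpd E"


section \<open>Algebras and modules\<close>

text \<open>
  Scalars come from a type of class \<^class>\<open>field\<close>. A \<open>K\<close>-algebra, not necessarily commutative or
  unital, is a record of type \<open>('k, 'a) module\<close> (a ring record with scalar multiplication); the
  field \<^const>\<open>monoid.one\<close> carries no information if there is no unit. In module records neither
  \<^const>\<open>monoid.one\<close> nor \<^const>\<open>monoid.mult\<close> carries information.
\<close>

definition field_ring :: "'k::field ring" where
  "field_ring = \<lparr>carrier = UNIV, monoid.mult = (*), monoid.one = 1, ring.zero = 0, ring.add = (+)\<rparr>"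

record ('k, 'a, 'm) lmodule = "('k, 'm) module" +
  lact :: "'a \<Rightarrow> 'm \<Rightarrow> 'm"

record ('k, 'a, 'r, 'm) bimodule = "('k, 'a, 'm) lmodule" +
  ract :: "'m \<Rightarrow> 'r \<Rightarrow> 'm"

definition left_module ::
  "('k::field, 'a, 'z1) module_scheme \<Rightarrow> ('k, 'a, 'm, 'z2) lmodule_scheme \<Rightarrow> bool" where
  "left_module A M \<longleftrightarrow> Module.module field_ring M \<and>
     (\<forall>a\<in>carrier A. \<forall>m\<in>carrier M. lact M a m \<in> carrier M) \<and>
     (\<forall>a\<in>carrier A. \<forall>m\<in>carrier M. \<forall>n\<in>carrier M.
        lact M a (m \<oplus>\<^bsub>M\<^esub> n) = lact M a m \<oplus>\<^bsub>M\<^esub> lact M a n) \<and>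
     (\<forall>a\<in>carrier A. \<forall>b\<in>carrier A. \<forall>m\<in>carrier M.
        lact M (a \<oplus>\<^bsub>A\<^esub> b) m = lact M a m \<oplus>\<^bsub>M\<^esub> lact M b m) \<and>
     (\<forall>a\<in>carrier A. \<forall>b\<in>carrier A. \<forall>m\<in>carrier M.
        lact M (a \<otimes>\<^bsub>A\<^esub> b) m = lact M a (lact M b m)) \<and>
     (\<forall>c. \<forall>a\<in>carrier A. \<forall>m\<in>carrier M.
        lact M (c \<odot>\<^bsub>A\<^esub> a) m = c \<odot>\<^bsub>M\<^esub> lact M a m \<and>
        lact M a (c \<odot>\<^bsub>M\<^esub> m) = c \<odot>\<^bsub>M\<^esub> lact M a m)"

definition isomorphic_modules ::
  "('k::field, 'a, 'z1) module_scheme \<Rightarrow> ('k, 'a, 'm, 'z2) lmodule_scheme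
     \<Rightarrow> ('k, 'a, 'n, 'z3) lmodule_scheme \<Rightarrow> bool" where
  "isomorphic_modules A M N \<longleftrightarrow> left_module A M \<and> left_module A N \<and>
     (\<exists>\<phi>. bij_betw \<phi> (carrier M) (carrier N) \<and>
        (\<forall>m\<in>carrier M. \<forall>n\<in>carrier M. \<phi> (m \<oplus>\<^bsub>M\<^esub> n) = \<phi> m \<oplus>\<^bsub>N\<^esub> \<phi> n) \<and>
        (\<forall>c. \<forall>m\<in>carrier M. \<phi> (c \<odot>\<^bsub>M\<^esub> m) = c \<odot>\<^bsub>N\<^esub> \<phi> m) \<and>
        (\<forall>a\<in>carrier A. \<forall>m\<in>carrier M. \<phi> (lact M a m) = lact N a (\<phi> m)))"

definition restrict_scalars ::
  "('b \<Rightarrow> 'a) \<Rightarrow> ('k, 'a, 'm, 'z) lmodule_scheme \<Rightarrow> ('k, 'b, 'm) lmodule" where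
  "restrict_scalars h M = \<lparr>carrier = carrier M, monoid.mult = monoid.mult M, monoid.one = monoid.one M,
     ring.zero = ring.zero M, ring.add = ring.add M, smult = smult M, lact = (\<lambda>b. lact M (h b))\<rparr>"

definition algebra_ideal :: "('k, 'a, 'z) module_scheme \<Rightarrow> 'a set \<Rightarrow> bool" where
  "algebra_ideal A I \<longleftrightarrow> I \<subseteq> carrier A \<and> \<zero>\<^bsub>A\<^esub> \<in> I \<and>
     (\<forall>a\<in>I. \<forall>b\<in>I. a \<oplus>\<^bsub>A\<^esub> b \<in> I) \<and>
     (\<forall>c. \<forall>a\<in>I. c \<odot>\<^bsub>A\<^esub> a \<in> I) \<and>
     (\<forall>a\<in>I. \<forall>b\<in>carrier A. a \<otimes>\<^bsub>A\<^esub> b \<in> I \<and> b \<otimes>\<^bsub>A\<^esub> a \<in> I)"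

definition quotient_algebra ::
  "('k, 'a, 'z) module_scheme \<Rightarrow> 'a set \<Rightarrow> ('k, 'a set) module" where
  "quotient_algebra A I = ring.extend (A Quot I)
     (module.fields (\<lambda>c C. \<Union>a\<in>C. I +>\<^bsub>A\<^esub> (c \<odot>\<^bsub>A\<^esub> a)))"

text \<open>The map on cosets induced by a map that is constant on each coset.\<close>

definition on_cosets :: "('a \<Rightarrow> 'b) \<Rightarrow> 'a set \<Rightarrow> 'b" where
  "on_cosets h C = the_elem (h ` C)"


subsection \<open>Finitely supported functions\<close>

definition pm_scale :: "'k::field \<Rightarrow> ('a \<Rightarrow>\<^sub>0 'k) \<Rightarrow> ('a \<Rightarrow>\<^sub>0 'k)" where
  "pm_scale c = Poly_Mapping.map ((*) c)"

definition linear_extend :: "('a \<Rightarrow> ('b \<Rightarrow>\<^sub>0 'k::field)) \<Rightarrow> ('a \<Rightarrow>\<^sub>0 'k) \<Rightarrow> ('b \<Rightarrow>\<^sub>0 'k)" where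
  "linear_extend g m = (\<Sum>t\<in>keys m. pm_scale (lookup m t) (g t))"

definition bilinear_extend ::
  "('a \<Rightarrow> 'b \<Rightarrow> 'c) \<Rightarrow> ('a \<Rightarrow>\<^sub>0 'k::field) \<Rightarrow> ('b \<Rightarrow>\<^sub>0 'k) \<Rightarrow> ('c \<Rightarrow>\<^sub>0 'k)" where
  "bilinear_extend f m n =
     (\<Sum>s\<in>keys m. \<Sum>t\<in>keys n. Poly_Mapping.single (f s t) (lookup m s * lookup n t))"


subsection \<open>Tensor products\<close>

text \<open>
  \<open>M \<otimes>\<^bsub>R\<^esub> W\<close> is the free abelian group on \<open>M \<times> W\<close> modulo the subgroup generated by the
  relations of biadditivity and \<open>R\<close>-balancedness; left actions on \<open>M\<close> pass to the first factor.
\<close>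

definition tensor_relations ::
  "('k, 'a, 'r, 'm) bimodule \<Rightarrow> ('k, 'r) module \<Rightarrow> ('k, 'r, 'w) lmodule
     \<Rightarrow> ('m \<times> 'w \<Rightarrow>\<^sub>0 int) set" where
  "tensor_relations M R W =
     {frag_of (m \<oplus>\<^bsub>M\<^esub> m', w) - frag_of (m, w) - frag_of (m', w) | m m' w.
        m \<in> carrier M \<and> m' \<in> carrier M \<and> w \<in> carrier W} \<union>
     {frag_of (m, w \<oplus>\<^bsub>W\<^esub> w') - frag_of (m, w) - frag_of (m, w') | m w w'.
        m \<in> carrier M \<and> w \<in> carrier W \<and> w' \<in> carrier W} \<union>
     {frag_of (ract M m r, w) - frag_of (m, lact W r w) | m r w.
        m \<in> carrier M \<and> r \<in> carrier R \<and> w \<in> carrier W}"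

definition tensor_product ::
  "('k, 'a, 'r, 'm) bimodule \<Rightarrow> ('k, 'r) module \<Rightarrow> ('k, 'r, 'w) lmodule
     \<Rightarrow> ('k, 'a, ('m \<times> 'w \<Rightarrow>\<^sub>0 int) set) lmodule" where
  "tensor_product M R W =
     (let F = free_Abelian_group (carrier M \<times> carrier W);
          H = generate F (tensor_relations M R W);
          first = (\<lambda>g. on_cosets (\<lambda>z. H #>\<^bsub>F\<^esub> frag_extend (\<lambda>(m, w). frag_of (g m, w)) z))
      in \<lparr>carrier = carrier (F Mod H), monoid.mult = undefined, monoid.one = undefined,
          ring.zero = \<one>\<^bsub>F Mod H\<^esub>, ring.add = monoid.mult (F Mod H),
          smult = (\<lambda>c. first (\<lambda>m. c \<odot>\<^bsub>M\<^esub> m)), lact = (\<lambda>a. first (lact M a))\<rparr>)"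


section \<open>The Steinberg algebra and induction from isotropy groups\<close>

definition steinberg_span :: "('v, 'e) pre_digraph \<Rightarrow> (('v, 'e) garrow \<Rightarrow> 'k::field) set" where
  "steinberg_span E = Modules.module.span (\<lambda>c f \<gamma>. c * f \<gamma>)
     {indicator (Zset E \<mu> \<nu>) | \<mu> \<nu>.
        \<mu> \<in> finite_paths E \<and> \<nu> \<in> finite_paths E \<and> frange E \<mu> = frange E \<nu>}"

text \<open>
  For \<open>f\<close>, \<open>g\<close> in the span of the indicator functions only finitely many summands are nonzero.
  The sum is restricted to them because \<^const>\<open>sum\<close> is zero on infinite index sets.
\<close>

definition convolution ::
  "('v, 'e) pre_digraph \<Rightarrow> (('v, 'e) garrow \<Rightarrow> 'k::field) \<Rightarrow> (('v, 'e) garrow \<Rightarrow> 'k)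
     \<Rightarrow> ('v, 'e) garrow \<Rightarrow> 'k" where
  "convolution E f g \<gamma> =
     (\<Sum>(\<alpha>, \<beta>) \<in> {(\<alpha>, \<beta>). \<alpha> \<in> gpd E \<and> \<beta> \<in> gpd E \<and> grange \<alpha> = gsource \<beta> \<and>
        gmult \<alpha> \<beta> = \<gamma> \<and> f \<alpha> * g \<beta> \<noteq> 0}. f \<alpha> * g \<beta>)"

definition steinberg ::
  "('v, 'e) pre_digraph \<Rightarrow> ('k::field, ('v, 'e) garrow \<Rightarrow> 'k) module" where
  "steinberg E = \<lparr>carrier = steinberg_span E, monoid.mult = convolution E, monoid.one = undefined,
     ring.zero = 0, ring.add = (+), smult = (\<lambda>c f \<gamma>. c * f \<gamma>)\<rparr>"

definition isotropy_algebra ::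
  "('v, 'e) pre_digraph \<Rightarrow> ('v, 'e) path \<Rightarrow> ('k::field, ('v, 'e) garrow \<Rightarrow>\<^sub>0 'k) module" where
  "isotropy_algebra E x = \<lparr>carrier = {g. keys g \<subseteq> carrier (isotropy E x)},
     monoid.mult = bilinear_extend gmult, monoid.one = Poly_Mapping.single (gunit x) 1,
     ring.zero = 0, ring.add = (+), smult = pm_scale\<rparr>"

text \<open>As in \<^const>\<open>convolution\<close>, the inner sum ranges over the nonzero summands only.\<close>

definition arrows_lact ::
  "('v, 'e) pre_digraph \<Rightarrow> ('v, 'e) path \<Rightarrow> (('v, 'e) garrow \<Rightarrow> 'k::field)
     \<Rightarrow> (('v, 'e) garrow \<Rightarrow>\<^sub>0 'k) \<Rightarrow> (('v, 'e) garrow \<Rightarrow>\<^sub>0 'k)" where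
  "arrows_lact E x f = linear_extend
     (\<lambda>t. \<Sum>y \<in> {y \<in> arrows_to E x. f (gmult y (ginv t)) \<noteq> 0}.
        Poly_Mapping.single y (f (gmult y (ginv t))))"

definition arrows_bimodule ::
  "('v, 'e) pre_digraph \<Rightarrow> ('v, 'e) path \<Rightarrow>
     ('k::field, ('v, 'e) garrow \<Rightarrow> 'k, ('v, 'e) garrow \<Rightarrow>\<^sub>0 'k, ('v, 'e) garrow \<Rightarrow>\<^sub>0 'k) bimodule"
where
  "arrows_bimodule E x = \<lparr>carrier = {m. keys m \<subseteq> arrows_to E x},
     monoid.mult = undefined, monoid.one = undefined, ring.zero = 0, ring.add = (+), smult = pm_scale,
     lact = arrows_lact E x, ract = bilinear_extend gmult\<rparr>"

definition Ind ::
  "('v, 'e) pre_digraph \<Rightarrow> ('v, 'e) path \<Rightarrow> ('k::field, ('v, 'e) garrow \<Rightarrow>\<^sub>0 'k, 'w) lmodule \<Rightarrow>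
     ('k, ('v, 'e) garrow \<Rightarrow> 'k, ((('v, 'e) garrow \<Rightarrow>\<^sub>0 'k) \<times> 'w \<Rightarrow>\<^sub>0 int) set) lmodule" where
  "Ind E x W = tensor_product (arrows_bimodule E x) (isotropy_algebra E x) W"

text \<open>
  If \<open>G\<^sub>x\<close> is trivial, \<open>coefficient_sum\<close> is the identification \<open>c \<cdot> 1\<^sub>x \<mapsto> c\<close> of \<open>KG\<^sub>x\<close> with \<open>K\<close>;
  in general it is the augmentation map.
\<close>

definition coefficient_sum :: "('a \<Rightarrow>\<^sub>0 'k::field) \<Rightarrow> 'k" where
  "coefficient_sum g = (\<Sum>\<gamma>\<in>keys g. lookup g \<gamma>)"

definition scalar_module :: "('k::field, ('v, 'e) garrow \<Rightarrow>\<^sub>0 'k, 'k) lmodule" where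
  "scalar_module = \<lparr>carrier = UNIV, monoid.mult = undefined, monoid.one = undefined, ring.zero = 0,
     ring.add = (+), smult = (*), lact = (\<lambda>g c. coefficient_sum g * c)\<rparr>"


section \<open>Leavitt path algebras\<close>

text \<open>\<open>Ghost e\<close> stands for the generator \<open>e\<^sup>*\<close>.\<close>

datatype ('v, 'e) letter = Vertex 'v | Arc 'e | Ghost 'e

definition letters :: "('v, 'e) pre_digraph \<Rightarrow> ('v, 'e) letter set" where
  "letters E = Vertex ` verts E \<union> Arc ` arcs E \<union> Ghost ` arcs E"

text \<open>The free non-unital algebra on the letters has the nonempty words as a basis.\<close>

definition free_algebra ::
  "('v, 'e) pre_digraph \<Rightarrow> ('k::field, ('v, 'e) letter list \<Rightarrow>\<^sub>0 'k) module" where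
  "free_algebra E = \<lparr>carrier = {z. keys z \<subseteq> {w. w \<noteq> [] \<and> set w \<subseteq> letters E}},
     monoid.mult = bilinear_extend (@), monoid.one = undefined, ring.zero = 0, ring.add = (+), smult = pm_scale\<rparr>"

abbreviation word :: "'l list \<Rightarrow> ('l list \<Rightarrow>\<^sub>0 'k::field)" where
  "word w \<equiv> Poly_Mapping.single w 1"

definition leavitt_relations ::
  "('v, 'e) pre_digraph \<Rightarrow> (('v, 'e) letter list \<Rightarrow>\<^sub>0 'k::field) set" where
  "leavitt_relations E =
     {word [Vertex v, Vertex w] - (if v = w then word [Vertex v] else 0) | v w.
        v \<in> verts E \<and> w \<in> verts E} \<union>
     (\<Union>e\<in>arcs E.
       {word [Vertex (tail E e), Arc e] - word [Arc e],
        word [Arc e, Vertex (head E e)] - word [Arc e],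
        word [Vertex (head E e), Ghost e] - word [Ghost e],
        word [Ghost e, Vertex (tail E e)] - word [Ghost e]}) \<union>
     {word [Ghost e, Arc f] - (if e = f then word [Vertex (head E e)] else 0) | e f.
        e \<in> arcs E \<and> f \<in> arcs E} \<union>
     {word [Vertex v] - (\<Sum>e\<in>out_arcs E v. word [Arc e, Ghost e]) | v. regular E v}"

definition leavitt_ideal ::
  "('v, 'e) pre_digraph \<Rightarrow> (('v, 'e) letter list \<Rightarrow>\<^sub>0 'k::field) set" where
  "leavitt_ideal E = algebra_ideal (free_algebra E) hull leavitt_relations E"

definition leavitt ::
  "('v, 'e) pre_digraph \<Rightarrow> ('k::field, (('v, 'e) letter list \<Rightarrow>\<^sub>0 'k) set) module" where
  "leavitt E = quotient_algebra (free_algebra E) (leavitt_ideal E)"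

definition generator ::
  "('v, 'e) pre_digraph \<Rightarrow> ('v, 'e) letter \<Rightarrow> (('v, 'e) letter list \<Rightarrow>\<^sub>0 'k::field) set" where
  "generator E l = leavitt_ideal E +>\<^bsub>free_algebra E\<^esub> word [l]"

fun eval_word :: "('k, 'b, 'z) module_scheme \<Rightarrow> ('l \<Rightarrow> 'b) \<Rightarrow> 'l list \<Rightarrow> 'b" where
  "eval_word B g [] = undefined"
| "eval_word B g [l] = g l"
| "eval_word B g (l # l' # w) = g l \<otimes>\<^bsub>B\<^esub> eval_word B g (l' # w)"

text \<open>
  The algebra homomorphism from the Leavitt path algebra to \<open>B\<close> that sends each generator \<open>l\<close>
  to \<open>g l\<close>, provided that \<open>g\<close> respects the defining relations.
\<close>

definition leavitt_hom ::
  "('k::field, 'b, 'z) module_scheme \<Rightarrow> (('v, 'e) letter \<Rightarrow> 'b)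
     \<Rightarrow> (('v, 'e) letter list \<Rightarrow>\<^sub>0 'k) set \<Rightarrow> 'b" where
  "leavitt_hom B g = on_cosets
     (\<lambda>z. \<Oplus>\<^bsub>B\<^esub>w\<in>keys z. lookup z w \<odot>\<^bsub>B\<^esub> eval_word B g w)"

text \<open>
  The isomorphism \<open>\<mu>\<nu>\<^sup>* \<mapsto> 1\<^bsub>Z(\<mu>,\<nu>)\<^esub>\<close>; the values on generators are the cases
  \<open>v = v v\<^sup>*\<close>, \<open>e = e r(e)\<^sup>*\<close> and \<open>e\<^sup>* = r(e) e\<^sup>*\<close>.
\<close>

fun steinberg_generator ::
  "('v, 'e) pre_digraph \<Rightarrow> ('v, 'e) letter \<Rightarrow> ('v, 'e) garrow \<Rightarrow> 'k::field" where
  "steinberg_generator E (Vertex v) = indicator (Zset E (v, []) (v, []))"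
| "steinberg_generator E (Arc e) = indicator (Zset E (arc_path E e) (head E e, []))"
| "steinberg_generator E (Ghost e) = indicator (Zset E (head E e, []) (arc_path E e))"

definition leavitt_to_steinberg ::
  "('v, 'e) pre_digraph \<Rightarrow> (('v, 'e) letter list \<Rightarrow>\<^sub>0 'k::field) set
     \<Rightarrow> ('v, 'e) garrow \<Rightarrow> 'k" where
  "leavitt_to_steinberg E = leavitt_hom (steinberg E) (steinberg_generator E)"

text \<open>Restriction of scalars along the inverse of the isomorphism \<^const>\<open>leavitt_to_steinberg\<close>.\<close>

definition as_steinberg_module ::
  "('v, 'e) pre_digraph \<Rightarrow> ('k::field, (('v, 'e) letter list \<Rightarrow>\<^sub>0 'k) set, 'm) lmodule
     \<Rightarrow> ('k, ('v, 'e) garrow \<Rightarrow> 'k, 'm) lmodule" where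
  "as_steinberg_module E M =
     restrict_scalars (inv_into (carrier (leavitt E)) (leavitt_to_steinberg E)) M"


section \<open>Twisted Chen modules\<close>

fun letter_act ::
  "('v, 'e) pre_digraph \<Rightarrow> ('v, 'e) letter \<Rightarrow> ('v, 'e) path \<Rightarrow> (('v, 'e) path \<Rightarrow>\<^sub>0 'k::field)"
where
  "letter_act E (Vertex v) p = (if v = source E p then Poly_Mapping.single p 1 else 0)"
| "letter_act E (Arc e) p =
     (if head E e = source E p then Poly_Mapping.single (conc (arc_path E e) p) 1 else 0)"
| "letter_act E (Ghost e) p =
     (if \<exists>p'\<in>boundary_paths E. head E e = source E p' \<and> p = conc (arc_path E e) p'
      then Poly_Mapping.single
        (THE p'. p' \<in> boundary_paths E \<and> head E e = source E p' \<and> p = conc (arc_path E e) p') 1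
      else 0)"

definition free_algebra_act ::
  "('v, 'e) pre_digraph \<Rightarrow> (('v, 'e) letter list \<Rightarrow>\<^sub>0 'k::field)
     \<Rightarrow> (('v, 'e) path \<Rightarrow>\<^sub>0 'k) \<Rightarrow> (('v, 'e) path \<Rightarrow>\<^sub>0 'k)" where
  "free_algebra_act E z m =
     (\<Sum>w\<in>keys z. pm_scale (lookup z w) (foldr (\<lambda>l. linear_extend (letter_act E l)) w m))"

definition chen_module ::
  "('v, 'e) pre_digraph \<Rightarrow> ('v, 'e) path \<Rightarrow>
     ('k::field, (('v, 'e) letter list \<Rightarrow>\<^sub>0 'k) set, ('v, 'e) path \<Rightarrow>\<^sub>0 'k) lmodule" where
  "chen_module E x = \<lparr>carrier = {m. keys m \<subseteq> tail_class E x},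
     monoid.mult = undefined, monoid.one = undefined, ring.zero = 0, ring.add = (+), smult = pm_scale,
     lact = (\<lambda>C m. on_cosets (\<lambda>z. free_algebra_act E z m) C)\<rparr>"

fun twist_generator ::
  "('v, 'e) pre_digraph \<Rightarrow> ('e \<Rightarrow> 'k::field) \<Rightarrow> ('v, 'e) letter
     \<Rightarrow> (('v, 'e) letter list \<Rightarrow>\<^sub>0 'k) set" where
  "twist_generator E a (Vertex v) = generator E (Vertex v)"
| "twist_generator E a (Arc e) = a e \<odot>\<^bsub>leavitt E\<^esub> generator E (Arc e)"
| "twist_generator E a (Ghost e) = inverse (a e) \<odot>\<^bsub>leavitt E\<^esub> generator E (Ghost e)"

definition twist ::
  "('v, 'e) pre_digraph \<Rightarrow> ('e \<Rightarrow> 'k::field) \<Rightarrow>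
     (('v, 'e) letter list \<Rightarrow>\<^sub>0 'k) set \<Rightarrow> (('v, 'e) letter list \<Rightarrow>\<^sub>0 'k) set" where
  "twist E a = leavitt_hom (leavitt E) (twist_generator E a)"

definition twisted_chen_module ::
  "('v, 'e) pre_digraph \<Rightarrow> ('e \<Rightarrow> 'k::field) \<Rightarrow> ('v, 'e) path \<Rightarrow>
     ('k, (('v, 'e) letter list \<Rightarrow>\<^sub>0 'k) set, ('v, 'e) path \<Rightarrow>\<^sub>0 'k) lmodule" where
  "twisted_chen_module E a x = restrict_scalars (twist E a) (chen_module E x)"

end

theory Submission
  imports Defs
begin

text \<open>
Both modules are compared with the space \<open>KL\<^sub>x\<close> of finitely supported functions on the arrows that end
at \<open>x\<close>, on which a function \<open>f\<close> on the groupoid acts as the matrix \<open>(y, t) \<mapsto> f (y t\<^sup>-\<^sup>1)\<close>.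

\<^emph>\<open>Induction.\<close> If \<open>G\<^sub>x\<close> is trivial, then \<open>KG\<^sub>x = K\<close> and \<open>m \<otimes> c \<mapsto> c m\<close> identifies \<open>KL\<^sub>x \<otimes> K\<close>
with \<open>KL\<^sub>x\<close> (\<open>Ind_isomorphic\<close>).

\<^emph>\<open>Triviality of the isotropy.\<close> The groupoid is that of the partial shift which removes the first arc of
a boundary path: \<open>(p, k, q)\<close> is an arrow iff \<open>p\<close> after \<open>m\<close> steps equals \<open>q\<close> after \<open>n\<close> steps for some \<open>m\<close> and
\<open>n\<close> with \<open>m - n = k\<close>. An arrow from \<open>x\<close> to \<open>x\<close> with \<open>k \<noteq> 0\<close> makes a tail of \<open>x\<close> periodic, and then \<open>x\<close>
is rational (\<open>gpd_loop_rational\<close>). For an irrational \<open>x\<close> the degree of an arrow \<open>(p, k, x)\<close> is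
therefore determined by \<open>p\<close>, and the arrows that end at \<open>x\<close> correspond to the members of \<open>[x]\<close>.

\<^emph>\<open>The twist.\<close> If \<open>p\<close> after \<open>m\<close> steps equals \<open>x\<close> after \<open>n\<close> steps, let \<open>b p\<close> be the product of the
scalars \<open>a e\<close> over the first \<open>m\<close> arcs of \<open>p\<close>, divided by the same product over the first \<open>n\<close> arcs of \<open>x\<close>.
Because \<open>m - n\<close> is determined by \<open>p\<close>, another choice of \<open>m\<close> and \<open>n\<close> changes both products by the same
factor. The resulting function \<open>b\<close> satisfies \<open>b (e p) = a e * b p\<close>, which says precisely that
the linear bijection \<open>(p, k, x) \<mapsto> b p \<cdot> p\<close> from \<open>KL\<^sub>x\<close> to \<open>K[x]\<close> turns the action of the arc \<open>e\<close> on
arrows into the twisted action \<open>a e \<cdot> e\<close> on paths (\<open>weighted_source_op\<close>).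

\<^emph>\<open>From the Leavitt path algebra to the Steinberg algebra.\<close> A function on the groupoid is zero as soon as
it acts as zero on every \<open>KL\<^sub>x\<close> (\<open>arrows_lact_faithful\<close>), and on \<open>KL\<^sub>x\<close> the generators permute
basis arrows partially, so that the defining relations are visible there (\<open>arrow_op_relations\<close>). Hence
the map from the Leavitt path algebra is well defined; it is surjective since \<open>\<mu>\<nu>\<^sup>*\<close> is sent to
the indicator of \<open>Z(\<mu>, \<nu>)\<close> (\<open>leavitt_to_steinberg_surj\<close>). If \<open>z\<close> is sent to \<open>f\<close>, then \<open>z\<close> acts on
\<open>KL\<^sub>x\<close> as \<open>f\<close> does. Under the bijection above, the twisted action of \<open>z\<close> on \<open>K[x]\<close> thus corresponds to
the action of \<open>f\<close> on \<open>KL\<^sub>x\<close>, whichever preimage \<open>z\<close> of \<open>f\<close> is taken (\<open>twisted_chen_isomorphic\<close>).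
\<close>

section \<open>Linear algebra of finitely supported functions\<close>

lemma lookup_pm_scale [simp]: "lookup (pm_scale c m) t = c * lookup m t"
  by (auto simp: pm_scale_def Poly_Mapping.map.rep_eq when_def)

lemma keys_pm_scale: "keys (pm_scale c m) \<subseteq> keys m"
  by (auto simp: in_keys_iff)

lemma pm_scale_single [simp]: "pm_scale c (Poly_Mapping.single t d) = Poly_Mapping.single t (c * d)"
  by (rule poly_mapping_eqI) (simp add: lookup_single when_def)

interpretation pm: vector_space "pm_scale :: 'k::field \<Rightarrow> ('a \<Rightarrow>\<^sub>0 'k) \<Rightarrow> ('a \<Rightarrow>\<^sub>0 'k)"
  by unfold_locales (auto intro!: poly_mapping_eqI simp: lookup_add algebra_simps)

abbreviation pm_linear :: "(('a \<Rightarrow>\<^sub>0 'k::field) \<Rightarrow> ('b \<Rightarrow>\<^sub>0 'k)) \<Rightarrow> bool" where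
  "pm_linear \<equiv> Vector_Spaces.linear pm_scale pm_scale"

lemma pm_linear_iff:
  fixes T :: "('a \<Rightarrow>\<^sub>0 'k::field) \<Rightarrow> ('b \<Rightarrow>\<^sub>0 'k)"
  shows "pm_linear T \<longleftrightarrow> (\<forall>m n. T (m + n) = T m + T n) \<and> (\<forall>c m. T (pm_scale c m) = pm_scale c (T m))"
  by (simp add: Vector_Spaces.linear_iff pm.vector_space_axioms)

lemma pm_linear_add: "pm_linear T \<Longrightarrow> T (m + n) = T m + T n"
  and pm_linear_scale: "pm_linear T \<Longrightarrow> T (pm_scale c m) = pm_scale c (T m)"
  by (simp_all add: pm_linear_iff)

lemma pm_linear_zero: "pm_linear T \<Longrightarrow> T 0 = 0"
  using pm_linear_add[of T 0 0] by simp

lemma pm_linear_sum: "pm_linear T \<Longrightarrow> T (sum f S) = (\<Sum>i\<in>S. T (f i))"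
  by (induction S rule: infinite_finite_induct) (auto simp: pm_linear_zero pm_linear_add)

lemma pm_linear_diff: "pm_linear T \<Longrightarrow> T (m - n) = T m - T n"
  using pm_linear_add[of T "m - n" n] by (simp add: algebra_simps)

lemma pm_linear_comp: "pm_linear T \<Longrightarrow> pm_linear T' \<Longrightarrow> pm_linear (\<lambda>m. T (T' m))"
  by (simp add: pm_linear_iff)

lemma linear_extend_superset:
  assumes "finite S" "keys m \<subseteq> S"
  shows "linear_extend g m = (\<Sum>t\<in>S. pm_scale (lookup m t) (g t))"
  unfolding linear_extend_def
  by (rule sum.mono_neutral_left) (use assms in \<open>auto simp: in_keys_iff\<close>)

lemma pm_linear_linear_extend: "pm_linear (linear_extend g)"
proof -
  have "linear_extend g (m + n) = linear_extend g m + linear_extend g n" for m n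
  proof -
    have "keys (m + n) \<subseteq> keys m \<union> keys n" by (rule keys_add)
    then show ?thesis
      by (simp add: linear_extend_superset[of "keys m \<union> keys n"] lookup_add pm.scale_left_distrib
          sum.distrib)
  qed
  moreover have "linear_extend g (pm_scale c m) = pm_scale c (linear_extend g m)" for c m
    using keys_pm_scale[of c m]
    by (simp add: linear_extend_superset[of "keys m"] pm.scale_sum_right)
  ultimately show ?thesis by (simp add: pm_linear_iff)
qed

lemma lookup_linear_extend:
  "lookup (linear_extend g m) y = (\<Sum>t\<in>keys m. lookup m t * lookup (g t) y)"
  by (simp add: linear_extend_def lookup_sum)

lemma linear_extend_single [simp]: "linear_extend g (Poly_Mapping.single t c) = pm_scale c (g t)"
  by (cases "c = 0") (auto simp: linear_extend_def)

lemma linear_extend_scale_fun: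
  "linear_extend (\<lambda>t. pm_scale c (g t)) m = pm_scale c (linear_extend g m)"
  by (simp add: linear_extend_def pm.scale_sum_right mult.commute)

lemma linear_extend_cong:
  "m = n \<Longrightarrow> (\<And>t. t \<in> keys n \<Longrightarrow> g t = h t) \<Longrightarrow> linear_extend g m = linear_extend h n"
  by (auto simp: linear_extend_def)

lemma keys_linear_extend:
  assumes "\<And>t. t \<in> keys m \<Longrightarrow> keys (g t) \<subseteq> Y"
  shows "keys (linear_extend g m) \<subseteq> Y"
proof
  fix y assume "y \<in> keys (linear_extend g m)"
  then have "(\<Sum>t\<in>keys m. lookup m t * lookup (g t) y) \<noteq> 0"
    by (simp add: in_keys_iff lookup_linear_extend)
  then obtain t where "t \<in> keys m" "lookup (g t) y \<noteq> 0"
    by (metis (no_types, lifting) mult_zero_right sum.neutral)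
  with assms[of t] show "y \<in> Y" by (auto simp: in_keys_iff)
qed

lemma linear_extend_id: "linear_extend (\<lambda>t. Poly_Mapping.single t 1) m = m"
proof (rule poly_mapping_eqI)
  fix k
  have "(\<Sum>t\<in>keys m. lookup m t * lookup (Poly_Mapping.single t 1) k) =
      (\<Sum>t\<in>keys m. if t = k then lookup m t else 0)"
    by (rule sum.cong) (auto simp: lookup_single when_def)
  then show "lookup (linear_extend (\<lambda>t. Poly_Mapping.single t 1) m) k = lookup m k"
    by (simp add: lookup_linear_extend in_keys_iff)
qed

lemma pm_linear_linear_extend_comp:
  assumes "pm_linear T"
  shows "T (linear_extend g m) = linear_extend (\<lambda>t. T (g t)) m"
  by (simp add: linear_extend_def pm_linear_sum[OF assms] pm_linear_scale[OF assms])

lemma pm_linear_expand: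
  assumes "pm_linear T"
  shows "T m = linear_extend (\<lambda>t. T (Poly_Mapping.single t 1)) m"
  using pm_linear_linear_extend_comp[OF assms, of "\<lambda>t. Poly_Mapping.single t 1" m]
  by (simp add: linear_extend_id)

text \<open>
The form in which identities between operators are checked throughout: on basis elements, and only
on those that can occur in the support of the argument.
\<close>

lemma pm_linear_eq_on:
  assumes "pm_linear T" "pm_linear T'" "keys m \<subseteq> Y"
    and "\<And>t. t \<in> Y \<Longrightarrow> T (Poly_Mapping.single t 1) = T' (Poly_Mapping.single t 1)"
  shows "T m = T' m"
  unfolding pm_linear_expand[OF assms(1), of m] pm_linear_expand[OF assms(2), of m]
  using assms(3,4) by (intro linear_extend_cong) auto

text \<open>
Reduces every statement about bilinear extensions to the calculus of linear extensions.
\<close>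

lemma bilinear_extend_conv_linear_extend:
  "bilinear_extend f m n =
     linear_extend (\<lambda>s. linear_extend (\<lambda>t. Poly_Mapping.single (f s t) 1) n) m"
  by (simp add: bilinear_extend_def linear_extend_def pm.scale_sum_right)

lemma keys_bilinear_extend:
  assumes "\<And>s t. s \<in> keys m \<Longrightarrow> t \<in> keys n \<Longrightarrow> f s t \<in> Y"
  shows "keys (bilinear_extend f m n) \<subseteq> Y"
  unfolding bilinear_extend_conv_linear_extend using assms by (intro keys_linear_extend) auto

lemma sum_lookup_superset:
  fixes c :: "'a \<Rightarrow> 'k::field"
  assumes "finite S" "keys m \<subseteq> S"
  shows "(\<Sum>t\<in>keys m. lookup m t * c t) = (\<Sum>t\<in>S. lookup m t * c t)"
  by (rule sum.mono_neutral_left) (use assms in \<open>auto simp: in_keys_iff\<close>)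

lemma sum_lookup_add:
  fixes c :: "'a \<Rightarrow> 'k::field"
  shows "(\<Sum>t\<in>keys (m + n). lookup (m + n) t * c t) =
     (\<Sum>t\<in>keys m. lookup m t * c t) + (\<Sum>t\<in>keys n. lookup n t * c t)"
  using keys_add[of m n]
  by (subst (1 2 3) sum_lookup_superset[of "keys m \<union> keys n"])
    (simp_all add: lookup_add distrib_right sum.distrib)

lemma keys_add_subset: "keys m \<subseteq> Y \<Longrightarrow> keys n \<subseteq> Y \<Longrightarrow> keys (m + n) \<subseteq> Y"
  using keys_add[of m n] by auto

lemma keys_pm_scale_subset: "keys m \<subseteq> Y \<Longrightarrow> keys (pm_scale c m) \<subseteq> Y"
  using keys_pm_scale[of c m] by auto

lemma keys_sum_subset: "(\<And>i. i \<in> S \<Longrightarrow> keys (f i) \<subseteq> Y) \<Longrightarrow> keys (sum f S) \<subseteq> Y"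
  using keys_sum[of f S] by blast

lemma keys_subset_singleton: "keys g \<subseteq> {t} \<longleftrightarrow> (\<exists>c. g = Poly_Mapping.single t c)"
proof
  assume "keys g \<subseteq> {t}"
  then have "g = Poly_Mapping.single t (lookup g t)"
    by (intro poly_mapping_eqI) (auto simp: lookup_single when_def in_keys_iff)
  then show "\<exists>c. g = Poly_Mapping.single t c" by blast
qed (auto split: if_splits)

lemma coefficient_sum_single [simp]: "coefficient_sum (Poly_Mapping.single t c) = c"
  by (cases "c = 0") (auto simp: coefficient_sum_def)

lemma bilinear_extend_single [simp]:
  "bilinear_extend f (Poly_Mapping.single s c) (Poly_Mapping.single t d) =
    Poly_Mapping.single (f s t) (c * d)"
  by (simp add: bilinear_extend_conv_linear_extend)

lemma bilinear_extend_diff_left: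
  "bilinear_extend f (m - m') n = bilinear_extend f m n - bilinear_extend f m' n"
  unfolding bilinear_extend_conv_linear_extend by (rule pm_linear_diff[OF pm_linear_linear_extend])

lemma bilinear_extend_diff_right:
  "bilinear_extend f m (n - n') = bilinear_extend f m n - bilinear_extend f m n'"
  unfolding bilinear_extend_conv_linear_extend pm_linear_diff[OF pm_linear_linear_extend]
  by (simp add: linear_extend_def pm.scale_right_diff_distrib sum_subtractf)

section \<open>Transport of module structures\<close>

lemma cring_field_ring: "cring (field_ring :: 'k::field ring)"
proof (rule cringI)
  show "abelian_group (field_ring :: 'k ring)"
    by (rule abelian_groupI)
      (auto simp: field_ring_def algebra_simps intro: exI[of _ "- _"] right_minus)
  show "comm_monoid (field_ring :: 'k ring)"
    by (rule comm_monoidI) (auto simp: field_ring_def)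
qed (auto simp: field_ring_def algebra_simps)

text \<open>
The target of a bijection that matches all operations with those of a module satisfies the module
axioms automatically; they have to be proved only once, for the space of arrows. The algebra is
a bare record here, so its closure properties are assumptions.
\<close>

lemma isomorphic_modules_transport:
  fixes A :: "('k::field, 'a, 'z1) module_scheme" and M :: "('k, 'a, 'm, 'z2) lmodule_scheme"
    and N :: "('k, 'a, 'n, 'z3) lmodule_scheme"
  assumes M: "left_module A M"
    and bij: "bij_betw \<phi> (carrier M) (carrier N)"
    and zero: "\<phi> \<zero>\<^bsub>M\<^esub> = \<zero>\<^bsub>N\<^esub>"
    and add: "\<And>m n. m \<in> carrier M \<Longrightarrow> n \<in> carrier M \<Longrightarrow> \<phi> m \<oplus>\<^bsub>N\<^esub> \<phi> n = \<phi> (m \<oplus>\<^bsub>M\<^esub> n)"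
    and smult: "\<And>c m. m \<in> carrier M \<Longrightarrow> c \<odot>\<^bsub>N\<^esub> \<phi> m = \<phi> (c \<odot>\<^bsub>M\<^esub> m)"
    and lact: "\<And>a m. a \<in> carrier A \<Longrightarrow> m \<in> carrier M \<Longrightarrow> lact N a (\<phi> m) = \<phi> (lact M a m)"
    and A_closed: "\<And>a b. a \<in> carrier A \<Longrightarrow> b \<in> carrier A \<Longrightarrow> a \<oplus>\<^bsub>A\<^esub> b \<in> carrier A"
      "\<And>a b. a \<in> carrier A \<Longrightarrow> b \<in> carrier A \<Longrightarrow> a \<otimes>\<^bsub>A\<^esub> b \<in> carrier A"
      "\<And>c a. a \<in> carrier A \<Longrightarrow> c \<odot>\<^bsub>A\<^esub> a \<in> carrier A"
  shows "isomorphic_modules A M N"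
proof -
  interpret M: Module.module field_ring M using M by (simp add: left_module_def)
  have N_carrier: "carrier N = \<phi> ` carrier M" using bij by (simp add: bij_betw_def)
  have [simp]: "carrier (field_ring :: 'k ring) = UNIV" by (simp add: field_ring_def)
  have sc: "c \<odot>\<^bsub>M\<^esub> m \<in> carrier M" if "m \<in> carrier M" for c m
    using M.smult_closed[of c m] that by simp
  note M' = M[unfolded left_module_def]
  have la: "lact M a m \<in> carrier M" if "a \<in> carrier A" "m \<in> carrier M" for a m
    using M' that by blast
  have "Module.module field_ring N"
  proof (rule moduleI)
    show "abelian_group N"
    proof (rule abelian_groupI)
      fix y assume "y \<in> carrier N"
      then obtain m where m: "m \<in> carrier M" "y = \<phi> m" by (auto simp: N_carrier)
      then have "\<phi> (\<ominus>\<^bsub>M\<^esub> m) \<oplus>\<^bsub>N\<^esub> y = \<zero>\<^bsub>N\<^esub>" by (simp add: add M.M.l_neg zero)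
      with m show "\<exists>z\<in>carrier N. z \<oplus>\<^bsub>N\<^esub> y = \<zero>\<^bsub>N\<^esub>" by (auto simp: N_carrier)
    qed (auto simp: N_carrier add zero[symmetric] M.M.a_ac)
  qed (use M.smult_l_distr M.smult_assoc1 M.smult_one in
      \<open>auto simp: N_carrier add smult sc cring_field_ring M.smult_r_distr\<close>)
  moreover have "lact N a y \<in> carrier N" if "a \<in> carrier A" "y \<in> carrier N" for a y
    using that by (auto simp: N_carrier lact la)
  ultimately have "left_module A N"
    unfolding left_module_def using M'
    by (auto simp: N_carrier add smult lact la sc A_closed)
  then show ?thesis
    unfolding isomorphic_modules_def using M bij by (auto simp: add smult lact)
qed

lemma isomorphic_modules_sym:
  assumes "isomorphic_modules A M N"
  shows "isomorphic_modules A N M"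
proof -
  from assms obtain \<phi> where M: "left_module A M" and N: "left_module A N"
    and bij: "bij_betw \<phi> (carrier M) (carrier N)"
    and add: "\<And>m n. m \<in> carrier M \<Longrightarrow> n \<in> carrier M \<Longrightarrow> \<phi> (m \<oplus>\<^bsub>M\<^esub> n) = \<phi> m \<oplus>\<^bsub>N\<^esub> \<phi> n"
    and smult: "\<And>c m. m \<in> carrier M \<Longrightarrow> \<phi> (c \<odot>\<^bsub>M\<^esub> m) = c \<odot>\<^bsub>N\<^esub> \<phi> m"
    and lact: "\<And>a m. a \<in> carrier A \<Longrightarrow> m \<in> carrier M \<Longrightarrow> \<phi> (lact M a m) = lact N a (\<phi> m)"
    unfolding isomorphic_modules_def by blast
  interpret M: Module.module field_ring M using M by (simp add: left_module_def)
  have closed: "c \<odot>\<^bsub>M\<^esub> m \<in> carrier M" "a \<in> carrier A \<Longrightarrow> lact M a m \<in> carrier M"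
    if "m \<in> carrier M" for c a m
    using M.smult_closed[of c m] M that by (auto simp: left_module_def field_ring_def)
  have inj: "inj_on \<phi> (carrier M)" and img: "carrier N = \<phi> ` carrier M"
    using bij by (auto simp: bij_betw_def)
  let ?\<psi> = "inv_into (carrier M) \<phi>"
  have "bij_betw ?\<psi> (carrier N) (carrier M)" by (rule bij_betw_inv_into[OF bij])
  then show ?thesis
    unfolding isomorphic_modules_def using M N
    by (intro conjI exI[of _ ?\<psi>])
      (auto simp: img inv_into_f_f[OF inj] closed simp flip: add smult lact)
qed

lemma isomorphic_modules_trans:
  assumes "isomorphic_modules A M N" "isomorphic_modules A N P"
  shows "isomorphic_modules A M P"
proof -
  from assms(1) obtain \<phi> where \<phi>: "bij_betw \<phi> (carrier M) (carrier N)"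
      "\<And>m n. m \<in> carrier M \<Longrightarrow> n \<in> carrier M \<Longrightarrow> \<phi> (m \<oplus>\<^bsub>M\<^esub> n) = \<phi> m \<oplus>\<^bsub>N\<^esub> \<phi> n"
      "\<And>c m. m \<in> carrier M \<Longrightarrow> \<phi> (c \<odot>\<^bsub>M\<^esub> m) = c \<odot>\<^bsub>N\<^esub> \<phi> m"
      "\<And>a m. a \<in> carrier A \<Longrightarrow> m \<in> carrier M \<Longrightarrow> \<phi> (lact M a m) = lact N a (\<phi> m)"
    unfolding isomorphic_modules_def by blast
  from assms(2) obtain \<psi> where \<psi>: "bij_betw \<psi> (carrier N) (carrier P)"
      "\<And>m n. m \<in> carrier N \<Longrightarrow> n \<in> carrier N \<Longrightarrow> \<psi> (m \<oplus>\<^bsub>N\<^esub> n) = \<psi> m \<oplus>\<^bsub>P\<^esub> \<psi> n"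
      "\<And>c m. m \<in> carrier N \<Longrightarrow> \<psi> (c \<odot>\<^bsub>N\<^esub> m) = c \<odot>\<^bsub>P\<^esub> \<psi> m"
      "\<And>a m. a \<in> carrier A \<Longrightarrow> m \<in> carrier N \<Longrightarrow> \<psi> (lact N a m) = lact P a (\<psi> m)"
    unfolding isomorphic_modules_def by blast
  have "\<phi> m \<in> carrier N" if "m \<in> carrier M" for m
    using that \<phi>(1) by (auto simp: bij_betw_def)
  then have "bij_betw (\<psi> \<circ> \<phi>) (carrier M) (carrier P) \<and>
     (\<forall>m\<in>carrier M. \<forall>n\<in>carrier M. (\<psi> \<circ> \<phi>) (m \<oplus>\<^bsub>M\<^esub> n) = (\<psi> \<circ> \<phi>) m \<oplus>\<^bsub>P\<^esub> (\<psi> \<circ> \<phi>) n) \<and>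
     (\<forall>c. \<forall>m\<in>carrier M. (\<psi> \<circ> \<phi>) (c \<odot>\<^bsub>M\<^esub> m) = c \<odot>\<^bsub>P\<^esub> (\<psi> \<circ> \<phi>) m) \<and>
     (\<forall>a\<in>carrier A. \<forall>m\<in>carrier M. (\<psi> \<circ> \<phi>) (lact M a m) = lact P a ((\<psi> \<circ> \<phi>) m))"
    using \<phi> \<psi> by (auto intro: bij_betw_trans)
  then show ?thesis
    using assms unfolding isomorphic_modules_def by blast
qed

section \<open>Cosets\<close>

text \<open>
All operations on quotients below are defined through \<open>on_cosets\<close>, so each of them is computed by
showing that some function is constant on a coset.
\<close>

lemma on_cosets_const:
  assumes "z \<in> C" "\<And>z. z \<in> C \<Longrightarrow> h z = v"
  shows "on_cosets h C = v"
proof -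
  have "h ` C = {v}" using assms by blast
  then show ?thesis by (simp add: on_cosets_def)
qed

lemma UN_const_on: "a \<in> A \<Longrightarrow> (\<And>y. y \<in> A \<Longrightarrow> f y = B) \<Longrightarrow> (\<Union>y\<in>A. f y) = B"
  by blast

section \<open>Boundary paths and the shift\<close>

text \<open>
The graph of the partial shift: \<open>q\<close> is \<open>p\<close> without its first arc.
\<close>

definition path_step :: "('v, 'e) pre_digraph \<Rightarrow> ('v, 'e) path \<Rightarrow> ('v, 'e) path \<Rightarrow> bool" where
  "path_step E p q \<longleftrightarrow> q \<in> boundary_paths E \<and>
     (\<exists>e\<in>arcs E. head E e = source E q \<and> p = conc (arc_path E e) q)"

definition fconc :: "('v, 'e) fpath \<Rightarrow> ('v, 'e) fpath \<Rightarrow> ('v, 'e) fpath" where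
  "fconc \<mu> \<kappa> = (fst \<mu>, snd \<mu> @ snd \<kappa>)"

lemma conc_fconc: "conc (fconc \<mu> \<kappa>) p = conc \<mu> (conc \<kappa> p)"
  by (cases p) (auto simp: fconc_def)

lemma plength_fconc [simp]: "plength (fconc \<mu> \<kappa>) = plength \<mu> + plength \<kappa>"
  by (simp add: fconc_def)

lemma frange_Nil [simp]: "frange E (u, []) = u"
  and frange_Cons [simp]: "frange E (u, e # es) = frange E (head E e, es)"
  by (auto simp: frange_def)

lemma frange_arc_path [simp]: "frange E (arc_path E e) = head E e"
  by (simp add: arc_path_def)

context wf_digraph
begin

lemma trivial_path_iff [simp]: "(u, []) \<in> finite_paths G \<longleftrightarrow> u \<in> verts G"
  unfolding finite_paths_def by simp (metis awalk_Nil_iff)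

lemma Cons_path_iff [simp]:
  "(u, e # es) \<in> finite_paths G \<longleftrightarrow> e \<in> arcs G \<and> u = tail G e \<and> (head G e, es) \<in> finite_paths G"
  unfolding finite_paths_def by simp (metis awalk_Cons_iff)

lemma arc_path_finite [simp]: "arc_path G e \<in> finite_paths G \<longleftrightarrow> e \<in> arcs G"
  by (auto simp: arc_path_def)

lemma fst_in_verts: "\<mu> \<in> finite_paths G \<Longrightarrow> fst \<mu> \<in> verts G"
  by (auto simp: finite_paths_def awalk_def)

lemma frange_in_verts: "\<mu> \<in> finite_paths G \<Longrightarrow> frange G \<mu> \<in> verts G"
proof (induction "snd \<mu>" arbitrary: \<mu>)
  case Nil then show ?case by (cases \<mu>) auto
next
  case (Cons e es)
  then show ?case by (cases \<mu>) force
qed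

lemma frange_fconc: "frange G \<mu> = fst \<kappa> \<Longrightarrow> frange G (fconc \<mu> \<kappa>) = frange G \<kappa>"
  by (auto simp: frange_def fconc_def)

lemma fconc_path:
  "\<mu> \<in> finite_paths G \<Longrightarrow> \<kappa> \<in> finite_paths G \<Longrightarrow> frange G \<mu> = fst \<kappa> \<Longrightarrow> fconc \<mu> \<kappa> \<in> finite_paths G"
proof (induction "snd \<mu>" arbitrary: \<mu>)
  case Nil then show ?case by (cases \<mu>) (auto simp: fconc_def)
next
  case (Cons e es)
  then show ?case
    using Cons.hyps(1)[of "(head G e, es)"] by (cases \<mu>) (auto simp: fconc_def)
qed

lemma fconc_pathD:
  "(u, xs @ ys) \<in> finite_paths G \<Longrightarrow> (u, xs) \<in> finite_paths G \<and> (frange G (u, xs), ys) \<in> finite_paths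
      G"
  by (induction xs arbitrary: u) (auto dest: fst_in_verts)

lemma InfPath_boundary_iff [simp]: "InfPath w \<in> boundary_paths G \<longleftrightarrow> w \<in> infinite_paths G"
  and FinPath_boundary_iff [simp]:
    "FinPath \<mu> \<in> boundary_paths G \<longleftrightarrow> \<mu> \<in> finite_paths G \<and> \<not> regular G (frange G \<mu>)"
  by (auto simp: boundary_paths_def)

lemma source_in_verts: "p \<in> boundary_paths G \<Longrightarrow> source G p \<in> verts G"
proof (cases p)
  case (InfPath w)
  moreover assume "p \<in> boundary_paths G"
  ultimately have "w \<in> infinite_paths G" by simp
  then have "w !! 0 \<in> arcs G" unfolding infinite_paths_def by blast
  then show ?thesis using InfPath by simp
next
  case (FinPath \<mu>)
  moreover assume "p \<in> boundary_paths G"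
  ultimately show ?thesis by (cases \<mu>) (auto simp: finite_paths_def fsource_def awalk_def)
qed

lemma source_conc:
  assumes "\<mu> \<in> finite_paths G" "frange G \<mu> = source G p"
  shows "source G (conc \<mu> p) = fst \<mu>"
proof (cases p)
  case (InfPath w)
  obtain u es where \<mu>: "\<mu> = (u, es)" by force
  show ?thesis using assms InfPath \<mu> by (cases es) auto
qed (simp add: fsource_def)

lemma infinite_paths_SCons:
  "e \<in> arcs G \<Longrightarrow> w \<in> infinite_paths G \<Longrightarrow> head G e = tail G (shd w) \<Longrightarrow> e ## w \<in> infinite_paths G"
proof -
  assume *: "e \<in> arcs G" "w \<in> infinite_paths G" "head G e = tail G (shd w)"
  have "(e ## w) !! i \<in> arcs G \<and> head G ((e ## w) !! i) = tail G ((e ## w) !! Suc i)" for i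
    using * by (cases i) (simp_all add: infinite_paths_def del: snth.simps(2), simp_all)
  then show ?thesis unfolding infinite_paths_def by blast
qed

lemma arc_conc_boundary:
  assumes "e \<in> arcs G" "p \<in> boundary_paths G" "head G e = source G p"
  shows "conc (arc_path G e) p \<in> boundary_paths G"
  using assms by (cases p) (auto simp: arc_path_def fsource_def infinite_paths_SCons)

lemma conc_Cons:
  "(u, e # es) \<in> finite_paths G \<Longrightarrow> conc (u, e # es) p = conc (arc_path G e) (conc (head G e, es) p)"
  by (cases p) (auto simp: arc_path_def)

lemma conc_trivial [simp]: "conc (source G p, []) p = p"
  by (cases p) (auto simp: fsource_def)

lemma conc_boundary:
  assumes "\<mu> \<in> finite_paths G" "p \<in> boundary_paths G" "frange G \<mu> = source G p"
  shows "conc \<mu> p \<in> boundary_paths G"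
  using assms
proof (induction "snd \<mu>" arbitrary: \<mu>)
  case Nil then show ?case by (cases \<mu>) auto
next
  case (Cons e es)
  then obtain u where \<mu>: "\<mu> = (u, e # es)" by (cases \<mu>) auto
  with Cons.prems have *: "e \<in> arcs G" "(head G e, es) \<in> finite_paths G"
    "frange G (head G e, es) = source G p" by auto
  then have "conc (head G e, es) p \<in> boundary_paths G"
    using Cons.hyps(1)[of "(head G e, es)"] Cons.prems(2) by simp
  then show ?case
    using * Cons.prems \<mu> by (simp add: conc_Cons arc_conc_boundary source_conc)
qed

text \<open>
For finite tails the arcs alone do not determine the tail (a trivial path carries its vertex), which
is why the sources have to be compared as well.
\<close>

lemma conc_cancel: "conc \<mu> p = conc \<mu> q \<Longrightarrow> source G p = source G q \<Longrightarrow> p = q"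
  by (cases p; cases q) (auto simp: fsource_def prod_eq_iff shift_left_inj)

text \<open>
This decides how two bisections are multiplied: of the two initial segments that meet, the longer one
extends the shorter one.
\<close>

lemma conc_eq_concD:
  assumes "\<mu> \<in> finite_paths G" "\<nu> \<in> finite_paths G" "conc \<mu> p = conc \<nu> q"
    and "frange G \<mu> = source G p" "frange G \<nu> = source G q" "plength \<mu> \<le> plength \<nu>"
  obtains \<kappa> where "\<kappa> \<in> finite_paths G" "fst \<kappa> = frange G \<mu>" "frange G \<kappa> = source G q"
    "\<nu> = fconc \<mu> \<kappa>" "p = conc \<kappa> q"
proof -
  have fst: "fst \<mu> = fst \<nu>" using source_conc assms by metis
  obtain ks where ks: "snd \<nu> = snd \<mu> @ ks"
  proof (cases p)
    case (FinPath p')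
    with assms(3) obtain q' where q': "q = FinPath q'" by (cases q) auto
    with q' FinPath assms(3) have "snd \<mu> @ snd p' = snd \<nu> @ snd q'" by simp
    then have "take (plength \<mu>) (snd \<mu> @ snd p') = take (plength \<mu>) (snd \<nu> @ snd q')" by simp
    then have "snd \<mu> = take (plength \<mu>) (snd \<nu>)" using assms(6) by simp
    then show thesis using that[of "drop (plength \<mu>) (snd \<nu>)"] by (metis append_take_drop_id)
  next
    case (InfPath w)
    with assms(3) obtain w' where "q = InfPath w'" by (cases q) auto
    with InfPath assms(3) have eq: "snd \<mu> @- w = snd \<nu> @- w'" by auto
    have "take (plength \<mu>) (snd \<nu>) = stake (plength \<mu>) (snd \<nu> @- w')"
      using assms(6) by (simp add: stake_shift)
    also have "\<dots> = snd \<mu>" by (simp add: eq[symmetric] stake_shift)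
    finally show thesis using that[of "drop (plength \<mu>) (snd \<nu>)"]
      by (metis append_take_drop_id)
  qed
  define \<kappa> where "\<kappa> = (frange G \<mu>, ks)"
  have \<nu>: "\<nu> = fconc \<mu> \<kappa>" using fst ks by (simp add: fconc_def \<kappa>_def prod_eq_iff)
  have \<kappa>: "\<kappa> \<in> finite_paths G"
    using fconc_pathD[of "fst \<mu>" "snd \<mu>" ks] assms(2) fst ks by (simp add: \<kappa>_def) (metis
        prod.collapse)
  have r: "frange G \<kappa> = source G q" using frange_fconc[of \<mu> \<kappa>] \<nu> assms(5) by (simp add: \<kappa>_def)
  have "source G (conc \<kappa> q) = source G p" using source_conc[OF \<kappa> r] assms(4) by (simp add: \<kappa>_def)
  then have "p = conc \<kappa> q" using assms(3) conc_cancel[of \<mu> p "conc \<kappa> q"] by (simp add: \<nu> conc_fconc)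
  then show thesis using that[OF \<kappa> _ r \<nu>] by (simp add: \<kappa>_def)
qed

lemma arc_conc_inj:
  assumes "conc (arc_path G e) q = conc (arc_path G e') q'"
    and "head G e = source G q" "head G e' = source G q'"
  shows "e = e'" "q = q'"
proof -
  show "e = e'" using assms(1) by (cases q; cases q') (auto simp: arc_path_def)
  then show "q = q'" using conc_cancel[of "arc_path G e" q q'] assms by simp
qed

lemma path_step_unique: "path_step G p q \<Longrightarrow> path_step G p q' \<Longrightarrow> q = q'"
  unfolding path_step_def by (metis arc_conc_inj(2))

lemma path_step_arc: "e \<in> arcs G \<Longrightarrow> q \<in> boundary_paths G \<Longrightarrow> head G e = source G q \<Longrightarrow>
    path_step G (conc (arc_path G e) q) q"
  by (auto simp: path_step_def)

lemma steps_unique: "(path_step G ^^ n) p q \<Longrightarrow> (path_step G ^^ n) p q' \<Longrightarrow> q = q'"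
proof (induction n arbitrary: p)
  case (Suc n)
  obtain r where "path_step G p r" "(path_step G ^^ n) r q"
    using Suc.prems(1) by (rule relpowp_Suc_E2)
  moreover obtain r' where "path_step G p r'" "(path_step G ^^ n) r' q'"
    using Suc.prems(2) by (rule relpowp_Suc_E2)
  ultimately show ?case using path_step_unique[of p r r'] Suc.IH by blast
qed simp

text \<open>
Of two points on an orbit of the shift, which is a partial function, one lies on the orbit of the
other. The closure of the groupoid under products and the analysis of loops both rest on this.
\<close>

lemma steps_split:
  assumes "(path_step G ^^ m) p q" "(path_step G ^^ n) p r" "m \<le> n"
  shows "(path_step G ^^ (n - m)) q r"
proof -
  have "(path_step G ^^ m OO path_step G ^^ (n - m)) p r"
    using assms by (simp flip: relpowp_add)
  then show ?thesis using steps_unique[OF assms(1)] by auto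
qed

lemma steps_trans: "(path_step G ^^ m) p q \<Longrightarrow> (path_step G ^^ n) q r \<Longrightarrow> (path_step G ^^ (m + n)) p r"
  by (auto simp: relpowp_add)

lemma steps_iff_conc:
  assumes "q \<in> boundary_paths G"
  shows "(path_step G ^^ n) p q \<longleftrightarrow>
    (\<exists>\<mu>\<in>finite_paths G. plength \<mu> = n \<and> frange G \<mu> = source G q \<and> p = conc \<mu> q)"
proof (induction n arbitrary: p)
  case 0
  show ?case using source_in_verts[OF assms]
    by (auto intro!: bexI[of _ "(source G q, [])"])
next
  case (Suc n)
  show ?case
  proof
    assume "(path_step G ^^ Suc n) p q"
    then obtain r where r: "path_step G p r" "(path_step G ^^ n) r q" by (rule relpowp_Suc_E2)
    then obtain e \<mu> where e: "e \<in> arcs G" "head G e = source G r" "p = conc (arc_path G e) r"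
      and \<mu>: "\<mu> \<in> finite_paths G" "plength \<mu> = n" "frange G \<mu> = source G q" "r = conc \<mu> q"
      using Suc.IH by (auto simp: path_step_def)
    have "head G e = fst \<mu>" using \<mu> e source_conc by simp
    with e \<mu> show "\<exists>\<mu>\<in>finite_paths G. plength \<mu> = Suc n \<and> frange G \<mu> = source G q \<and> p = conc \<mu> q"
      by (intro bexI[of _ "fconc (arc_path G e) \<mu>"])
        (auto simp: conc_fconc frange_fconc fconc_path, simp add: arc_path_def)
  next
    assume "\<exists>\<mu>\<in>finite_paths G. plength \<mu> = Suc n \<and> frange G \<mu> = source G q \<and> p = conc \<mu> q"
    then obtain u e es where \<mu>: "(u, e # es) \<in> finite_paths G" "length es = n"
      "frange G (u, e # es) = source G q" "p = conc (u, e # es) q"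
      by (auto simp: length_Suc_conv)
    have "(path_step G ^^ n) (conc (head G e, es) q) q"
      unfolding Suc.IH using \<mu> by (intro bexI[of _ "(head G e, es)"]) auto
    moreover have "path_step G p (conc (head G e, es) q)"
      using \<mu> assms source_conc[of "(head G e, es)" q]
      by (auto simp: conc_Cons intro!: path_step_arc conc_boundary)
    ultimately show "(path_step G ^^ Suc n) p q" by (metis relpowp_Suc_I2)
  qed
qed

lemma steps_boundary:
  assumes "(path_step G ^^ n) p q" "q \<in> boundary_paths G"
  shows "p \<in> boundary_paths G"
  using assms by (auto simp: steps_iff_conc conc_boundary)

section \<open>The path groupoid\<close>

lemma gpdI:
  assumes "\<mu> \<in> finite_paths G" "\<nu> \<in> finite_paths G" "r \<in> boundary_paths G"
    "frange G \<mu> = source G r" "frange G \<nu> = source G r"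
  shows "(conc \<mu> r, int (plength \<mu>) - int (plength \<nu>), conc \<nu> r) \<in> gpd G"
  using assms conc_boundary unfolding gpd_def by blast

text \<open>
The path groupoid is the groupoid of the partial shift (its Deaconu-Renault groupoid).
\<close>

lemma gpd_iff:
  "(p, k, q) \<in> gpd G \<longleftrightarrow> (\<exists>m n. \<exists>r\<in>boundary_paths G.
     (path_step G ^^ m) p r \<and> (path_step G ^^ n) q r \<and> k = int m - int n)" (is "_ \<longleftrightarrow> ?R")
proof
  assume "(p, k, q) \<in> gpd G"
  then obtain \<mu> \<nu> r where "p = conc \<mu> r" "q = conc \<nu> r" "k = int (plength \<mu>) - int (plength \<nu>)"
    "\<mu> \<in> finite_paths G" "\<nu> \<in> finite_paths G" "r \<in> boundary_paths G"
    "frange G \<mu> = source G r" "frange G \<nu> = source G r"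
    by (auto simp: gpd_def)
  then have "(path_step G ^^ plength \<mu>) p r" "(path_step G ^^ plength \<nu>) q r"
    by (auto simp: steps_iff_conc)
  with \<open>k = _\<close> \<open>r \<in> _\<close> show ?R by blast
next
  assume ?R
  then obtain m n r where r: "r \<in> boundary_paths G" "(path_step G ^^ m) p r" "(path_step G ^^ n) q
      r"
    "k = int m - int n" by auto
  then obtain \<mu> \<nu> where "\<mu> \<in> finite_paths G" "\<nu> \<in> finite_paths G" "p = conc \<mu> r" "q = conc \<nu> r"
    "frange G \<mu> = source G r" "frange G \<nu> = source G r" "k = int (plength \<mu>) - int (plength \<nu>)"
    unfolding steps_iff_conc[OF r(1)] by blast
  with r(1) show "(p, k, q) \<in> gpd G" using gpdI by simp
qed

lemma gpd_unit: "p \<in> boundary_paths G \<Longrightarrow> (p, 0, p) \<in> gpd G"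
  unfolding gpd_iff by (intro exI[of _ 0]) auto

lemma gpd_inverse: "(p, k, q) \<in> gpd G \<Longrightarrow> (q, - k, p) \<in> gpd G"
  unfolding gpd_iff by force

lemma gpd_boundary:
  assumes "(p, k, q) \<in> gpd G"
  shows "p \<in> boundary_paths G" "q \<in> boundary_paths G"
  using assms steps_boundary unfolding gpd_iff by blast+

text \<open>
Of the two tails at which the middle path \<open>q\<close> meets its neighbours, the one that is reached later
serves for the product.
\<close>

lemma gpd_mult:
  assumes "(p, k, q) \<in> gpd G" "(q, l, r) \<in> gpd G"
  shows "(p, k + l, r) \<in> gpd G"
proof -
  from assms obtain m n m' n' y z where y: "y \<in> boundary_paths G" "(path_step G ^^ m) p y"
    "(path_step G ^^ n) q y" "k = int m - int n"
    and z: "z \<in> boundary_paths G" "(path_step G ^^ m') q z"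
    "(path_step G ^^ n') r z" "l = int m' - int n'"
    unfolding gpd_iff by auto
  show ?thesis
  proof (cases "n \<le> m'")
    case True
    then have "(path_step G ^^ (m + (m' - n))) p z"
      using y z steps_split steps_trans by blast
    with z y True show ?thesis unfolding gpd_iff
      by (intro exI[of _ "m + (m' - n)"] exI[of _ n'] bexI[of _ z]) auto
  next
    case False
    then have "(path_step G ^^ (n' + (n - m'))) r y"
      using y z steps_split steps_trans by (meson nat_le_linear)
    with z y False show ?thesis unfolding gpd_iff
      by (intro exI[of _ m] exI[of _ "n' + (n - m')"] bexI[of _ y]) auto
  qed
qed

lemma gpd_arc:
  assumes "e \<in> arcs G" "p \<in> boundary_paths G" "head G e = source G p"
  shows "(conc (arc_path G e) p, 1, p) \<in> gpd G"
  unfolding gpd_iff using assms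
  by (intro exI[of _ 1] exI[of _ 0]) (auto simp: path_step_arc)

lemma Zset_iff:
  assumes "\<mu> \<in> finite_paths G" "\<nu> \<in> finite_paths G"
  shows "\<gamma> \<in> Zset G \<mu> \<nu> \<longleftrightarrow> (\<exists>y\<in>boundary_paths G. frange G \<mu> = source G y \<and> frange G \<nu> = source G y \<and>
     \<gamma> = (conc \<mu> y, int (plength \<mu>) - int (plength \<nu>), conc \<nu> y))"
  unfolding Zset_def using assms by (auto intro: gpdI)

lemma Zset_subset_gpd: "Zset G \<mu> \<nu> \<subseteq> gpd G"
  by (auto simp: Zset_def)

lemma tail_equiv_iff: "tail_equiv G p q \<longleftrightarrow> (\<exists>k. (p, k, q) \<in> gpd G)"
proof
  assume "tail_equiv G p q"
  then obtain \<mu> \<nu> r where "\<mu> \<in> finite_paths G" "\<nu> \<in> finite_paths G" "r \<in> boundary_paths G"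
    "frange G \<mu> = source G r" "frange G \<nu> = source G r" "p = conc \<mu> r" "q = conc \<nu> r"
    unfolding tail_equiv_def by blast
  then have "(p, int (plength \<mu>) - int (plength \<nu>), q) \<in> gpd G" using gpdI by simp
  then show "\<exists>k. (p, k, q) \<in> gpd G" by blast
qed (auto simp: tail_equiv_def gpd_def)

end

section \<open>Isotropy at irrational paths\<close>

lemma cycle_unique:
  assumes "xs \<noteq> []" "w = xs @- w"
  shows "w = Stream.cycle xs"
proof -
  have "w !! n = Stream.cycle xs !! n" for n
  proof (induction n rule: less_induct)
    case (less n)
    have "w !! n = (xs @- w) !! n" "Stream.cycle xs !! n = (xs @- Stream.cycle xs) !! n"
      using assms(2) cycle_decomp[OF assms(1)] by metis+
    moreover have "n - length xs < n" if "\<not> n < length xs" using that assms(1) by (cases n) auto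
    ultimately show ?case
      using less[of "n - length xs"] assms(1)
      by (cases "n < length xs") auto
  qed
  then have "smap ((!!) w) nats = smap ((!!) (Stream.cycle xs)) nats" by (intro stream.map_cong)
      auto
  then show ?thesis by (metis stream_smap_nats)
qed

lemma shift_concat_replicate:
  "w = xs @- w \<Longrightarrow> w = concat (replicate m xs) @- w"
proof (induction m)
  case (Suc m)
  have "concat (replicate (Suc m) xs) @- w = xs @- (concat (replicate m xs) @- w)" by simp
  then show ?case using Suc by simp
qed simp

context wf_digraph
begin

lemma infinite_path_prefix:
  "es @- w \<in> infinite_paths G \<Longrightarrow> w \<in> infinite_paths G \<and>
     (tail G (shd (es @- w)), es) \<in> finite_paths G \<and>
     frange G (tail G (shd (es @- w)), es) = tail G (shd w)"
proof (induction es)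
  case Nil
  then show ?case using source_in_verts[of "InfPath w"] by auto
next
  case (Cons e es)
  then have *: "(e ## (es @- w)) !! i \<in> arcs G"
    "head G ((e ## (es @- w)) !! i) = tail G ((e ## (es @- w)) !! Suc i)" for i
    unfolding infinite_paths_def by auto
  have "es @- w \<in> infinite_paths G"
    using *[of "Suc _"] unfolding infinite_paths_def by simp
  with Cons.IH *[of 0] show ?case by simp
qed

text \<open>
Take the shortest period of \<open>w\<close>. If it were a proper power of a closed path, the base of that power would
be a shorter period.
\<close>

lemma periodic_simple_cycle:
  assumes "w \<in> infinite_paths G" "xs \<noteq> []" "w = xs @- w"
  obtains c where "simple_closed_path G c" "w = Stream.cycle (snd c)"
proof -
  let ?P = "\<lambda>d. d \<noteq> [] \<and> w = d @- w"
  obtain d where d: "?P d" and least: "\<And>d'. ?P d' \<Longrightarrow> length d \<le> length d'"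
    using ex_has_least_nat[of ?P xs length] assms(2,3) by blast
  then have eq: "d @- w = w" by simp
  define c where "c = (tail G (shd w), d)"
  have "closed_path G c"
    using infinite_path_prefix[of d w] assms(1) conjunct1[OF d]
    unfolding eq by (simp add: closed_path_def c_def fsource_def)
  moreover have "d' = c" if d': "closed_path G d'" and pow: "c = path_power d' m" for d' m
  proof -
    have ne: "snd d' \<noteq> []" and dd: "d = concat (replicate m (snd d'))"
      and fst: "fst d' = fst c"
      using d' pow by (auto simp: closed_path_def path_power_def c_def)
    define v where "v = Stream.cycle (snd d')"
    have v: "v = snd d' @- v" unfolding v_def by (rule cycle_decomp[OF ne])
    then have "v = d @- v" unfolding dd by (rule shift_concat_replicate)
    then have "v = w" using cycle_unique[of d v] cycle_unique[of d w] d by blast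
    with v ne have "length d \<le> length (snd d')" by (intro least) blast
    moreover have "length d = m * length (snd d')" by (simp add: dd length_concat
        sum_list_replicate)
    moreover have "m \<noteq> 0" using conjunct1[OF d] dd by auto
    ultimately have "m = 1" using ne by (cases m) simp_all
    then show ?thesis using dd fst by (simp add: c_def prod_eq_iff)
  qed
  ultimately have "simple_closed_path G c" by (auto simp: simple_closed_path_def)
  moreover have "w = Stream.cycle (snd c)" using cycle_unique[of d w] d unfolding c_def snd_conv by
      blast
  ultimately show thesis by (rule that)
qed

text \<open>
A loop of nonzero degree at \<open>x\<close> yields two different numbers of steps from \<open>x\<close> to one tail \<open>r\<close>, so \<open>r\<close>
is a proper tail of itself. A finite path cannot be that, and an infinite one is then periodic.
\<close>

lemma gpd_loop_rational:
  assumes "(x, k, x) \<in> gpd G" "k \<noteq> 0"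
  shows "x \<in> rational_paths G"
proof -
  obtain m n r where r: "r \<in> boundary_paths G" "(path_step G ^^ m) x r" "(path_step G ^^ n) x r"
    "k = int m - int n"
    using assms(1) unfolding gpd_iff by auto
  have "\<exists>d>0. (path_step G ^^ d) r r"
  proof (cases "m < n")
    case True
    then show ?thesis using steps_split[OF r(2,3)] by (intro exI[of _ "n - m"]) auto
  next
    case False
    then show ?thesis using steps_split[OF r(3,2)] r(4) assms(2) by (intro exI[of _ "m - n"]) auto
  qed
  then obtain \<mu> where \<mu>: "snd \<mu> \<noteq> []" "r = conc \<mu> r"
    unfolding steps_iff_conc[OF r(1)] by auto
  have "\<exists>w. r = InfPath w \<and> w = snd \<mu> @- w"
  proof (cases r)
    case (FinPath q)
    with \<mu>(2) have "snd q = snd \<mu> @ snd q" by (cases q) simp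
    with \<mu>(1) show ?thesis by simp
  qed (use \<mu>(2) in simp)
  then obtain w where w: "r = InfPath w" "w = snd \<mu> @- w" by blast
  obtain c where c: "simple_closed_path G c" "w = Stream.cycle (snd c)"
    using periodic_simple_cycle[of w "snd \<mu>"] \<mu> w r(1) by auto
  have "x \<in> InfPath ` infinite_paths G"
    using r(1,2) w(1) steps_boundary[OF r(2,1)] unfolding steps_iff_conc[OF r(1)] by auto
  moreover have "tail_equiv G x (InfPath (Stream.cycle (snd c)))"
    unfolding tail_equiv_iff gpd_iff
    using r(1,2) w(1) c(2) by (intro exI[of _ "int m"] exI[of _ m] exI[of _ 0] bexI[of _ r]) auto
  ultimately show ?thesis using c(1) unfolding rational_paths_def by blast
qed

text \<open>
Two arrows with the same ends differ by a loop at \<open>x\<close>.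
\<close>

lemma arrow_degree_unique:
  assumes "x \<notin> rational_paths G" "(p, k, x) \<in> gpd G" "(p, l, x) \<in> gpd G"
  shows "k = l"
  using gpd_loop_rational[OF gpd_mult[OF gpd_inverse[OF assms(2)] assms(3)]] assms(1) by auto

lemma isotropy_trivial:
  assumes "x \<in> boundary_paths G - rational_paths G"
  shows "carrier (isotropy G x) = {gunit x}"
proof -
  have "k = 0" if "(x, k, x) \<in> gpd G" for k using gpd_loop_rational[OF that] assms by blast
  then show ?thesis using assms gpd_unit[of x]
    by (auto simp: isotropy_def gunit_def gsource_def grange_def)
qed

lemma isotropy_algebra_iso:
  assumes "x \<in> boundary_paths G - rational_paths G"
  shows "(coefficient_sum :: _ \<Rightarrow> 'k::field) \<in> ring_iso (isotropy_algebra G x) field_ring"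
proof -
  have carrier: "carrier (isotropy_algebra G x) = range (Poly_Mapping.single (gunit x) :: 'k \<Rightarrow> _)"
    by (auto simp: isotropy_algebra_def isotropy_trivial[OF assms] keys_subset_singleton)
  show ?thesis
    unfolding ring_iso_def ring_hom_def carrier
    by (auto simp: field_ring_def isotropy_algebra_def gmult_def gunit_def gsource_def grange_def
        bij_betw_def inj_on_def image_iff simp flip: single_add)
qed

end

section \<open>Weights of paths\<close>

fun path_prefix :: "nat \<Rightarrow> ('v, 'e) path \<Rightarrow> 'e list" where
  "path_prefix n (FinPath \<mu>) = take n (snd \<mu>)"
| "path_prefix n (InfPath w) = stake n w"

definition prefix_weight :: "('e \<Rightarrow> 'k::field) \<Rightarrow> nat \<Rightarrow> ('v, 'e) path \<Rightarrow> 'k" where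
  "prefix_weight a n p = prod_list (map a (path_prefix n p))"

text \<open>
The scalar by which the basis arrow from \<open>p\<close> to \<open>x\<close> is rescaled in the comparison with the twisted Chen
module. It is chosen through an arbitrary common tail of \<open>p\<close> and \<open>x\<close>; for irrational \<open>x\<close> the
choice does not matter, by \<open>path_weight_eq\<close>.
\<close>

definition path_weight ::
  "('v, 'e) pre_digraph \<Rightarrow> ('e \<Rightarrow> 'k::field) \<Rightarrow> ('v, 'e) path \<Rightarrow> ('v, 'e) path \<Rightarrow> 'k" where
  "path_weight E a x p = (SOME c. \<exists>m n. \<exists>r\<in>boundary_paths E. (path_step E ^^ m) p r \<and>
     (path_step E ^^ n) x r \<and> c = prefix_weight a m p / prefix_weight a n x)"

context wf_digraph
begin

lemma prefix_weight_0 [simp]: "prefix_weight a 0 p = 1"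
  by (cases p) (auto simp: prefix_weight_def)

lemma prefix_weight_arc [simp]:
  "prefix_weight a (Suc n) (conc (arc_path G e) p) = a e * prefix_weight a n p"
  by (cases p) (auto simp: prefix_weight_def arc_path_def)

lemma prefix_weight_add:
  "(path_step G ^^ m) p q \<Longrightarrow> prefix_weight a (m + n) p = prefix_weight a m p * prefix_weight a n q"
proof (induction m arbitrary: p)
  case (Suc m)
  obtain r where r: "path_step G p r" "(path_step G ^^ m) r q"
    using Suc.prems by (rule relpowp_Suc_E2)
  from r(1) obtain e where "p = conc (arc_path G e) r" by (auto simp: path_step_def)
  with Suc.IH[OF r(2)] show ?case by simp
qed simp

lemma prefix_weight_nonzero:
  assumes "\<And>e. e \<in> arcs G \<Longrightarrow> a e \<noteq> 0"
  shows "(path_step G ^^ m) p q \<Longrightarrow> prefix_weight a m p \<noteq> 0"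
proof (induction m arbitrary: p)
  case (Suc m)
  obtain r where r: "path_step G p r" "(path_step G ^^ m) r q"
    using Suc.prems by (rule relpowp_Suc_E2)
  from r(1) obtain e where "e \<in> arcs G" "p = conc (arc_path G e) r" by (auto simp: path_step_def)
  with Suc.IH[OF r(2)] assms show ?case by simp
qed simp

text \<open>
Two common tails of \<open>p\<close> and \<open>x\<close> are reached after \<open>(m, n)\<close> and \<open>(m + j, n + j)\<close> steps with the
same \<open>j\<close>, because \<open>m - n\<close> is the unique degree. The \<open>j\<close> additional arcs are the same in \<open>p\<close> and in \<open>x\<close>
and cancel in the quotient.
\<close>

lemma path_weight_eq:
  assumes a: "\<And>e. e \<in> arcs G \<Longrightarrow> a e \<noteq> 0" and x: "x \<notin> rational_paths G"
    and r: "r \<in> boundary_paths G" "(path_step G ^^ m) p r" "(path_step G ^^ n) x r"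
  shows "path_weight G a x p = prefix_weight a m p / prefix_weight a n x"
proof -
  have *: "prefix_weight a m' p / prefix_weight a n' x = prefix_weight a m p / prefix_weight a n x"
    if r: "r \<in> boundary_paths G" "(path_step G ^^ m) p r" "(path_step G ^^ n) x r"
      and r': "r' \<in> boundary_paths G" "(path_step G ^^ m') p r'" "(path_step G ^^ n') x r'"
      and le: "m \<le> m'" for m n r m' n' r'
  proof -
    have "int m - int n = int m' - int n'"
      by (rule arrow_degree_unique[OF x, of p]; unfold gpd_iff) (use r r' in blast)+
    then obtain j where j: "m' = m + j" "n' = n + j" using le by (intro that[of "m' - m"]) auto
    have "(path_step G ^^ j) r r'" using steps_split[OF r(2) r'(2)] j by simp
    then have "prefix_weight a j r \<noteq> 0" using prefix_weight_nonzero a by blast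
    then show ?thesis by (simp add: j prefix_weight_add[OF r(2)] prefix_weight_add[OF r(3)])
  qed
  have "path_weight G a x p = (SOME c. c = prefix_weight a m p / prefix_weight a n x)"
    unfolding path_weight_def
    by (rule arg_cong[where f = Eps], rule ext) (use * r nat_le_linear in metis)
  then show ?thesis by simp
qed

lemma path_weight_nonzero:
  assumes a: "\<And>e. e \<in> arcs G \<Longrightarrow> a e \<noteq> 0" and x: "x \<notin> rational_paths G"
    and p: "(p, k, x) \<in> gpd G"
  shows "path_weight G a x p \<noteq> 0"
proof -
  obtain m n r where r: "r \<in> boundary_paths G" "(path_step G ^^ m) p r" "(path_step G ^^ n) x r"
    using p unfolding gpd_iff by blast
  then have "prefix_weight a m p \<noteq> 0" "prefix_weight a n x \<noteq> 0"
    using prefix_weight_nonzero a by blast+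
  then show ?thesis using path_weight_eq[OF a x r] by simp
qed

text \<open>
The cocycle identity that absorbs the twist.
\<close>

lemma path_weight_arc:
  assumes a: "\<And>e. e \<in> arcs G \<Longrightarrow> a e \<noteq> 0" and x: "x \<notin> rational_paths G"
    and p: "(p, k, x) \<in> gpd G" and e: "e \<in> arcs G" "head G e = source G p"
  shows "path_weight G a x (conc (arc_path G e) p) = a e * path_weight G a x p"
proof -
  obtain m n r where r: "r \<in> boundary_paths G" "(path_step G ^^ m) p r" "(path_step G ^^ n) x r"
    using p unfolding gpd_iff by blast
  have "(path_step G ^^ Suc m) (conc (arc_path G e) p) r"
    using r(2) path_step_arc[OF e(1) gpd_boundary(1)[OF p] e(2)] by (rule relpowp_Suc_I2[rotated])
  from path_weight_eq[OF a x r(1) this r(3)] path_weight_eq[OF a x r] show ?thesis by simp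
qed

end

section \<open>Induction from a trivial isotropy group\<close>

text \<open>
The additive extension of \<open>(m, c) \<mapsto> c m\<close> from generators to the free abelian group on pairs.
\<close>

definition tensor_eval :: "(('a \<Rightarrow>\<^sub>0 'k::field) \<times> 'k \<Rightarrow>\<^sub>0 int) \<Rightarrow> ('a \<Rightarrow>\<^sub>0 'k)" where
  "tensor_eval z = (\<Sum>i\<in>keys z. pm_scale (of_int (lookup z i) * snd i) (fst i))"

lemma tensor_eval_superset:
  assumes "finite S" "keys z \<subseteq> S"
  shows "tensor_eval z = (\<Sum>i\<in>S. pm_scale (of_int (lookup z i) * snd i) (fst i))"
  unfolding tensor_eval_def
  by (rule sum.mono_neutral_left) (use assms in \<open>auto simp: in_keys_iff\<close>)

lemma tensor_eval_zero [simp]: "tensor_eval 0 = 0"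
  by (simp add: tensor_eval_def)

lemma tensor_eval_of [simp]: "tensor_eval (frag_of (m, c)) = pm_scale c m"
  by (simp add: tensor_eval_def)

lemma tensor_eval_diff: "tensor_eval (z - z') = tensor_eval z - tensor_eval z'"
  using keys_diff[of z z']
  by (simp add: tensor_eval_superset[of "keys z \<union> keys z'"] lookup_minus left_diff_distrib
      pm.scale_left_diff_distrib sum_subtractf)

lemma tensor_eval_add: "tensor_eval (z + z') = tensor_eval z + tensor_eval z'"
  using tensor_eval_diff[of "z + z'" z'] by (simp add: algebra_simps)

lemma tensor_eval_uminus: "tensor_eval (- z) = - tensor_eval z"
  using tensor_eval_diff[of 0 z] by simp

lemma tensor_eval_keys:
  assumes "keys z \<subseteq> C \<times> UNIV" "\<And>m. m \<in> C \<Longrightarrow> keys m \<subseteq> Y"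
  shows "keys (tensor_eval z) \<subseteq> Y"
  unfolding tensor_eval_def
proof (rule keys_sum_subset, rule keys_pm_scale_subset)
  fix i assume "i \<in> keys z"
  then have "fst i \<in> C" using assms(1) by auto
  then show "keys (fst i) \<subseteq> Y" by (rule assms(2))
qed

lemma tensor_eval_frag_extend:
  fixes g :: "('a \<Rightarrow>\<^sub>0 'k::field) \<Rightarrow> ('a \<Rightarrow>\<^sub>0 'k)" and z :: "(('a \<Rightarrow>\<^sub>0 'k) \<times> 'k) \<Rightarrow>\<^sub>0 int"
  assumes "pm_linear g"
  shows "tensor_eval (frag_extend (\<lambda>(m, c). frag_of (g m, c)) z) = g (tensor_eval z)"
proof (rule frag_induction[of z UNIV])
  fix i :: "('a \<Rightarrow>\<^sub>0 'k) \<times> 'k"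
  show "tensor_eval (frag_extend (\<lambda>(m, c). frag_of (g m, c)) (frag_of i)) = g (tensor_eval (frag_of
      i))"
    by (cases i) (simp add: pm_linear_scale[OF assms])
qed (simp_all add: pm_linear_zero[OF assms] pm_linear_diff[OF assms] frag_extend_diff
    tensor_eval_diff)

lemma keys_frag_extend_of:
  assumes "keys z \<subseteq> C \<times> UNIV" "\<And>m. m \<in> C \<Longrightarrow> g m \<in> C"
  shows "keys (frag_extend (\<lambda>(m, c). frag_of (g m, c)) z) \<subseteq> C \<times> UNIV"
  using keys_frag_extend[of "\<lambda>(m, c). frag_of (g m, c)" z] assms by fastforce

lemma gmult_gunit: "t \<in> arrows_to E x \<Longrightarrow> gmult t (gunit x) = t"
  by (auto simp: arrows_to_def gmult_def gunit_def gsource_def grange_def)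

definition arrow_space :: "('v, 'e) pre_digraph \<Rightarrow> ('v, 'e) path \<Rightarrow> (('v, 'e) garrow \<Rightarrow>\<^sub>0 'k::field)
    set" where
  "arrow_space E x = {m. keys m \<subseteq> arrows_to E x}"

lemma arrow_space_iff: "m \<in> arrow_space E x \<longleftrightarrow> keys m \<subseteq> arrows_to E x"
  by (simp add: arrow_space_def)

lemma arrow_space_zero: "0 \<in> arrow_space E x"
  and arrow_space_add: "m \<in> arrow_space E x \<Longrightarrow> m' \<in> arrow_space E x \<Longrightarrow> m + m' \<in> arrow_space E x"
  and arrow_space_scale: "m \<in> arrow_space E x \<Longrightarrow> pm_scale c m \<in> arrow_space E x"
  by (simp_all add: arrow_space_iff keys_add_subset keys_pm_scale_subset)

lemma arrow_space_uminus: "m \<in> arrow_space E x \<Longrightarrow> - m \<in> arrow_space E x"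
  by (simp add: arrow_space_iff)

lemma arrow_space_diff: "m \<in> arrow_space E x \<Longrightarrow> m' \<in> arrow_space E x \<Longrightarrow> m - m' \<in> arrow_space E x"
  using arrow_space_add[OF _ arrow_space_uminus, of m E x m'] by simp

lemma arrows_bimodule_simps [simp]:
  "carrier (arrows_bimodule E x) = arrow_space E x"
  "\<zero>\<^bsub>arrows_bimodule E x\<^esub> = 0"
  "m \<oplus>\<^bsub>arrows_bimodule E x\<^esub> m' = m + m'"
  "c \<odot>\<^bsub>arrows_bimodule E x\<^esub> m = pm_scale c m"
  "lact (arrows_bimodule E x) = arrows_lact E x"
  "ract (arrows_bimodule E x) = bilinear_extend gmult"
  by (simp_all add: arrows_bimodule_def arrow_space_def)

locale trivial_isotropy = wf_digraph +
  fixes x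
  assumes trivial_isotropy: "carrier (isotropy G x) = {gunit x}"
begin

abbreviation (input) "pair_group \<equiv> free_Abelian_group (arrow_space G x \<times> (UNIV :: 'k::field set))"

definition tensor_kernel :: "(((('a, 'b) garrow \<Rightarrow>\<^sub>0 'k::field) \<times> 'k) \<Rightarrow>\<^sub>0 int) set" where
  "tensor_kernel = generate pair_group (tensor_relations (arrows_bimodule G x) (isotropy_algebra G
      x) scalar_module)"

definition simple_tensor :: "(('a, 'b) garrow \<Rightarrow>\<^sub>0 'k::field) \<Rightarrow> ((('a, 'b) garrow \<Rightarrow>\<^sub>0 'k) \<times> 'k \<Rightarrow>\<^sub>0
    int) set" where
  "simple_tensor m = tensor_kernel #>\<^bsub>pair_group\<^esub> frag_of (m, 1)"

text \<open>
This is where trivial isotropy enters the tensor product: every element of the group algebra is a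
multiple of the unit, and the unit acts trivially on the right of the space of arrows.
\<close>

lemma isotropy_algebra_carrier:
  "carrier (isotropy_algebra G x) = range (Poly_Mapping.single (gunit x))"
  by (auto simp: isotropy_algebra_def trivial_isotropy keys_subset_singleton)

lemma ract_single:
  fixes m :: "('a, 'b) garrow \<Rightarrow>\<^sub>0 'k::field"
  assumes "m \<in> arrow_space G x"
  shows "ract (arrows_bimodule G x) m (Poly_Mapping.single (gunit x) c) = pm_scale c m"
proof -
  have "ract (arrows_bimodule G x) m (Poly_Mapping.single (gunit x) c) =
      linear_extend (\<lambda>t. pm_scale c (Poly_Mapping.single t 1)) m"
    using assms by (auto simp: arrow_space_iff bilinear_extend_conv_linear_extend gmult_gunit
        intro!: linear_extend_cong)
  then show ?thesis by (simp only: linear_extend_scale_fun linear_extend_id)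
qed

lemma tensor_relations_conv:
  "tensor_relations (arrows_bimodule G x) (isotropy_algebra G x) (scalar_module :: ('k::field, _,
      'k) lmodule) =
     {frag_of (m + m', c) - frag_of (m, c) - frag_of (m', c) | m m' c.
        m \<in> arrow_space G x \<and> m' \<in> arrow_space G x} \<union>
     {frag_of (m, c + c') - frag_of (m, c) - frag_of (m, c') | m c c'. m \<in> arrow_space G x} \<union>
     {frag_of (pm_scale d m, c) - frag_of (m, d * c) | m d c. m \<in> arrow_space G x}"
proof -
  let ?s = "Poly_Mapping.single (gunit x) :: 'k \<Rightarrow> _" and ?B = "arrows_bimodule G x"
  have "{frag_of (ract ?B m r, w) - frag_of (m, lact scalar_module r w) | m r w.
        m \<in> arrow_space G x \<and> r \<in> range ?s \<and> w \<in> UNIV} =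
     {frag_of (ract ?B m (?s d), c) - frag_of (m, lact scalar_module (?s d) c) | m d c. m \<in>
         arrow_space G x}"
    by blast
  also have "\<dots> = {frag_of (pm_scale d m, c) - frag_of (m, d * c) | m d c. m \<in> arrow_space G x}"
    using ract_single[where ?'k = 'k] by (simp add: scalar_module_def cong: rev_conj_cong)
  finally show ?thesis
    unfolding tensor_relations_def isotropy_algebra_carrier
    by (simp add: scalar_module_def)
qed

lemma tensor_relations_subset:
  "tensor_relations (arrows_bimodule G x) (isotropy_algebra G x) scalar_module \<subseteq> carrier pair_group"
proof -
  have keys2: "keys (frag_of i - frag_of j) \<subseteq> S" if "i \<in> S" "j \<in> S" for i j :: 'z and S
    using that keys_diff[of "frag_of i" "frag_of j"] by auto
  have keys3: "keys (frag_of i - frag_of j - frag_of l) \<subseteq> S" if "i \<in> S" "j \<in> S" "l \<in> S" for i j l ::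
      'z and S
    using that keys_diff[of "frag_of i - frag_of j" "frag_of l"] keys2[of i S j] by auto
  show ?thesis
  proof (rule subsetI)
    fix z assume "z \<in> tensor_relations (arrows_bimodule G x) (isotropy_algebra G x) scalar_module"
    then show "z \<in> carrier pair_group"
      unfolding tensor_relations_conv carrier_free_Abelian_group_iff
      by (elim UnE CollectE exE conjE; hypsubst)
        ((rule keys3 keys2; simp add: arrow_space_add arrow_space_scale)+)
  qed
qed

lemma subgroup_tensor_kernel: "subgroup tensor_kernel pair_group"
  unfolding tensor_kernel_def by (rule group.generate_is_subgroup[OF group_free_Abelian_group
      tensor_relations_subset])

lemma tensor_kernel_normal: "tensor_kernel \<lhd> pair_group"
  using subgroup_tensor_kernel by (simp add: comm_group.normal_iff_subgroup
      abelian_free_Abelian_group)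

lemma tensor_kernel_carrier: "h \<in> tensor_kernel \<Longrightarrow> keys h \<subseteq> arrow_space G x \<times> UNIV"
  using subsetD[OF subgroup.subset[OF subgroup_tensor_kernel]] by (simp only:
      carrier_free_Abelian_group_iff)

lemma tensor_kernel_zero: "0 \<in> tensor_kernel"
  using subgroup.one_closed[OF subgroup_tensor_kernel] by simp

lemma tensor_kernel_uminus: "h \<in> tensor_kernel \<Longrightarrow> - h \<in> tensor_kernel"
proof -
  assume h: "h \<in> tensor_kernel"
  have "inv\<^bsub>pair_group\<^esub> h \<in> tensor_kernel" by (rule subgroup.m_inv_closed[OF subgroup_tensor_kernel
      h])
  then show ?thesis by (simp only: inv_free_Abelian_group[OF tensor_kernel_carrier[OF h]])
qed

lemma tensor_kernel_add: "h \<in> tensor_kernel \<Longrightarrow> h' \<in> tensor_kernel \<Longrightarrow> h + h' \<in> tensor_kernel"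
  using subgroup.m_closed[OF subgroup_tensor_kernel, of h h'] by simp

lemma tensor_kernel_diff: "h \<in> tensor_kernel \<Longrightarrow> h' \<in> tensor_kernel \<Longrightarrow> h - h' \<in> tensor_kernel"
  using tensor_kernel_add[OF _ tensor_kernel_uminus, of h h'] by simp

lemma tensor_eval_kernel: "h \<in> tensor_kernel \<Longrightarrow> tensor_eval h = 0"
  unfolding tensor_kernel_def
proof (induction rule: generate.induct)
  case (incl h)
  then show ?case unfolding tensor_relations_conv
    by (auto simp: tensor_eval_diff pm.scale_right_distrib pm.scale_left_distrib mult.commute)
next
  case (inv h)
  then have "keys h \<subseteq> arrow_space G x \<times> UNIV"
    using subsetD[OF tensor_relations_subset] by (simp only: carrier_free_Abelian_group_iff)
  then have "tensor_eval (inv\<^bsub>pair_group\<^esub> h) = - tensor_eval h"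
    by (simp only: inv_free_Abelian_group tensor_eval_uminus)
  also have "tensor_eval h = 0" using inv unfolding tensor_relations_conv
    by (auto simp: tensor_eval_diff pm.scale_right_distrib pm.scale_left_distrib mult.commute)
  finally show ?case by simp
next
  case (eng h h')
  then show ?case by (simp add: tensor_eval_add)
qed simp

lemma tensor_relation_in_tensor_kernel:
  "z \<in> tensor_relations (arrows_bimodule G x) (isotropy_algebra G x) scalar_module \<Longrightarrow> z \<in>
      tensor_kernel"
  unfolding tensor_kernel_def by (rule generate.incl)

text \<open>
Modulo the tensor relations \<open>m \<otimes> c = c m \<otimes> 1\<close> by balancedness, and the elements \<open>m \<otimes> 1\<close> are closed
under differences by additivity in \<open>m\<close>. So every element of the free abelian group is congruent to
\<open>m \<otimes> 1\<close> with \<open>m\<close> its evaluation; together with \<open>tensor_eval_kernel\<close> this shows that the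
relations generate exactly the kernel of the evaluation.
\<close>

lemma minus_eval_in_tensor_kernel:
  "keys z \<subseteq> arrow_space G x \<times> UNIV \<Longrightarrow> z - frag_of (tensor_eval z, 1) \<in> tensor_kernel"
proof -
  assume "keys z \<subseteq> arrow_space G x \<times> UNIV"
  then have "(tensor_eval z) \<in> arrow_space G x \<and> z - frag_of (tensor_eval z, 1) \<in> tensor_kernel"
  proof (induction z rule: frag_induction[consumes 1, case_names zero one diff])
    case zero
    \<comment> \<open>Additivity at \<open>0 + 0\<close> gives \<open>0 \<otimes> 1 = 0\<close>.\<close>
    have "frag_of (0 + 0, 1) - frag_of (0, 1) - frag_of (0, 1) \<in> tensor_kernel"
      by (rule tensor_relation_in_tensor_kernel, unfold tensor_relations_conv) (use arrow_space_zero
          in blast)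
    then show ?case by (simp add: arrow_space_zero)
  next
    case (one i)
    then obtain m c where i: "i = (m, c)" "m \<in> arrow_space G x" by auto
    have "frag_of (pm_scale c m, 1) - frag_of (m, c * 1) \<in> tensor_kernel"
      by (rule tensor_relation_in_tensor_kernel, unfold tensor_relations_conv) (use i in blast)
    from tensor_kernel_uminus[OF this] i show ?case by (simp add: arrow_space_scale)
  next
    case (diff a b)
    let ?m = "tensor_eval a - tensor_eval b"
    have m: "?m \<in> arrow_space G x" using diff arrow_space_diff by blast
    have "frag_of (?m + tensor_eval b, 1) - frag_of (?m, 1) - frag_of (tensor_eval b, 1) \<in>
        tensor_kernel"
      by (rule tensor_relation_in_tensor_kernel, unfold tensor_relations_conv) (use diff m in blast)
    moreover have "(a - frag_of (tensor_eval a, 1)) - (b - frag_of (tensor_eval b, 1)) \<in>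
        tensor_kernel"
      by (rule tensor_kernel_diff) (use diff in blast)+
    ultimately have "((a - frag_of (tensor_eval a, 1)) - (b - frag_of (tensor_eval b, 1))) +
       (frag_of (?m + tensor_eval b, 1) - frag_of (?m, 1) - frag_of (tensor_eval b, 1)) \<in>
           tensor_kernel"
      by (rule tensor_kernel_add[rotated])
    then show ?case using m by (simp add: tensor_eval_diff algebra_simps)
  qed
  then show ?thesis by blast
qed

lemma coset_eq_simple_tensor:
  assumes "keys z \<subseteq> arrow_space G x \<times> UNIV"
  shows "tensor_kernel #>\<^bsub>pair_group\<^esub> z = simple_tensor (tensor_eval z)"
proof -
  let ?w = "frag_of (tensor_eval z, 1)"
  have d: "z - ?w \<in> tensor_kernel" using minus_eval_in_tensor_kernel[OF assms] .
  have "h + z \<in> (\<lambda>h. h + ?w) ` tensor_kernel" if "h \<in> tensor_kernel" for h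
    using tensor_kernel_add[OF that d] by (intro image_eqI[of _ _ "h + (z - ?w)"]) auto
  moreover have "h + ?w \<in> (\<lambda>h. h + z) ` tensor_kernel" if "h \<in> tensor_kernel" for h
    using tensor_kernel_diff[OF that d] by (intro image_eqI[of _ _ "h - (z - ?w)"]) auto
  ultimately show ?thesis
    unfolding simple_tensor_def r_coset_def by (simp add: UNION_singleton_eq_range) blast
qed

lemma simple_tensor_bij:
  "bij_betw (simple_tensor :: (('a, 'b) garrow \<Rightarrow>\<^sub>0 'k::field) \<Rightarrow> _) (arrow_space G x) (carrier
      (pair_group Mod tensor_kernel))"
proof (rule bij_betw_imageI)
  have zero: "0 \<in> tensor_kernel" by (rule tensor_kernel_zero)
  show "inj_on simple_tensor (arrow_space G x :: (('a, 'b) garrow \<Rightarrow>\<^sub>0 'k) set)"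
  proof (rule inj_onI)
    fix m m' :: "('a, 'b) garrow \<Rightarrow>\<^sub>0 'k"
    assume "simple_tensor m = simple_tensor m'"
    moreover have "frag_of (m, 1) \<in> simple_tensor m"
      unfolding simple_tensor_def r_coset_def using tensor_kernel_zero by force
    ultimately obtain h where "h \<in> tensor_kernel" "frag_of (m, 1) = h + frag_of (m', 1)"
      unfolding simple_tensor_def r_coset_def by auto
    then have "tensor_eval (frag_of (m, 1)) = tensor_eval (frag_of (m', 1))"
      by (simp only: tensor_eval_add tensor_eval_kernel add_0_left)
    then show "m = m'" by simp
  qed
  show "simple_tensor ` arrow_space G x =
      carrier (pair_group Mod (tensor_kernel :: (((('a, 'b) garrow \<Rightarrow>\<^sub>0 'k) \<times> 'k) \<Rightarrow>\<^sub>0 int) set))"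
  proof (rule equalityI; rule subsetI)
    fix C :: "(((('a, 'b) garrow \<Rightarrow>\<^sub>0 'k) \<times> 'k) \<Rightarrow>\<^sub>0 int) set"
    assume "C \<in> simple_tensor ` arrow_space G x"
    then show "C \<in> carrier (pair_group Mod tensor_kernel)" by (auto simp: FactGroup_def RCOSETS_def
        simple_tensor_def)
  next
    fix C assume "C \<in> carrier (pair_group Mod (tensor_kernel :: (((('a, 'b) garrow \<Rightarrow>\<^sub>0 'k) \<times> 'k) \<Rightarrow>\<^sub>0
        int) set))"
    then obtain z where z: "keys z \<subseteq> arrow_space G x \<times> UNIV" "C = tensor_kernel #>\<^bsub>pair_group\<^esub> z"
      by (auto simp: FactGroup_def RCOSETS_def)
    have "tensor_eval z \<in> arrow_space G x"
      unfolding arrow_space_iff using z(1) by (rule tensor_eval_keys) (simp add: arrow_space_iff)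
    then show "C \<in> simple_tensor ` arrow_space G x"
      using coset_eq_simple_tensor z by blast
  qed
qed

lemma simple_tensor_zero: "simple_tensor (0 :: ('a, 'b) garrow \<Rightarrow>\<^sub>0 'k::field) = tensor_kernel"
proof -
  have "(tensor_kernel :: (((('a, 'b) garrow \<Rightarrow>\<^sub>0 'k) \<times> 'k) \<Rightarrow>\<^sub>0 int) set) #>\<^bsub>pair_group\<^esub> 0 =
      tensor_kernel" by (simp add: r_coset_def)
  then show ?thesis using coset_eq_simple_tensor[of "0 :: (((('a, 'b) garrow \<Rightarrow>\<^sub>0 'k) \<times> 'k) \<Rightarrow>\<^sub>0
      int)"] by simp
qed

lemma simple_tensor_add:
  assumes "m \<in> arrow_space G x" "m' \<in> arrow_space G x"
  shows "simple_tensor m <#>\<^bsub>pair_group\<^esub> simple_tensor m' = simple_tensor (m + m')"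
proof -
  have k: "keys (frag_of (m, 1) + frag_of (m', 1)) \<subseteq> arrow_space G x \<times> UNIV"
    using assms keys_add[of "frag_of (m, 1)" "frag_of (m', 1)"] by auto
  have "simple_tensor m <#>\<^bsub>pair_group\<^esub> simple_tensor m' = tensor_kernel #>\<^bsub>pair_group\<^esub> (frag_of (m,
      1) + frag_of (m', 1))"
    unfolding simple_tensor_def using normal.rcos_sum[OF tensor_kernel_normal, of "frag_of (m, 1)"
        "frag_of (m', 1)"] assms
    by simp
  also have "\<dots> = simple_tensor (m + m')"
    by (simp add: coset_eq_simple_tensor[OF k] tensor_eval_add)
  finally show ?thesis .
qed

text \<open>
An operator on the first factor passes to the tensor product, and corresponds to itself under the
identification of the tensor product with the space of arrows.
\<close>

lemma first_factor_action:
  assumes g: "pm_linear g" "\<And>m. m \<in> arrow_space G x \<Longrightarrow> (g m) \<in> arrow_space G x"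
    and m: "m \<in> arrow_space G x"
  shows "on_cosets (\<lambda>z. tensor_kernel #>\<^bsub>pair_group\<^esub> frag_extend (\<lambda>(m, w). frag_of (g m, w)) z)
      (simple_tensor m) =
     simple_tensor (g m)"
proof -
  have *: "tensor_kernel #>\<^bsub>pair_group\<^esub> frag_extend (\<lambda>(m, w). frag_of (g m, w)) z = simple_tensor (g
      m)"
    if "z \<in> simple_tensor m" for z
  proof -
    obtain h where h: "h \<in> tensor_kernel" "z = h + frag_of (m, 1)"
      using \<open>z \<in> _\<close> unfolding simple_tensor_def r_coset_def by auto
    have "keys z \<subseteq> arrow_space G x \<times> UNIV"
      unfolding h(2) using tensor_kernel_carrier[OF h(1)] m by (intro keys_add_subset) auto
    then have "keys (frag_extend (\<lambda>(m, w). frag_of (g m, w)) z) \<subseteq> arrow_space G x \<times> UNIV"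
      by (rule keys_frag_extend_of) (use g(2) in auto)
    moreover have "tensor_eval z = m" by (simp add: h tensor_eval_add tensor_eval_kernel)
    ultimately show ?thesis
      by (simp only: coset_eq_simple_tensor tensor_eval_frag_extend[OF g(1)])
  qed
  have "frag_of (m, 1) \<in> simple_tensor m"
    unfolding simple_tensor_def r_coset_def using tensor_kernel_zero by force
  then show ?thesis using * by (rule on_cosets_const)
qed

end

section \<open>Convolution and its action on arrows\<close>

interpretation fun_space: vector_space "\<lambda>c f \<gamma>. c * f \<gamma> :: 'k::field"
  by unfold_locales (auto simp: algebra_simps fun_eq_iff)

text \<open>
A function on the groupoid is regarded as a matrix; a column consists of the arrows with a common
range. Finitely many nonzero entries in each column suffice for the convolution and for the action on
arrows to be finite sums.
\<close>

definition column_finite :: "('v, 'e) pre_digraph \<Rightarrow> (('v, 'e) garrow \<Rightarrow> 'k::field) \<Rightarrow> bool" where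
  "column_finite E f \<longleftrightarrow> (\<forall>\<gamma>. f \<gamma> \<noteq> 0 \<longrightarrow> \<gamma> \<in> gpd E) \<and> (\<forall>z. finite {\<gamma>. grange \<gamma> = z \<and> f \<gamma> \<noteq> 0})"

definition gprod :: "('v, 'e) garrow set \<Rightarrow> ('v, 'e) garrow set \<Rightarrow> ('v, 'e) garrow set" where
  "gprod A B = {gmult \<alpha> \<beta> | \<alpha> \<beta>. \<alpha> \<in> A \<and> \<beta> \<in> B \<and> grange \<alpha> = gsource \<beta>}"

lemma gpd_simps [simp]:
  "gsource (p, k, q) = p" "grange (p, k, q) = q" "ginv (p, k, q) = (q, - k, p)"
  "gmult (p, k, q) (p', k', q') = (p, k + k', q')"
  by (simp_all add: gsource_def grange_def ginv_def gmult_def)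

lemma arrows_to_iff [simp]: "(p, k, q) \<in> arrows_to E x \<longleftrightarrow> q = x \<and> (p, k, x) \<in> gpd E"
  by (auto simp: arrows_to_def)

lemma column_finite_gpd: "column_finite E f \<Longrightarrow> f \<gamma> \<noteq> 0 \<Longrightarrow> \<gamma> \<in> gpd E"
  unfolding column_finite_def by blast

lemma column_finite_finite: "column_finite E f \<Longrightarrow> finite {\<gamma>. grange \<gamma> = z \<and> f \<gamma> \<noteq> 0}"
  unfolding column_finite_def by blast

lemma column_finite_0: "column_finite E (\<lambda>_. 0)"
  by (simp add: column_finite_def)

lemma column_finite_add:
  assumes "column_finite E f" "column_finite E g"
  shows "column_finite E (\<lambda>\<gamma>. c * f \<gamma> + g \<gamma>)"
proof -
  have "finite {\<gamma>. grange \<gamma> = z \<and> c * f \<gamma> + g \<gamma> \<noteq> 0}" for z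
    by (rule finite_subset[of _ "{\<gamma>. grange \<gamma> = z \<and> f \<gamma> \<noteq> 0} \<union> {\<gamma>. grange \<gamma> = z \<and> g \<gamma> \<noteq> 0}"])
      (use assms in \<open>auto simp: column_finite_def\<close>)
  moreover have "\<gamma> \<in> gpd E" if "c * f \<gamma> + g \<gamma> \<noteq> 0" for \<gamma>
    using that column_finite_gpd[OF assms(1), of \<gamma>] column_finite_gpd[OF assms(2), of \<gamma>]
    by (cases "f \<gamma> = 0") auto
  ultimately show ?thesis by (simp add: column_finite_def)
qed

lemma column_finite_indicator:
  assumes "A \<subseteq> gpd E" "inj_on grange A"
  shows "column_finite E (indicator A)"
proof -
  have "finite {\<gamma>. grange \<gamma> = z \<and> indicator A \<gamma> \<noteq> (0::'k::field)}" for z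
  proof (rule finite_subset)
    show "{\<gamma>. grange \<gamma> = z \<and> indicator A \<gamma> \<noteq> (0::'k)} \<subseteq> {the_inv_into A grange z}"
      using the_inv_into_f_f[OF assms(2)] by (auto simp: indicator_def)
  qed simp
  then show ?thesis using assms(1) by (auto simp: column_finite_def indicator_def)
qed

lemma pm_linear_arrows_lact: "pm_linear (arrows_lact E x f)"
  unfolding arrows_lact_def by (rule pm_linear_linear_extend)

lemma arrows_lact_arrow_space: "arrows_lact E x f m \<in> arrow_space E x"
proof -
  have "keys (\<Sum>y \<in> {y \<in> arrows_to E x. f (gmult y (ginv t)) \<noteq> 0}.
        Poly_Mapping.single y (f (gmult y (ginv t)))) \<subseteq> arrows_to E x" for t
    by (rule keys_sum_subset) auto
  then show ?thesis unfolding arrow_space_iff arrows_lact_def by (intro keys_linear_extend) auto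
qed

lemma lookup_arrows_lact_outside: "y \<notin> arrows_to E x \<Longrightarrow> lookup (arrows_lact E x f m) y = 0"
  using arrows_lact_arrow_space[of E x f m] by (auto simp: arrow_space_iff in_keys_iff)

text \<open>
The action as multiplication by the matrix \<open>(y, t) \<mapsto> f (y t\<^sup>-\<^sup>1)\<close>. Translation by \<open>t\<^sup>-\<^sup>1\<close> maps
arrows that end at \<open>x\<close> injectively into the column of the source of \<open>t\<close>, so every column of this matrix is finite.
\<close>

lemma lookup_arrows_lact:
  assumes f: "column_finite E f" and m: "m \<in> arrow_space E x"
  shows "lookup (arrows_lact E x f m) y =
     (if y \<in> arrows_to E x then \<Sum>t\<in>keys m. lookup m t * f (gmult y (ginv t)) else 0)"
proof (cases "y \<in> arrows_to E x")
  case False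
  then show ?thesis by (simp add: lookup_arrows_lact_outside)
next
  case True
  have "lookup (\<Sum>y \<in> {y \<in> arrows_to E x. f (gmult y (ginv t)) \<noteq> 0}.
        Poly_Mapping.single y (f (gmult y (ginv t)))) y = f (gmult y (ginv t))" if "t \<in> keys m" for
            t
  proof -
    let ?A = "{y \<in> arrows_to E x. f (gmult y (ginv t)) \<noteq> 0}"
    have t: "t \<in> arrows_to E x" using m that by (auto simp: arrow_space_iff)
    have "inj_on (\<lambda>y. gmult y (ginv t)) (arrows_to E x)"
      by (auto simp: inj_on_def arrows_to_def grange_def gmult_def gsource_def)
    then have inj: "inj_on (\<lambda>y. gmult y (ginv t)) ?A" by (rule inj_on_subset) auto
    have "(\<lambda>y. gmult y (ginv t)) ` ?A \<subseteq> {\<gamma>. grange \<gamma> = gsource t \<and> f \<gamma> \<noteq> 0}"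
      by (cases t) auto
    then have "finite ?A"
      using f inj finite_imageD finite_subset unfolding column_finite_def by blast
    then show ?thesis using True by (simp add: lookup_sum lookup_single when_def)
  qed
  then show ?thesis using True
    by (simp add: arrows_lact_def lookup_linear_extend)
qed

lemma lookup_arrows_lact_single:
  assumes "column_finite E f" "t \<in> arrows_to E x"
  shows "lookup (arrows_lact E x f (Poly_Mapping.single t 1)) y =
     (if y \<in> arrows_to E x then f (gmult y (ginv t)) else 0)"
  using assms by (simp add: lookup_arrows_lact arrow_space_iff)

text \<open>
A factorization of \<open>\<gamma>\<close> is determined by its second factor, which lies in the column of \<open>\<gamma>\<close>. The
finite index set \<open>S\<close> may be larger than the support, so that different convolutions can be summed
over a common set.
\<close>

lemma convolution_column_sum:
  assumes f: "column_finite E f" and g: "column_finite E g" and S: "finite S"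
    "\<And>\<beta>. grange \<beta> = grange \<gamma> \<Longrightarrow> g \<beta> \<noteq> 0 \<Longrightarrow> \<beta> \<in> S" "\<And>\<beta>. \<beta> \<in> S \<Longrightarrow> grange \<beta> = grange \<gamma>"
  shows "convolution E f g \<gamma> = (\<Sum>\<beta>\<in>S. f (gmult \<gamma> (ginv \<beta>)) * g \<beta>)"
proof -
  let ?P = "{(\<alpha>, \<beta>). \<alpha> \<in> gpd E \<and> \<beta> \<in> gpd E \<and> grange \<alpha> = gsource \<beta> \<and>
        gmult \<alpha> \<beta> = \<gamma> \<and> f \<alpha> * g \<beta> \<noteq> 0}"
  let ?S = "{\<beta> \<in> S. f (gmult \<gamma> (ginv \<beta>)) * g \<beta> \<noteq> 0}"
  have "convolution E f g \<gamma> = (\<Sum>(\<alpha>, \<beta>)\<in>?P. f \<alpha> * g \<beta>)" by (simp add: convolution_def)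
  also have "\<dots> = (\<Sum>\<beta>\<in>?S. f (gmult \<gamma> (ginv \<beta>)) * g \<beta>)"
  proof (rule sum.reindex_bij_witness[of _ "\<lambda>\<beta>. (gmult \<gamma> (ginv \<beta>), \<beta>)" snd])
    fix a assume a: "a \<in> ?P"
    obtain p k q r l q' where "a = ((p, k, q), (r, l, q'))" by (metis prod_cases3 surj_pair)
    with a S(2)[of "(r, l, q')"]
    show "(gmult \<gamma> (ginv (snd a)), snd a) = a" "snd a \<in> ?S"
      "f (gmult \<gamma> (ginv (snd a))) * g (snd a) = (case a of (\<alpha>, \<beta>) \<Rightarrow> f \<alpha> * g \<beta>)" by auto
  next
    fix \<beta> assume b: "\<beta> \<in> ?S"
    obtain p k q r l q' where "\<gamma> = (p, k, q)" "\<beta> = (r, l, q')" by (metis prod_cases3)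
    then show "(gmult \<gamma> (ginv \<beta>), \<beta>) \<in> ?P"
      using b S(3)[of \<beta>] f g by (auto simp: column_finite_def)
  qed simp
  also have "\<dots> = (\<Sum>\<beta>\<in>S. f (gmult \<gamma> (ginv \<beta>)) * g \<beta>)"
    by (rule sum.mono_neutral_left) (use S(1) in auto)
  finally show ?thesis .
qed

lemma convolution_column:
  assumes "column_finite E f" "column_finite E g"
  shows "convolution E f g \<gamma> =
    (\<Sum>\<beta>\<in>{\<beta>. grange \<beta> = grange \<gamma> \<and> g \<beta> \<noteq> 0}. f (gmult \<gamma> (ginv \<beta>)) * g \<beta>)"
  by (rule convolution_column_sum) (use assms in \<open>auto simp: column_finite_def\<close>)

lemma convolution_linear_left:
  assumes "column_finite E f" "column_finite E f'" "column_finite E g"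
  shows "convolution E (\<lambda>\<gamma>. c * f \<gamma> + f' \<gamma>) g = (\<lambda>\<gamma>. c * convolution E f g \<gamma> + convolution E f' g
      \<gamma>)"
proof
  fix \<gamma>
  show "convolution E (\<lambda>\<gamma>. c * f \<gamma> + f' \<gamma>) g \<gamma> = c * convolution E f g \<gamma> + convolution E f' g \<gamma>"
    unfolding convolution_column[OF column_finite_add[OF assms(1,2)] assms(3)]
      convolution_column[OF assms(1,3)] convolution_column[OF assms(2,3)]
    by (simp add: algebra_simps sum.distrib sum_distrib_left)
qed

lemma convolution_linear_right:
  assumes "column_finite E f" "column_finite E g" "column_finite E g'"
  shows "convolution E f (\<lambda>\<gamma>. c * g \<gamma> + g' \<gamma>) = (\<lambda>\<gamma>. c * convolution E f g \<gamma> + convolution E f g'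
      \<gamma>)"
proof
  fix \<gamma>
  let ?S = "{\<beta>. grange \<beta> = grange \<gamma> \<and> g \<beta> \<noteq> 0} \<union> {\<beta>. grange \<beta> = grange \<gamma> \<and> g' \<beta> \<noteq> 0}"
  have S: "finite ?S" using column_finite_finite[OF assms(2)] column_finite_finite[OF assms(3)] by
      simp
  have 1: "convolution E f (\<lambda>\<gamma>. c * g \<gamma> + g' \<gamma>) \<gamma> =
      (\<Sum>\<beta>\<in>?S. f (gmult \<gamma> (ginv \<beta>)) * (c * g \<beta> + g' \<beta>))"
    by (rule convolution_column_sum[OF assms(1) column_finite_add[OF assms(2,3)] S]) auto
  have 2: "convolution E f g \<gamma> = (\<Sum>\<beta>\<in>?S. f (gmult \<gamma> (ginv \<beta>)) * g \<beta>)"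
    by (rule convolution_column_sum[OF assms(1,2) S]) auto
  have 3: "convolution E f g' \<gamma> = (\<Sum>\<beta>\<in>?S. f (gmult \<gamma> (ginv \<beta>)) * g' \<beta>)"
    by (rule convolution_column_sum[OF assms(1,3) S]) auto
  show "convolution E f (\<lambda>\<gamma>. c * g \<gamma> + g' \<gamma>) \<gamma> = c * convolution E f g \<gamma> + convolution E f g' \<gamma>"
    unfolding 1 2 3 by (simp only: distrib_left sum.distrib sum_distrib_left mult.left_commute)
qed

lemma convolution_0 [simp]: "convolution E (\<lambda>_. 0) g = (\<lambda>_. 0)" "convolution E f (\<lambda>_. 0) = (\<lambda>_. 0)"
  by (simp_all add: convolution_def fun_eq_iff)

text \<open>
If the range map is injective on \<open>B\<close>, an arrow factors through \<open>A\<close> and \<open>B\<close> in at most one way.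
\<close>

lemma convolution_indicator:
  assumes "A \<subseteq> gpd E" "B \<subseteq> gpd E" "inj_on grange B"
  shows "convolution E (indicator A) (indicator B) = (indicator (gprod A B) :: _ \<Rightarrow> 'k::field)"
proof
  fix \<gamma>
  let ?P = "{(\<alpha>, \<beta>). \<alpha> \<in> gpd E \<and> \<beta> \<in> gpd E \<and> grange \<alpha> = gsource \<beta> \<and>
        gmult \<alpha> \<beta> = \<gamma> \<and> indicator A \<alpha> * indicator B \<beta> \<noteq> (0::'k)}"
  have P: "?P = {(\<alpha>, \<beta>). \<alpha> \<in> A \<and> \<beta> \<in> B \<and> grange \<alpha> = gsource \<beta> \<and> gmult \<alpha> \<beta> = \<gamma>}"
    using assms(1,2) by (auto simp: indicator_def split: if_splits)
  have conv: "convolution E (indicator A) (indicator B) \<gamma> = (\<Sum>(\<alpha>, \<beta>)\<in>?P. indicator A \<alpha> * indicator B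
      \<beta> :: 'k)"
    by (simp add: convolution_def)
  show "convolution E (indicator A) (indicator B) \<gamma> = (indicator (gprod A B) \<gamma> :: 'k)"
  proof (cases "\<gamma> \<in> gprod A B")
    case True
    then obtain \<alpha> \<beta> where ab: "\<alpha> \<in> A" "\<beta> \<in> B" "grange \<alpha> = gsource \<beta>" "gmult \<alpha> \<beta> = \<gamma>"
      by (auto simp: gprod_def)
    have "?P = {(\<alpha>, \<beta>)}"
    proof -
      have "\<alpha>' = \<alpha> \<and> \<beta>' = \<beta>" if "\<beta>' \<in> B" "grange \<alpha>' = gsource \<beta>'" "gmult \<alpha>' \<beta>' = \<gamma>" for \<alpha>' \<beta>'
      proof -
        have "grange \<beta>' = grange \<beta>" using ab(4) that(3) by (auto simp: gmult_def grange_def)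
        then have "\<beta>' = \<beta>" using assms(3) ab(2) that(1) by (auto dest: inj_onD)
        then show ?thesis using ab that by (cases \<alpha>; cases \<alpha>'; cases \<beta>) auto
      qed
      then show ?thesis unfolding P using ab by blast
    qed
    then show ?thesis unfolding conv using True ab by simp
  next
    case False
    then have "?P = {}" unfolding P gprod_def by auto
    then show ?thesis unfolding conv using False by (simp only: sum.empty indicator_simps(2)
        simp_thms)
  qed
qed

context wf_digraph
begin

lemma column_finite_convolution:
  assumes f: "column_finite G f" and g: "column_finite G g"
  shows "column_finite G (convolution G f g)"
proof -
  have ex: "\<exists>\<alpha> \<beta>. f \<alpha> \<noteq> 0 \<and> g \<beta> \<noteq> 0 \<and> grange \<alpha> = gsource \<beta> \<and> \<gamma> = gmult \<alpha> \<beta>"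
    if "convolution G f g \<gamma> \<noteq> 0" for \<gamma>
  proof -
    obtain a where "a \<in> {(\<alpha>, \<beta>). \<alpha> \<in> gpd G \<and> \<beta> \<in> gpd G \<and> grange \<alpha> = gsource \<beta> \<and>
        gmult \<alpha> \<beta> = \<gamma> \<and> f \<alpha> * g \<beta> \<noteq> 0}"
      using \<open>convolution G f g \<gamma> \<noteq> 0\<close> unfolding convolution_def
      by (rule sum.not_neutral_contains_not_neutral)
    then show ?thesis by (intro exI[of _ "fst a"] exI[of _ "snd a"]) (auto split: prod.splits)
  qed
  have "finite {\<gamma>. grange \<gamma> = z \<and> convolution G f g \<gamma> \<noteq> 0}" for z
  proof (rule finite_subset)
    let ?S = "{\<beta>. grange \<beta> = z \<and> g \<beta> \<noteq> 0}"
    show "{\<gamma>. grange \<gamma> = z \<and> convolution G f g \<gamma> \<noteq> 0} \<subseteq>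
        (\<Union>\<beta>\<in>?S. (\<lambda>\<alpha>. gmult \<alpha> \<beta>) ` {\<alpha>. grange \<alpha> = gsource \<beta> \<and> f \<alpha> \<noteq> 0})"
      using ex by (force simp: gmult_def grange_def)
    show "finite (\<Union>\<beta>\<in>?S. (\<lambda>\<alpha>. gmult \<alpha> \<beta>) ` {\<alpha>. grange \<alpha> = gsource \<beta> \<and> f \<alpha> \<noteq> 0})"
      using f g by (auto simp: column_finite_def)
  qed
  moreover have "\<gamma> \<in> gpd G" if "convolution G f g \<gamma> \<noteq> 0" for \<gamma>
  proof -
    obtain \<alpha> \<beta> where ab: "f \<alpha> \<noteq> 0" "g \<beta> \<noteq> 0" "grange \<alpha> = gsource \<beta>" "\<gamma> = gmult \<alpha> \<beta>"
      using ex[OF \<open>convolution G f g \<gamma> \<noteq> 0\<close>] by blast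
    then show ?thesis
      using gpd_mult column_finite_gpd[OF f ab(1)] column_finite_gpd[OF g ab(2)]
      by (cases \<alpha>; cases \<beta>) simp
  qed
  ultimately show ?thesis by (simp add: column_finite_def)
qed

text \<open>
Both sides are \<open>\<Sum>\<^sub>s f (y s\<^sup>-\<^sup>1) g (s t\<^sup>-\<^sup>1)\<close>. In the convolution at \<open>y t\<^sup>-\<^sup>1\<close> the second factor \<open>\<beta>\<close>
runs over the column of \<open>y t\<^sup>-\<^sup>1\<close>, and \<open>\<beta> = s t\<^sup>-\<^sup>1\<close> turns it into an arrow \<open>s = \<beta> t\<close> that ends at \<open>x\<close>.
\<close>

lemma arrows_lact_convolution:
  assumes f: "column_finite G f" and g: "column_finite G g" and m: "m \<in> arrow_space G x"
  shows "arrows_lact G x (convolution G f g) m = arrows_lact G x f (arrows_lact G x g m)"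
proof (rule pm_linear_eq_on[of _ _ m "arrows_to G x"])
  fix t assume t: "t \<in> arrows_to G x"
  obtain q l where t': "t = (q, l, x)" using t by (cases t) auto
  let ?n = "arrows_lact G x g (Poly_Mapping.single t 1)"
  let ?\<tau> = "\<lambda>s. gmult s (ginv t)"
  have n: "?n \<in> arrow_space G x" by (rule arrows_lact_arrow_space)
  then have kn: "keys ?n \<subseteq> arrows_to G x" by (simp add: arrow_space_iff)
  have ln: "lookup ?n s = g (?\<tau> s)" if "s \<in> arrows_to G x" for s
    using that lookup_arrows_lact_single[OF g t] by simp
  show "arrows_lact G x (convolution G f g) (Poly_Mapping.single t 1) = arrows_lact G x f ?n"
  proof (rule poly_mapping_eqI)
    fix y
    show "lookup (arrows_lact G x (convolution G f g) (Poly_Mapping.single t 1)) y =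
        lookup (arrows_lact G x f ?n) y"
    proof (cases "y \<in> arrows_to G x")
      case True
      then obtain p k where y: "y = (p, k, x)" by (cases y) auto
      have inj: "inj_on ?\<tau> (keys ?n)"
        by (rule inj_on_subset[OF _ kn]) (auto simp: inj_on_def t')
      have "convolution G f g (?\<tau> y) = (\<Sum>\<beta>\<in>?\<tau> ` keys ?n. f (gmult (?\<tau> y) (ginv \<beta>)) * g \<beta>)"
      proof (rule convolution_column_sum[OF f g])
        fix \<beta> assume b: "grange \<beta> = grange (?\<tau> y)" "g \<beta> \<noteq> 0"
        then obtain r j where \<beta>: "\<beta> = (r, j, q)" by (cases \<beta>) (auto simp: y t')
        have "\<beta> \<in> gpd G" using column_finite_gpd[OF g b(2)] .
        then have s: "(r, j + l, x) \<in> arrows_to G x" using gpd_mult t by (simp add: \<beta> t')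
        have "?\<tau> (r, j + l, x) = \<beta>" by (simp add: \<beta> t')
        moreover from this s b have "(r, j + l, x) \<in> keys ?n" by (simp add: in_keys_iff ln)
        ultimately show "\<beta> \<in> ?\<tau> ` keys ?n" by force
      qed (auto simp: y t')
      also have "\<dots> = (\<Sum>s\<in>keys ?n. f (gmult (?\<tau> y) (ginv (?\<tau> s))) * g (?\<tau> s))"
        using inj by (simp add: sum.reindex)
      also have "\<dots> = (\<Sum>s\<in>keys ?n. lookup ?n s * f (gmult y (ginv s)))"
      proof (rule sum.cong)
        fix s assume "s \<in> keys ?n"
        then have s: "s \<in> arrows_to G x" using kn by blast
        then show "f (gmult (?\<tau> y) (ginv (?\<tau> s))) * g (?\<tau> s) = lookup ?n s * f (gmult y (ginv s))"
          unfolding ln[OF s] by (cases s) (simp add: y t')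
      qed simp
      finally show ?thesis
        using True by (simp add: lookup_arrows_lact_single[OF column_finite_convolution[OF f g] t]
            lookup_arrows_lact[OF f n])
    next
      case False
      then show ?thesis by (simp add: lookup_arrows_lact_outside)
    qed
  qed
qed (use m in \<open>auto simp: arrow_space_iff pm_linear_arrows_lact intro: pm_linear_comp\<close>)

text \<open>
The value \<open>f \<gamma>\<close> is the coefficient of \<open>\<gamma>\<close> in the image of the unit at the range of \<open>\<gamma>\<close>. All boundary
paths \<open>x\<close> are needed here, rational ones included.
\<close>

lemma arrows_lact_faithful:
  assumes f: "column_finite G f"
    and zero: "\<And>x. x \<in> boundary_paths G \<Longrightarrow> arrows_lact G x f (Poly_Mapping.single (gunit x) 1) = 0"
  shows "f = (\<lambda>_. 0)"
proof
  fix \<gamma>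
  show "f \<gamma> = 0"
  proof (rule ccontr)
    assume "f \<gamma> \<noteq> 0"
    then have "\<gamma> \<in> gpd G" by (rule column_finite_gpd[OF f])
    then obtain p k x where \<gamma>: "\<gamma> = (p, k, x)" "(p, k, x) \<in> gpd G" by (cases \<gamma>) auto
    then have x: "x \<in> boundary_paths G" using gpd_boundary by blast
    then have "gunit x \<in> arrows_to G x" using gpd_unit by (simp add: gunit_def)
    from lookup_arrows_lact_single[OF f this, of \<gamma>] zero[OF x] \<gamma>
    have "f \<gamma> = 0" by (simp add: gunit_def)
    with \<open>f \<gamma> \<noteq> 0\<close> show False by simp
  qed
qed

lemma arrows_lact_linear_fun:
  assumes "column_finite G f" "column_finite G g" "m \<in> arrow_space G x"
  shows "arrows_lact G x (\<lambda>\<gamma>. c * f \<gamma> + g \<gamma>) m = pm_scale c (arrows_lact G x f m) + arrows_lact G x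
      g m"
proof (rule poly_mapping_eqI)
  fix y
  show "lookup (arrows_lact G x (\<lambda>\<gamma>. c * f \<gamma> + g \<gamma>) m) y =
     lookup (pm_scale c (arrows_lact G x f m) + arrows_lact G x g m) y"
    unfolding lookup_add lookup_pm_scale lookup_arrows_lact[OF column_finite_add[OF assms(1,2)]
        assms(3)]
      lookup_arrows_lact[OF assms(1,3)] lookup_arrows_lact[OF assms(2,3)]
    by (simp add: algebra_simps sum.distrib sum_distrib_left)
qed

section \<open>Products of the basic bisections\<close>

lemma Zset_inj:
  assumes "\<mu> \<in> finite_paths G" "\<nu> \<in> finite_paths G"
  shows "inj_on grange (Zset G \<mu> \<nu>)"
proof (rule inj_onI)
  fix \<alpha> \<beta> assume "\<alpha> \<in> Zset G \<mu> \<nu>" "\<beta> \<in> Zset G \<mu> \<nu>" and eq: "grange \<alpha> = grange \<beta>"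
  then obtain y z where yz: "frange G \<nu> = source G y" "frange G \<nu> = source G z"
    "\<alpha> = (conc \<mu> y, int (plength \<mu>) - int (plength \<nu>), conc \<nu> y)"
    "\<beta> = (conc \<mu> z, int (plength \<mu>) - int (plength \<nu>), conc \<nu> z)"
    unfolding Zset_iff[OF assms] by blast
  have "y = z" by (rule conc_cancel[of \<nu>]) (use eq yz in simp_all)
  then show "\<alpha> = \<beta>" unfolding yz(3,4) by simp
qed

lemma column_finite_Zset:
  "\<mu> \<in> finite_paths G \<Longrightarrow> \<nu> \<in> finite_paths G \<Longrightarrow> column_finite G (indicator (Zset G \<mu> \<nu>))"
  by (intro column_finite_indicator Zset_subset_gpd Zset_inj)

lemma convolution_Zset:
  assumes "\<mu>' \<in> finite_paths G" "\<nu>' \<in> finite_paths G"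
  shows "convolution G (indicator (Zset G \<mu> \<nu>)) (indicator (Zset G \<mu>' \<nu>')) =
    (indicator (gprod (Zset G \<mu> \<nu>) (Zset G \<mu>' \<nu>')) :: _ \<Rightarrow> 'k::field)"
  using assms by (intro convolution_indicator Zset_subset_gpd Zset_inj)

text \<open>
In the algebra: \<open>\<mu>\<nu>\<^sup>* \<cdot> \<nu>\<kappa>\<nu>'\<^sup>* = \<mu>\<kappa>\<nu>'\<^sup>*\<close>.
\<close>

lemma gprod_Zset_left:
  assumes "\<mu> \<in> finite_paths G" "\<nu> \<in> finite_paths G" "\<kappa> \<in> finite_paths G" "\<nu>' \<in> finite_paths G"
    and "frange G \<mu> = fst \<kappa>" "frange G \<nu> = fst \<kappa>"
  shows "gprod (Zset G \<mu> \<nu>) (Zset G (fconc \<nu> \<kappa>) \<nu>') = Zset G (fconc \<mu> \<kappa>) \<nu>'"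
proof -
  have F: "fconc \<nu> \<kappa> \<in> finite_paths G" "fconc \<mu> \<kappa> \<in> finite_paths G" using assms fconc_path by auto
  have r: "frange G (fconc \<nu> \<kappa>) = frange G \<kappa>" "frange G (fconc \<mu> \<kappa>) = frange G \<kappa>"
    using assms frange_fconc by auto
  note Z = Zset_iff[OF assms(1,2)] Zset_iff[OF F(1) assms(4)] Zset_iff[OF F(2) assms(4)]
  show ?thesis
  proof (rule equalityI; rule subsetI)
    fix \<gamma> assume "\<gamma> \<in> gprod (Zset G \<mu> \<nu>) (Zset G (fconc \<nu> \<kappa>) \<nu>')"
    then obtain y z where y: "y \<in> boundary_paths G" "frange G \<nu> = source G y"
      and z: "z \<in> boundary_paths G" "frange G \<kappa> = source G z" "frange G \<nu>' = source G z"
      and eq: "conc \<nu> y = conc (fconc \<nu> \<kappa>) z"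
      and \<gamma>: "\<gamma> = (conc \<mu> y, int (plength \<mu>) - int (plength \<nu>) +
        (int (plength (fconc \<nu> \<kappa>)) - int (plength \<nu>')), conc \<nu>' z)"
      by (auto simp: gprod_def Z r)
    have "source G y = source G (conc \<kappa> z)" using source_conc[OF assms(3) z(2)] assms(6) y(2) by
        simp
    then have "y = conc \<kappa> z" by (rule conc_cancel[of \<nu>, rotated]) (use eq in \<open>simp_all add:
        conc_fconc\<close>)
    then show "\<gamma> \<in> Zset G (fconc \<mu> \<kappa>) \<nu>'" unfolding Z r
      using z by (intro bexI[of _ z]) (auto simp: \<gamma> conc_fconc)
  next
    fix \<gamma> assume "\<gamma> \<in> Zset G (fconc \<mu> \<kappa>) \<nu>'"
    then obtain z where z: "z \<in> boundary_paths G" "frange G \<kappa> = source G z" "frange G \<nu>' = source G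
        z"
      and \<gamma>: "\<gamma> = (conc (fconc \<mu> \<kappa>) z, int (plength (fconc \<mu> \<kappa>)) - int (plength \<nu>'), conc \<nu>' z)"
      unfolding Z r by auto
    let ?\<alpha> = "(conc \<mu> (conc \<kappa> z), int (plength \<mu>) - int (plength \<nu>), conc \<nu> (conc \<kappa> z))"
    let ?\<beta> = "(conc (fconc \<nu> \<kappa>) z, int (plength (fconc \<nu> \<kappa>)) - int (plength \<nu>'), conc \<nu>' z)"
    have "?\<alpha> \<in> Zset G \<mu> \<nu>" unfolding Z
      using z assms(3,5,6) source_conc[OF assms(3) z(2)]
      by (intro bexI[of _ "conc \<kappa> z"]) (auto simp: conc_boundary)
    moreover have "?\<beta> \<in> Zset G (fconc \<nu> \<kappa>) \<nu>'" unfolding Z r using z by auto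
    moreover have "\<gamma> = gmult ?\<alpha> ?\<beta>" "grange ?\<alpha> = gsource ?\<beta>" by (auto simp: \<gamma> conc_fconc)
    ultimately show "\<gamma> \<in> gprod (Zset G \<mu> \<nu>) (Zset G (fconc \<nu> \<kappa>) \<nu>')" unfolding gprod_def by blast
  qed
qed

text \<open>
In the algebra: \<open>\<mu>(\<mu>'\<kappa>)\<^sup>* \<cdot> \<mu>'\<nu>'\<^sup>* = \<mu>(\<nu>'\<kappa>)\<^sup>*\<close>.
\<close>

lemma gprod_Zset_right:
  assumes "\<mu> \<in> finite_paths G" "\<mu>' \<in> finite_paths G" "\<kappa> \<in> finite_paths G" "\<nu>' \<in> finite_paths G"
    and "frange G \<mu>' = fst \<kappa>" "frange G \<nu>' = fst \<kappa>"
  shows "gprod (Zset G \<mu> (fconc \<mu>' \<kappa>)) (Zset G \<mu>' \<nu>') = Zset G \<mu> (fconc \<nu>' \<kappa>)"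
proof -
  have F: "fconc \<mu>' \<kappa> \<in> finite_paths G" "fconc \<nu>' \<kappa> \<in> finite_paths G" using assms fconc_path by auto
  have r: "frange G (fconc \<mu>' \<kappa>) = frange G \<kappa>" "frange G (fconc \<nu>' \<kappa>) = frange G \<kappa>"
    using assms frange_fconc by auto
  note Z = Zset_iff[OF assms(2,4)] Zset_iff[OF assms(1) F(1)] Zset_iff[OF assms(1) F(2)]
  show ?thesis
  proof (rule equalityI; rule subsetI)
    fix \<gamma> assume "\<gamma> \<in> gprod (Zset G \<mu> (fconc \<mu>' \<kappa>)) (Zset G \<mu>' \<nu>')"
    then obtain y z where y: "y \<in> boundary_paths G" "frange G \<mu>' = source G y"
      and z: "z \<in> boundary_paths G" "frange G \<kappa> = source G z" "frange G \<mu> = source G z"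
      and eq: "conc (fconc \<mu>' \<kappa>) z = conc \<mu>' y"
      and \<gamma>: "\<gamma> = (conc \<mu> z, int (plength \<mu>) - int (plength (fconc \<mu>' \<kappa>)) +
        (int (plength \<mu>') - int (plength \<nu>')), conc \<nu>' y)"
      by (auto simp: gprod_def Z r)
    have "source G y = source G (conc \<kappa> z)" using source_conc[OF assms(3) z(2)] assms(5) y(2) by
        simp
    then have "y = conc \<kappa> z" by (rule conc_cancel[of \<mu>', rotated]) (use eq in \<open>simp_all add:
        conc_fconc\<close>)
    then show "\<gamma> \<in> Zset G \<mu> (fconc \<nu>' \<kappa>)" unfolding Z r
      using z by (intro bexI[of _ z]) (auto simp: \<gamma> conc_fconc)
  next
    fix \<gamma> assume "\<gamma> \<in> Zset G \<mu> (fconc \<nu>' \<kappa>)"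
    then obtain z where z: "z \<in> boundary_paths G" "frange G \<kappa> = source G z" "frange G \<mu> = source G
        z"
      and \<gamma>: "\<gamma> = (conc \<mu> z, int (plength \<mu>) - int (plength (fconc \<nu>' \<kappa>)), conc (fconc \<nu>' \<kappa>) z)"
      unfolding Z r by auto
    let ?\<alpha> = "(conc \<mu> z, int (plength \<mu>) - int (plength (fconc \<mu>' \<kappa>)), conc (fconc \<mu>' \<kappa>) z)"
    let ?\<beta> = "(conc \<mu>' (conc \<kappa> z), int (plength \<mu>') - int (plength \<nu>'), conc \<nu>' (conc \<kappa> z))"
    have "?\<beta> \<in> Zset G \<mu>' \<nu>'" unfolding Z
      using z assms(3,5,6) source_conc[OF assms(3) z(2)]
      by (intro bexI[of _ "conc \<kappa> z"]) (auto simp: conc_boundary)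
    moreover have "?\<alpha> \<in> Zset G \<mu> (fconc \<mu>' \<kappa>)" unfolding Z r using z by auto
    moreover have "\<gamma> = gmult ?\<alpha> ?\<beta>" "grange ?\<alpha> = gsource ?\<beta>" by (auto simp: \<gamma> conc_fconc)
    ultimately show "\<gamma> \<in> gprod (Zset G \<mu> (fconc \<mu>' \<kappa>)) (Zset G \<mu>' \<nu>')" unfolding gprod_def by blast
  qed
qed

definition monomials :: "(('a, 'b) garrow \<Rightarrow> 'k::field) set" where
  "monomials = {indicator (Zset G \<mu> \<nu>) | \<mu> \<nu>.
     \<mu> \<in> finite_paths G \<and> \<nu> \<in> finite_paths G \<and> frange G \<mu> = frange G \<nu>}"

lemma monomialI: "\<mu> \<in> finite_paths G \<Longrightarrow> \<nu> \<in> finite_paths G \<Longrightarrow> frange G \<mu> = frange G \<nu> \<Longrightarrow>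
    indicator (Zset G \<mu> \<nu>) \<in> monomials"
  unfolding monomials_def by blast

text \<open>
If the product of \<open>Z(\<mu>, \<nu>)\<close> and \<open>Z(\<mu>', \<nu>')\<close> is not empty, some path begins with both \<open>\<nu>\<close> and \<open>\<mu>'\<close>. One
of the two is then an initial segment of the other, and one of the two preceding identities applies.
\<close>

lemma convolution_monomials:
  assumes "f \<in> monomials" "g \<in> monomials"
  shows "convolution G f g \<in> insert (\<lambda>_. 0) (monomials :: (_ \<Rightarrow> 'k::field) set)"
proof -
  obtain \<mu> \<nu> \<mu>' \<nu>' where f: "f = indicator (Zset G \<mu> \<nu>)" "\<mu> \<in> finite_paths G" "\<nu> \<in> finite_paths G"
      "frange G \<mu> = frange G \<nu>"
    and g: "g = indicator (Zset G \<mu>' \<nu>')" "\<mu>' \<in> finite_paths G" "\<nu>' \<in> finite_paths G"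
      "frange G \<mu>' = frange G \<nu>'"
    using assms unfolding monomials_def by blast
  let ?P = "gprod (Zset G \<mu> \<nu>) (Zset G \<mu>' \<nu>')"
  have conv: "convolution G f g = indicator ?P" using f g convolution_Zset by blast
  show ?thesis
  proof (cases "?P = {}")
    case True
    then show ?thesis by (simp add: conv fun_eq_iff)
  next
    case False
    then obtain y z where y: "frange G \<nu> = source G y" and z: "frange G \<mu>' = source G z"
      and eq: "conc \<nu> y = conc \<mu>' z"
      by (auto simp: gprod_def Zset_iff[OF f(2,3)] Zset_iff[OF g(2,3)])
    show ?thesis
    proof (cases "plength \<nu> \<le> plength \<mu>'")
      case True
      obtain \<kappa> where \<kappa>: "\<kappa> \<in> finite_paths G" "fst \<kappa> = frange G \<nu>" "frange G \<kappa> = source G z"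
        "\<mu>' = fconc \<nu> \<kappa>"
        by (rule conc_eq_concD[OF f(3) g(2) eq y z True], rule that)
      have \<mu>\<kappa>: "frange G \<mu> = fst \<kappa>" using f(4) \<kappa>(2) by simp
      have "?P = Zset G (fconc \<mu> \<kappa>) \<nu>'"
        unfolding \<kappa>(4) by (rule gprod_Zset_left[OF f(2,3) \<kappa>(1) g(3) \<mu>\<kappa> \<kappa>(2)[symmetric]])
      moreover have "fconc \<mu> \<kappa> \<in> finite_paths G" by (rule fconc_path[OF f(2) \<kappa>(1) \<mu>\<kappa>])
      moreover have "frange G (fconc \<mu> \<kappa>) = frange G \<nu>'"
        using frange_fconc[OF \<mu>\<kappa>] \<kappa>(3) z g(4) by simp
      ultimately show ?thesis using g(3) by (simp only: conv) (rule insertI2, rule monomialI)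
    next
      case False
      then have le: "plength \<mu>' \<le> plength \<nu>" by simp
      obtain \<kappa> where \<kappa>: "\<kappa> \<in> finite_paths G" "fst \<kappa> = frange G \<mu>'" "frange G \<kappa> = source G y"
        "\<nu> = fconc \<mu>' \<kappa>"
        by (rule conc_eq_concD[OF g(2) f(3) eq[symmetric] z y le], rule that)
      have \<nu>\<kappa>: "frange G \<nu>' = fst \<kappa>" using g(4) \<kappa>(2) by simp
      have "?P = Zset G \<mu> (fconc \<nu>' \<kappa>)"
        unfolding \<kappa>(4) by (rule gprod_Zset_right[OF f(2) g(2) \<kappa>(1) g(3) \<kappa>(2)[symmetric] \<nu>\<kappa>])
      moreover have "fconc \<nu>' \<kappa> \<in> finite_paths G" by (rule fconc_path[OF g(3) \<kappa>(1) \<nu>\<kappa>])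
      moreover have "frange G \<mu> = frange G (fconc \<nu>' \<kappa>)"
        using frange_fconc[OF \<nu>\<kappa>] \<kappa>(3) y f(4) by simp
      ultimately show ?thesis using f(2) by (simp only: conv) (rule insertI2, rule monomialI)
    qed
  qed
qed

section \<open>The span of the monomials\<close>

lemma steinberg_span_monomials: "steinberg_span G = fun_space.span monomials"
  by (simp add: steinberg_span_def monomials_def)

lemma monomial_column_finite: "f \<in> monomials \<Longrightarrow> column_finite G f"
  by (auto simp: monomials_def column_finite_Zset)

lemma steinberg_span_0: "(\<lambda>_. 0) \<in> steinberg_span G"
  using fun_space.span_zero by (simp add: steinberg_span_monomials zero_fun_def)

lemma steinberg_span_add: "f \<in> steinberg_span G \<Longrightarrow> g \<in> steinberg_span G \<Longrightarrow> f + g \<in> steinberg_span G"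
  unfolding steinberg_span_monomials by (rule fun_space.span_add)

lemma steinberg_span_scale: "f \<in> steinberg_span G \<Longrightarrow> (\<lambda>\<gamma>. c * f \<gamma>) \<in> steinberg_span G"
  unfolding steinberg_span_monomials by (rule fun_space.span_scale)

lemma monomial_in_span: "f \<in> monomials \<Longrightarrow> f \<in> steinberg_span G"
  unfolding steinberg_span_monomials by (rule fun_space.span_base)

lemma steinberg_span_induct [consumes 1, case_names zero step]:
  assumes "f \<in> steinberg_span G" "P (\<lambda>_. 0)"
    and "\<And>c f g. f \<in> monomials \<Longrightarrow> g \<in> steinberg_span G \<Longrightarrow> P g \<Longrightarrow> P (\<lambda>\<gamma>. c * f \<gamma> + g \<gamma>)"
  shows "P f"
proof -
  have "f \<in> steinberg_span G \<and> P f"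
    using assms(1) unfolding steinberg_span_monomials
  proof (induction rule: fun_space.span_induct_alt)
    case base
    then show ?case using assms(2) fun_space.span_zero by (simp add: zero_fun_def)
  next
    case (step c f g)
    then have "(\<lambda>\<gamma>. c * f \<gamma>) + g \<in> steinberg_span G"
      using steinberg_span_add[OF steinberg_span_scale[OF monomial_in_span], of f g c]
      by (simp add: steinberg_span_monomials)
    with step assms(3)[of f g c] show ?case by (simp add: plus_fun_def steinberg_span_monomials)
  qed
  then show ?thesis ..
qed

lemma steinberg_span_column_finite: "f \<in> steinberg_span G \<Longrightarrow> column_finite G f"
  by (induction rule: steinberg_span_induct)
    (auto intro: column_finite_0 column_finite_add monomial_column_finite)

lemma steinberg_span_lincomb:
  "f \<in> steinberg_span G \<Longrightarrow> g \<in> steinberg_span G \<Longrightarrow> (\<lambda>\<gamma>. c * f \<gamma> + g \<gamma>) \<in> steinberg_span G"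
  using steinberg_span_add[OF steinberg_span_scale] by (simp add: plus_fun_def)

lemma steinberg_span_convolution:
  assumes "f \<in> steinberg_span G" "g \<in> steinberg_span G"
  shows "convolution G f g \<in> steinberg_span G"
  using assms(1)
proof (induction rule: steinberg_span_induct)
  case zero
  then show ?case by (simp add: steinberg_span_0)
next
  case (step c f f')
  have "convolution G f g \<in> steinberg_span G"
    using assms(2)
  proof (induction rule: steinberg_span_induct)
    case zero
    then show ?case by (simp add: steinberg_span_0)
  next
    case (step d g g')
    have "convolution G f g \<in> steinberg_span G"
      using convolution_monomials[OF \<open>f \<in> monomials\<close> step(1)] steinberg_span_0 monomial_in_span by
          auto
    then show ?case using step \<open>f \<in> monomials\<close>
      by (simp add: convolution_linear_right monomial_column_finite steinberg_span_column_finite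
          steinberg_span_lincomb)
  qed
  then show ?case using step assms(2)
    by (simp add: convolution_linear_left monomial_column_finite steinberg_span_column_finite
        steinberg_span_lincomb)
qed

lemma steinberg_simps [simp]:
  "carrier (steinberg G) = steinberg_span G"
  "f \<otimes>\<^bsub>steinberg G\<^esub> g = convolution G f g"
  "f \<oplus>\<^bsub>steinberg G\<^esub> g = f + g"
  "\<zero>\<^bsub>steinberg G\<^esub> = 0"
  "c \<odot>\<^bsub>steinberg G\<^esub> f = (\<lambda>\<gamma>. c * f \<gamma>)"
  by (simp_all add: steinberg_def)

lemma arrows_lact_add_fun:
  assumes "f \<in> steinberg_span G" "g \<in> steinberg_span G" "m \<in> arrow_space G x"
  shows "arrows_lact G x (f + g) m = arrows_lact G x f m + arrows_lact G x g m"
  using arrows_lact_linear_fun[OF assms(1,2)[THEN steinberg_span_column_finite] assms(3), of 1]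
  by (simp add: plus_fun_def)

lemma arrows_lact_zero_fun: "m \<in> arrow_space G x \<Longrightarrow> arrows_lact G x (\<lambda>_. 0) m = 0"
  by (intro poly_mapping_eqI) (simp add: lookup_arrows_lact column_finite_0)

lemma arrows_lact_scale_fun:
  assumes "f \<in> steinberg_span G" "m \<in> arrow_space G x"
  shows "arrows_lact G x (\<lambda>\<gamma>. c * f \<gamma>) m = pm_scale c (arrows_lact G x f m)"
  using arrows_lact_linear_fun[OF steinberg_span_column_finite[OF assms(1)] column_finite_0
      assms(2), of c]
    arrows_lact_zero_fun[OF assms(2)] by simp

lemma arrows_left_module: "left_module (steinberg G) (arrows_bimodule G x)"
proof -
  have "Module.module field_ring (arrows_bimodule G x)"
  proof (rule moduleI[OF cring_field_ring])
    show "abelian_group (arrows_bimodule G x)"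
      by (rule abelian_groupI)
        (auto simp: arrow_space_add arrow_space_zero algebra_simps intro: bexI[OF _
            arrow_space_uminus])
  qed (auto simp: arrow_space_scale field_ring_def pm.scale_left_distrib pm.scale_right_distrib)
  then show ?thesis
    unfolding left_module_def
    by (auto simp: arrows_lact_arrow_space pm_linear_add[OF pm_linear_arrows_lact]
        pm_linear_scale[OF pm_linear_arrows_lact] arrows_lact_add_fun arrows_lact_convolution
        steinberg_span_column_finite arrows_lact_scale_fun)
qed

end

context trivial_isotropy
begin

lemma Ind_isomorphic:
  "isomorphic_modules (steinberg G) (arrows_bimodule G x)
     (Ind G x (scalar_module :: ('k::field, ('a, 'b) garrow \<Rightarrow>\<^sub>0 'k, 'k) lmodule))"
proof (rule isomorphic_modules_transport[OF arrows_left_module, where \<phi> = simple_tensor])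
  have carrier: "carrier (scalar_module :: (_, ('a, 'b) garrow \<Rightarrow>\<^sub>0 'k, 'k) lmodule) = UNIV"
    by (simp add: scalar_module_def)
  note simps = Ind_def tensor_product_def Let_def tensor_kernel_def[symmetric] carrier
      arrows_bimodule_simps
  show "bij_betw simple_tensor (carrier (arrows_bimodule G x)) (carrier (Ind G x (scalar_module ::
      (_, _, 'k) lmodule)))"
    using simple_tensor_bij by (simp add: simps)
  show "simple_tensor \<zero>\<^bsub>arrows_bimodule G x\<^esub> = \<zero>\<^bsub>Ind G x (scalar_module :: (_, _, 'k) lmodule)\<^esub>"
    using simple_tensor_zero by (simp add: simps FactGroup_def)
  fix m :: "('a, 'b) garrow \<Rightarrow>\<^sub>0 'k" assume "m \<in> carrier (arrows_bimodule G x)"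
  then have m: "m \<in> arrow_space G x" by simp
  show "simple_tensor m \<oplus>\<^bsub>Ind G x (scalar_module :: (_, _, 'k) lmodule)\<^esub> simple_tensor n =
      simple_tensor (m \<oplus>\<^bsub>arrows_bimodule G x\<^esub> n)" if "n \<in> carrier (arrows_bimodule G x)" for n
    using simple_tensor_add[OF m] that by (simp add: simps FactGroup_def)
  show "c \<odot>\<^bsub>Ind G x (scalar_module :: (_, _, 'k) lmodule)\<^esub> simple_tensor m =
      simple_tensor (c \<odot>\<^bsub>arrows_bimodule G x\<^esub> m)" for c
    using first_factor_action[OF _ _ m, of "pm_scale c"]
    by (simp add: simps arrow_space_scale pm_linear_iff pm.scale_right_distrib mult.commute)
  show "lact (Ind G x (scalar_module :: (_, _, 'k) lmodule)) f (simple_tensor m) =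
      simple_tensor (lact (arrows_bimodule G x) f m)" for f
    using first_factor_action[OF pm_linear_arrows_lact arrows_lact_arrow_space m]
    by (simp add: simps)
qed (simp_all add: steinberg_span_add steinberg_span_scale steinberg_span_convolution)

end

section \<open>Words in the generators acting on a module\<close>

text \<open>
The action of noncommutative polynomials that is determined by operators for the letters. It is
used for the letters acting on arrows and for the letters acting on paths.
\<close>

definition word_act :: "('l \<Rightarrow> ('y \<Rightarrow>\<^sub>0 'k::field) \<Rightarrow> ('y \<Rightarrow>\<^sub>0 'k)) \<Rightarrow> ('l list \<Rightarrow>\<^sub>0 'k) \<Rightarrow>
    ('y \<Rightarrow>\<^sub>0 'k) \<Rightarrow> ('y \<Rightarrow>\<^sub>0 'k)" where
  "word_act op z m = linear_extend (\<lambda>w. foldr op w m) z"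

lemma pm_linear_foldr:
  assumes "\<And>l. pm_linear (op l)"
  shows "pm_linear (foldr op w)"
proof (induction w)
  case Nil
  show ?case by (simp add: pm_linear_iff)
next
  case (Cons l w)
  then show ?case using pm_linear_comp[OF assms[of l] Cons] by (simp add: comp_def)
qed

lemma pm_linear_word_act_left: "pm_linear (\<lambda>z. word_act op z m)"
  unfolding word_act_def by (rule pm_linear_linear_extend)

lemma pm_linear_word_act_right:
  assumes "\<And>l. pm_linear (op l)"
  shows "pm_linear (word_act op z)"
proof -
  have "pm_linear (foldr op w)" for w by (rule pm_linear_foldr) (rule assms)
  then show ?thesis
    by (simp add: pm_linear_iff word_act_def linear_extend_def pm.scale_right_distrib sum.distrib
        pm.scale_sum_right mult.commute)
qed

lemma word_act_single [simp]: "word_act op (Poly_Mapping.single w c) m = pm_scale c (foldr op w m)"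
  by (simp add: word_act_def)

lemma word_act_mult:
  assumes "\<And>l. pm_linear (op l)"
  shows "word_act op (bilinear_extend (@) z z') m = word_act op z (word_act op z' m)"
proof -
  have "word_act op (bilinear_extend (@) z z') m =
      linear_extend (\<lambda>s. linear_extend (\<lambda>t. foldr op s (foldr op t m)) z') z"
    by (simp add: bilinear_extend_conv_linear_extend
        pm_linear_linear_extend_comp[OF pm_linear_word_act_left])
  also have "\<dots> = word_act op z (word_act op z' m)"
  proof -
    have "pm_linear (foldr op w)" for w by (rule pm_linear_foldr) (rule assms)
    then show ?thesis unfolding word_act_def by (simp add: pm_linear_linear_extend_comp)
  qed
  finally show ?thesis .
qed

fun letter_weight :: "('e \<Rightarrow> 'k::field) \<Rightarrow> ('v, 'e) letter \<Rightarrow> 'k" where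
  "letter_weight a (Vertex v) = 1"
| "letter_weight a (Arc e) = a e"
| "letter_weight a (Ghost e) = inverse (a e)"

definition word_weight :: "('e \<Rightarrow> 'k::field) \<Rightarrow> ('v, 'e) letter list \<Rightarrow> 'k" where
  "word_weight a w = prod_list (map (letter_weight a) w)"

text \<open>
The twist on representatives in the free algebra.
\<close>

definition rescale :: "('e \<Rightarrow> 'k::field) \<Rightarrow> (('v, 'e) letter list \<Rightarrow>\<^sub>0 'k) \<Rightarrow> (('v, 'e) letter list \<Rightarrow>\<^sub>0
    'k)" where
  "rescale a = linear_extend (\<lambda>w. Poly_Mapping.single w (word_weight a w))"

lemma pm_linear_rescale: "pm_linear (rescale a)"
  unfolding rescale_def by (rule pm_linear_linear_extend)

lemma rescale_single [simp]:
  "rescale a (Poly_Mapping.single w c) = Poly_Mapping.single w (c * word_weight a w)"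
  by (simp add: rescale_def)

lemma rescale_mult:
  "rescale a (bilinear_extend (@) z z') = bilinear_extend (@) (rescale a z) (rescale a z')"
proof -
  have "rescale a (bilinear_extend (@) z z') =
      linear_extend (\<lambda>s. linear_extend (\<lambda>t. Poly_Mapping.single (s @ t) (word_weight a s *
          word_weight a t)) z') z"
    by (simp add: bilinear_extend_conv_linear_extend pm_linear_linear_extend_comp[OF
        pm_linear_rescale]
        word_weight_def)
  also have "\<dots> = linear_extend (\<lambda>s. pm_scale (word_weight a s)
      (linear_extend (\<lambda>t. pm_scale (word_weight a t) (Poly_Mapping.single (s @ t) 1)) z')) z"
    by (simp flip: linear_extend_scale_fun)
  also have "\<dots> = bilinear_extend (@) (rescale a z) (rescale a z')"
    by (simp add: bilinear_extend_conv_linear_extend rescale_def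
        pm_linear_linear_extend_comp[OF pm_linear_linear_extend])
  finally show ?thesis .
qed

lemma rescale_one:
  fixes z :: "('v, 'e) letter list \<Rightarrow>\<^sub>0 'k::field"
  shows "rescale (\<lambda>_. 1) z = z"
proof -
  have "letter_weight (\<lambda>_. 1) l = (1 :: 'k)" for l :: "('v, 'e) letter" by (cases l) auto
  then have "word_weight (\<lambda>_. 1) w = (1 :: 'k)" for w :: "('v, 'e) letter list"
    by (induction w) (auto simp: word_weight_def)
  then show ?thesis by (simp add: rescale_def linear_extend_id)
qed

lemma word_act_rescale:
  "word_act op (rescale a z) m = linear_extend (\<lambda>w. pm_scale (word_weight a w) (foldr op w m)) z"
  unfolding rescale_def by (simp add: pm_linear_linear_extend_comp[OF pm_linear_word_act_left])

section \<open>The free algebra and the Leavitt ideal\<close>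

definition letter_words :: "('v, 'e) pre_digraph \<Rightarrow> ('v, 'e) letter list set" where
  "letter_words E = {w. w \<noteq> [] \<and> set w \<subseteq> letters E}"

definition free_space :: "('v, 'e) pre_digraph \<Rightarrow> (('v, 'e) letter list \<Rightarrow>\<^sub>0 'k::field) set" where
  "free_space E = {z. keys z \<subseteq> letter_words E}"

lemma free_algebra_simps [simp]:
  "carrier (free_algebra E) = free_space E"
  "z \<otimes>\<^bsub>free_algebra E\<^esub> z' = bilinear_extend (@) z z'"
  "z \<oplus>\<^bsub>free_algebra E\<^esub> z' = z + z'"
  "\<zero>\<^bsub>free_algebra E\<^esub> = 0"
  "c \<odot>\<^bsub>free_algebra E\<^esub> z = pm_scale c z"
  by (simp_all add: free_algebra_def free_space_def letter_words_def)

lemma free_space_0: "0 \<in> free_space E"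
  and free_space_add: "z \<in> free_space E \<Longrightarrow> z' \<in> free_space E \<Longrightarrow> z + z' \<in> free_space E"
  and free_space_scale: "z \<in> free_space E \<Longrightarrow> pm_scale c z \<in> free_space E"
  by (simp_all add: free_space_def keys_add_subset keys_pm_scale_subset)

lemma free_space_diff: "z \<in> free_space E \<Longrightarrow> z' \<in> free_space E \<Longrightarrow> z - z' \<in> free_space E"
  using keys_diff[of z z'] by (auto simp: free_space_def)

lemma free_space_sum: "(\<And>i. i \<in> S \<Longrightarrow> f i \<in> free_space E) \<Longrightarrow> sum f S \<in> free_space E"
  using keys_sum_subset[of S f "letter_words E"] by (simp add: free_space_def)

lemma free_space_single: "w \<in> letter_words E \<Longrightarrow> Poly_Mapping.single w c \<in> free_space E"
  by (simp add: free_space_def)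

lemma free_space_mult:
  "z \<in> free_space E \<Longrightarrow> z' \<in> free_space E \<Longrightarrow> bilinear_extend (@) z z' \<in> free_space E"
  unfolding free_space_def mem_Collect_eq
  by (rule keys_bilinear_extend) (simp add: letter_words_def subset_iff)

lemma free_algebra_ideal: "algebra_ideal (free_algebra E) (free_space E)"
  by (simp add: algebra_ideal_def free_space_0 free_space_add free_space_scale free_space_mult)

lemma algebra_ideal_hull:
  assumes "S \<subseteq> I" "algebra_ideal A I"
  shows "algebra_ideal A (algebra_ideal A hull S)"
proof -
  let ?H = "algebra_ideal A hull S"
  have mem: "z \<in> ?H \<longleftrightarrow> (\<forall>J. algebra_ideal A J \<and> S \<subseteq> J \<longrightarrow> z \<in> J)" for z
    by (auto simp: hull_def)
  have "?H \<subseteq> I" using assms mem by blast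
  then have sub: "?H \<subseteq> carrier A" using assms(2) by (auto simp: algebra_ideal_def)
  show ?thesis
    unfolding algebra_ideal_def[of A ?H]
  proof (intro conjI ballI allI)
    show "?H \<subseteq> carrier A" by (rule sub)
  qed (auto simp: mem algebra_ideal_def)
qed

lemma algebra_ideal_uminus:
  fixes I :: "(('v, 'e) letter list \<Rightarrow>\<^sub>0 'k::field) set"
  assumes "algebra_ideal (free_algebra E) I" "z \<in> I"
  shows "- z \<in> I"
proof -
  have "pm_scale (- 1) z \<in> I" using assms unfolding algebra_ideal_def free_algebra_simps by blast
  then show ?thesis by simp
qed

context wf_digraph
begin

lemma leavitt_relations_cases:
  fixes z :: "('a, 'b) letter list \<Rightarrow>\<^sub>0 'k::field"
  assumes "z \<in> leavitt_relations G"
  obtains (vertices) v w where "v \<in> verts G" "w \<in> verts G"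
      "z = word [Vertex v, Vertex w] - (if v = w then word [Vertex v] else 0)"
    | (tail_arc) e where "e \<in> arcs G" "z = word [Vertex (tail G e), Arc e] - word [Arc e]"
    | (arc_head) e where "e \<in> arcs G" "z = word [Arc e, Vertex (head G e)] - word [Arc e]"
    | (head_ghost) e where "e \<in> arcs G" "z = word [Vertex (head G e), Ghost e] - word [Ghost e]"
    | (ghost_tail) e where "e \<in> arcs G" "z = word [Ghost e, Vertex (tail G e)] - word [Ghost e]"
    | (ghost_arc) e f where "e \<in> arcs G" "f \<in> arcs G"
      "z = word [Ghost e, Arc f] - (if e = f then word [Vertex (head G e)] else 0)"
    | (arc_sum) v where "regular G v"
      "z = word [Vertex v] - (\<Sum>e\<in>out_arcs G v. word [Arc e, Ghost e])"
  using assms unfolding leavitt_relations_def by blast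

lemma leavitt_relations_subset: "leavitt_relations G \<subseteq> free_space G"
proof -
  have w: "word ws \<in> free_space G" if "ws \<noteq> []" "set ws \<subseteq> letters G" for ws :: "('a, 'b) letter
      list"
    using that by (intro free_space_single) (simp add: letter_words_def)
  have l: "v \<in> verts G \<Longrightarrow> Vertex v \<in> letters G" "e \<in> arcs G \<Longrightarrow> Arc e \<in> letters G"
    "e \<in> arcs G \<Longrightarrow> Ghost e \<in> letters G" for v e
    by (auto simp: letters_def)
  have "z \<in> free_space G" if "z \<in> leavitt_relations G" for z
    using that unfolding leavitt_relations_def regular_def
    by (auto intro!: free_space_diff free_space_sum w l free_space_0)
  then show ?thesis by blast
qed

lemma leavitt_ideal_is_ideal: "algebra_ideal (free_algebra G) (leavitt_ideal G)"
  unfolding leavitt_ideal_def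
  by (rule algebra_ideal_hull[OF leavitt_relations_subset free_algebra_ideal])

lemma relation_in_leavitt_ideal: "z \<in> leavitt_relations G \<Longrightarrow> z \<in> leavitt_ideal G"
  unfolding leavitt_ideal_def by (rule hull_inc)

lemma leavitt_ideal_free_space: "z \<in> leavitt_ideal G \<Longrightarrow> z \<in> free_space G"
  and leavitt_ideal_0: "0 \<in> leavitt_ideal G"
  and leavitt_ideal_add: "z \<in> leavitt_ideal G \<Longrightarrow> z' \<in> leavitt_ideal G \<Longrightarrow> z + z' \<in> leavitt_ideal G"
  and leavitt_ideal_scale: "z \<in> leavitt_ideal G \<Longrightarrow> pm_scale c z \<in> leavitt_ideal G"
  and leavitt_ideal_mult_left: "z \<in> leavitt_ideal G \<Longrightarrow> y \<in> free_space G \<Longrightarrow> bilinear_extend (@) y z \<in>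
      leavitt_ideal G"
  and leavitt_ideal_mult_right: "z \<in> leavitt_ideal G \<Longrightarrow> y \<in> free_space G \<Longrightarrow> bilinear_extend (@) z y \<in>
      leavitt_ideal G"
  using leavitt_ideal_is_ideal by (auto simp: algebra_ideal_def)

lemma leavitt_ideal_uminus: "z \<in> leavitt_ideal G \<Longrightarrow> - z \<in> leavitt_ideal G"
  by (rule algebra_ideal_uminus[OF leavitt_ideal_is_ideal])

lemma leavitt_ideal_diff: "z \<in> leavitt_ideal G \<Longrightarrow> z' \<in> leavitt_ideal G \<Longrightarrow> z - z' \<in> leavitt_ideal G"
  using leavitt_ideal_add[OF _ leavitt_ideal_uminus, of z z'] by simp

lemma leavitt_ideal_induct:
  assumes "z \<in> leavitt_ideal G" "algebra_ideal (free_algebra G) {z \<in> free_space G. P z}"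
    and "\<And>z. z \<in> leavitt_relations G \<Longrightarrow> P z"
  shows "P z"
proof -
  have "leavitt_ideal G \<subseteq> {z \<in> free_space G. P z}"
    unfolding leavitt_ideal_def using assms(2,3) leavitt_relations_subset by (intro hull_minimal)
        auto
  then show ?thesis using assms(1) by blast
qed

text \<open>
The elements that act as zero on an invariant subspace form an ideal.
\<close>

lemma leavitt_ideal_word_act:
  assumes z: "z \<in> leavitt_ideal G" and lin: "\<And>l. pm_linear (op l)"
    and inv: "\<And>l m. l \<in> letters G \<Longrightarrow> keys m \<subseteq> Y \<Longrightarrow> keys (op l m) \<subseteq> Y"
    and rel: "\<And>z m. z \<in> leavitt_relations G \<Longrightarrow> keys m \<subseteq> Y \<Longrightarrow> word_act op z m = 0"
    and m: "keys m \<subseteq> Y"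
  shows "word_act op z m = 0"
proof -
  have inv_word: "keys (foldr op w m) \<subseteq> Y" if "set w \<subseteq> letters G" "keys m \<subseteq> Y" for w m
    using that by (induction w) (simp_all add: inv)
  have inv_z: "keys (word_act op z m) \<subseteq> Y" if "z \<in> free_space G" "keys m \<subseteq> Y" for z m
    unfolding word_act_def using that
    by (intro keys_linear_extend inv_word) (auto simp: free_space_def letter_words_def)
  note add = pm_linear_add[OF pm_linear_word_act_left] and scale = pm_linear_scale[OF
      pm_linear_word_act_left]
    and zero = pm_linear_zero[OF pm_linear_word_act_left]
    and zero' = pm_linear_zero[OF pm_linear_word_act_right[OF lin]]
  have "\<forall>m. keys m \<subseteq> Y \<longrightarrow> word_act op z m = 0"
    by (rule leavitt_ideal_induct[OF z])
      (use rel in \<open>auto simp: algebra_ideal_def free_space_0 free_space_add free_space_scale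
        free_space_mult word_act_mult[OF lin] add scale zero zero' inv_z\<close>)
  then show ?thesis using m by blast
qed

section \<open>The Leavitt path algebra as a set of cosets\<close>

definition leavitt_class :: "(('a, 'b) letter list \<Rightarrow>\<^sub>0 'k::field) \<Rightarrow> (('a, 'b) letter list \<Rightarrow>\<^sub>0 'k)
    set" where
  "leavitt_class z = leavitt_ideal G +>\<^bsub>free_algebra G\<^esub> z"

lemma leavitt_class_conv: "leavitt_class z = (\<lambda>i. i + z) ` leavitt_ideal G"
  by (auto simp: leavitt_class_def a_r_coset_def')

lemma mem_leavitt_class: "z' \<in> leavitt_class z \<longleftrightarrow> z' - z \<in> leavitt_ideal G"
  unfolding leavitt_class_conv by (auto simp: image_iff) (metis diff_add_cancel)

lemma self_in_leavitt_class: "z \<in> leavitt_class z"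
  by (simp add: mem_leavitt_class leavitt_ideal_0)

lemma leavitt_class_eqI: "z - z' \<in> leavitt_ideal G \<Longrightarrow> leavitt_class z = leavitt_class z'"
  using leavitt_ideal_add[of _ "z - z'"] leavitt_ideal_diff[of _ "z - z'"] by (auto simp:
      mem_leavitt_class) (fastforce simp: algebra_simps)+

lemma leavitt_carrier: "carrier (leavitt G) = leavitt_class ` free_space G"
  by (auto simp: leavitt_def quotient_algebra_def ring.extend_def module.fields_def FactRing_def
      A_RCOSETS_def' leavitt_class_def)

lemma leavitt_zero: "\<zero>\<^bsub>leavitt G\<^esub> = leavitt_class 0"
  by (simp add: leavitt_def quotient_algebra_def ring.extend_def module.fields_def FactRing_def
      leavitt_class_conv)

lemma leavitt_add: "leavitt_class z \<oplus>\<^bsub>leavitt G\<^esub> leavitt_class z' = leavitt_class (z + z')"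
proof -
  have "leavitt_class z \<oplus>\<^bsub>leavitt G\<^esub> leavitt_class z' = (\<Union>h\<in>leavitt_class z. \<Union>k\<in>leavitt_class z'. {h
      + k})"
    by (simp add: leavitt_def quotient_algebra_def ring.extend_def module.fields_def FactRing_def
        set_add_def')
  also have "\<dots> = leavitt_class (z + z')"
  proof (rule equalityI; rule subsetI)
    fix y assume "y \<in> (\<Union>h\<in>leavitt_class z. \<Union>k\<in>leavitt_class z'. {h + k})"
    then obtain h k where hk: "h - z \<in> leavitt_ideal G" "k - z' \<in> leavitt_ideal G" "y = h + k" by
        (auto simp: mem_leavitt_class)
    have "y - (z + z') = (h - z) + (k - z')" by (simp add: hk)
    then show "y \<in> leavitt_class (z + z')" unfolding mem_leavitt_class by (simp only:) (rule
        leavitt_ideal_add[OF hk(1,2)])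
  next
    fix y assume "y \<in> leavitt_class (z + z')"
    then have "(y - z') - z \<in> leavitt_ideal G" by (simp add: mem_leavitt_class algebra_simps)
    then have "y - z' \<in> leavitt_class z" "z' \<in> leavitt_class z'" "y = (y - z') + z'" by (simp_all
        add: mem_leavitt_class leavitt_ideal_0)
    then show "y \<in> (\<Union>h\<in>leavitt_class z. \<Union>k\<in>leavitt_class z'. {h + k})" by blast
  qed
  finally show ?thesis .
qed

lemma leavitt_smult: "c \<odot>\<^bsub>leavitt G\<^esub> leavitt_class z = leavitt_class (pm_scale c z)"
proof -
  have "c \<odot>\<^bsub>leavitt G\<^esub> leavitt_class z = (\<Union>y\<in>leavitt_class z. leavitt_class (pm_scale c y))"
    by (simp add: leavitt_def quotient_algebra_def ring.extend_def module.fields_def FactRing_def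
        leavitt_class_def)
  also have "\<dots> = leavitt_class (pm_scale c z)"
  proof (rule UN_const_on[OF self_in_leavitt_class], rule leavitt_class_eqI)
    fix y assume "y \<in> leavitt_class z"
    then have "y - z \<in> leavitt_ideal G" by (simp only: mem_leavitt_class)
    from leavitt_ideal_scale[OF this] show "pm_scale c y - pm_scale c z \<in> leavitt_ideal G"
      by (simp only: pm.scale_right_diff_distrib)
  qed
  finally show ?thesis .
qed

lemma leavitt_mult:
  assumes "z \<in> free_space G" "z' \<in> free_space G"
  shows "leavitt_class z \<otimes>\<^bsub>leavitt G\<^esub> leavitt_class z' = leavitt_class (bilinear_extend (@) z z')"
proof -
  have "leavitt_class z \<otimes>\<^bsub>leavitt G\<^esub> leavitt_class z' = (\<Union>a\<in>leavitt_class z. \<Union>b\<in>leavitt_class z'.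
      leavitt_class (bilinear_extend (@) a b))"
    by (simp add: leavitt_def quotient_algebra_def ring.extend_def module.fields_def FactRing_def
        rcoset_mult_def leavitt_class_def)
  also have "\<dots> = leavitt_class (bilinear_extend (@) z z')"
  proof (rule UN_const_on[OF self_in_leavitt_class], rule UN_const_on[OF self_in_leavitt_class],
      rule leavitt_class_eqI)
    fix a b assume a: "a \<in> leavitt_class z" and b: "b \<in> leavitt_class z'"
    have a': "a - z \<in> leavitt_ideal G" and b': "b - z' \<in> leavitt_ideal G" using a b by (simp_all
        add: mem_leavitt_class)
    have b_free: "b \<in> free_space G"
      using free_space_add[OF leavitt_ideal_free_space[OF b'] assms(2)] by simp
    have "bilinear_extend (@) a b - bilinear_extend (@) z z' =
        bilinear_extend (@) (a - z) b + bilinear_extend (@) z (b - z')"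
      by (simp add: bilinear_extend_diff_left bilinear_extend_diff_right)
    then show "bilinear_extend (@) a b - bilinear_extend (@) z z' \<in> leavitt_ideal G"
      using leavitt_ideal_add[OF leavitt_ideal_mult_right[OF a' b_free] leavitt_ideal_mult_left[OF
          b' assms(1)]] by simp
  qed
  finally show ?thesis .
qed

lemma on_cosets_leavitt_class:
  assumes "\<And>i. i \<in> leavitt_ideal G \<Longrightarrow> h (i + z) = v"
  shows "on_cosets h (leavitt_class z) = v"
  by (rule on_cosets_const[OF self_in_leavitt_class]) (auto simp: leavitt_class_conv assms)

lemma abelian_monoid_leavitt: "abelian_monoid (leavitt G)"
  by (rule abelian_monoidI)
    (auto simp: leavitt_carrier leavitt_add leavitt_zero free_space_add free_space_0 algebra_simps)

lemma finsum_leavitt: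
  assumes "finite A" "\<And>a. a \<in> A \<Longrightarrow> f a \<in> free_space G"
  shows "(\<Oplus>\<^bsub>leavitt G\<^esub>a\<in>A. leavitt_class (f a)) = leavitt_class (sum f A)"
  using assms
proof (induction A)
  case empty
  then show ?case by (simp add: abelian_monoid.finsum_empty[OF abelian_monoid_leavitt] leavitt_zero)
next
  case (insert a A)
  then show ?case
    by (subst abelian_monoid.finsum_insert[OF abelian_monoid_leavitt])
      (auto simp: leavitt_carrier leavitt_add)
qed

section \<open>The twist\<close>

lemma rescale_free_space: "z \<in> free_space G \<Longrightarrow> rescale a z \<in> free_space G"
  unfolding free_space_def rescale_def mem_Collect_eq
  by (rule keys_linear_extend) (auto split: if_splits)

text \<open>
Each defining relation is homogeneous for the weights: all words in it that have a nonzero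
coefficient have the same weight, with \<open>e\<close> and \<open>e\<^sup>*\<close> cancelling each other.
So the twist only multiplies it by a scalar.
\<close>

lemma rescale_leavitt_ideal:
  fixes a :: "'b \<Rightarrow> 'k::field" and z :: "('a, 'b) letter list \<Rightarrow>\<^sub>0 'k"
  assumes a: "\<And>e. e \<in> arcs G \<Longrightarrow> a e \<noteq> 0" and "z \<in> leavitt_ideal G"
  shows "rescale a z \<in> leavitt_ideal G"
proof (rule leavitt_ideal_induct[OF \<open>z \<in> leavitt_ideal G\<close>])
  show "algebra_ideal (free_algebra G) {z \<in> free_space G. rescale a z \<in> leavitt_ideal G}"
    by (auto simp: algebra_ideal_def free_space_0 free_space_add free_space_scale free_space_mult
        rescale_mult rescale_free_space leavitt_ideal_0 leavitt_ideal_add leavitt_ideal_scale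
            leavitt_ideal_mult_left leavitt_ideal_mult_right
        pm_linear_zero[OF pm_linear_rescale] pm_linear_add[OF pm_linear_rescale]
        pm_linear_scale[OF pm_linear_rescale])
next
  fix z :: "('a, 'b) letter list \<Rightarrow>\<^sub>0 'k" assume z: "z \<in> leavitt_relations G"
  note simps = pm_linear_diff[OF pm_linear_rescale] pm_linear_sum[OF pm_linear_rescale]
    pm_linear_zero[OF pm_linear_rescale] word_weight_def pm.scale_right_diff_distrib
  have "\<exists>c. rescale a z = pm_scale c z"
    using z
  proof (cases rule: leavitt_relations_cases)
    case (vertices v w)
    then show ?thesis by (intro exI[of _ 1]) (simp add: simps)
  next
    case (tail_arc e)
    then show ?thesis by (intro exI[of _ "a e"]) (simp add: simps)
  next
    case (arc_head e)
    then show ?thesis by (intro exI[of _ "a e"]) (simp add: simps)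
  next
    case (head_ghost e)
    then show ?thesis by (intro exI[of _ "inverse (a e)"]) (simp add: simps)
  next
    case (ghost_tail e)
    then show ?thesis by (intro exI[of _ "inverse (a e)"]) (simp add: simps)
  next
    case (ghost_arc e f)
    then show ?thesis using a by (intro exI[of _ "inverse (a e) * a f"]) (simp add: simps)
  next
    case (arc_sum v)
    then show ?thesis using a by (intro exI[of _ 1]) (simp add: simps)
  qed
  then show "rescale a z \<in> leavitt_ideal G" using leavitt_ideal_scale[OF
      relation_in_leavitt_ideal[OF z]] by auto
qed

lemma eval_word_twist:
  fixes a :: "'b \<Rightarrow> 'k::field" and w :: "('a, 'b) letter list"
  assumes "w \<in> letter_words G"
  shows "eval_word (leavitt G) (twist_generator G a) w = leavitt_class (Poly_Mapping.single w
      (word_weight a w))"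
  using assms
proof (induction w rule: induct_list012)
  case (2 l)
  then show ?case by (cases l) (auto simp: word_weight_def generator_def leavitt_smult simp flip:
      leavitt_class_def)
next
  case (3 l l' w)
  have "eval_word (leavitt G) (twist_generator G a) [l] = leavitt_class (Poly_Mapping.single [l]
      (word_weight a [l]))"
    by (cases l) (auto simp: word_weight_def generator_def leavitt_smult simp flip:
        leavitt_class_def)
  moreover have "l' # w \<in> letter_words G" "[l] \<in> letter_words G" using 3 by (auto simp:
      letter_words_def)
  ultimately show ?case using 3
    by (simp add: leavitt_mult free_space_single word_weight_def)
qed (simp add: letter_words_def)

lemma twist_leavitt_class:
  fixes a :: "'b \<Rightarrow> 'k::field" and z :: "('a, 'b) letter list \<Rightarrow>\<^sub>0 'k"
  assumes a: "\<And>e. e \<in> arcs G \<Longrightarrow> a e \<noteq> 0" and z: "z \<in> free_space G"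
  shows "twist G a (leavitt_class z) = leavitt_class (rescale a z)"
proof -
  have *: "(\<Oplus>\<^bsub>leavitt G\<^esub>w\<in>keys y. lookup y w \<odot>\<^bsub>leavitt G\<^esub> eval_word (leavitt G) (twist_generator G
      a) w) =
      leavitt_class (rescale a y)" if y: "y \<in> free_space G" for y :: "('a, 'b) letter list \<Rightarrow>\<^sub>0 'k"
  proof -
    have w: "w \<in> letter_words G" if "w \<in> keys y" for w using that y by (auto simp: free_space_def)
    have "(\<Oplus>\<^bsub>leavitt G\<^esub>w\<in>keys y. lookup y w \<odot>\<^bsub>leavitt G\<^esub> eval_word (leavitt G) (twist_generator G a)
        w) =
      (\<Oplus>\<^bsub>leavitt G\<^esub>w\<in>keys y. leavitt_class (pm_scale (lookup y w) (Poly_Mapping.single w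
          (word_weight a w))))"
      by (rule abelian_monoid.finsum_cong'[OF abelian_monoid_leavitt])
        (auto simp: eval_word_twist w leavitt_smult leavitt_carrier free_space_single)
    also have "\<dots> = leavitt_class (rescale a y)"
      by (subst finsum_leavitt) (simp_all add: w free_space_single rescale_def linear_extend_def)
    finally show ?thesis .
  qed
  show ?thesis unfolding twist_def leavitt_hom_def
  proof (rule on_cosets_leavitt_class)
    fix i :: "('a, 'b) letter list \<Rightarrow>\<^sub>0 'k" assume i: "i \<in> leavitt_ideal G"
    have "leavitt_class (rescale a (i + z)) = leavitt_class (rescale a z)"
      using rescale_leavitt_ideal[OF a i] by (intro leavitt_class_eqI) (simp add: pm_linear_add[OF
          pm_linear_rescale])
    then show "(\<Oplus>\<^bsub>leavitt G\<^esub>w\<in>keys (i + z). lookup (i + z) w \<odot>\<^bsub>leavitt G\<^esub>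
        eval_word (leavitt G) (twist_generator G a) w) = leavitt_class (rescale a z)"
      using * free_space_add[OF leavitt_ideal_free_space[OF i] z] by simp
  qed
qed

section \<open>The generators acting on arrows\<close>

text \<open>
The indicator of a set on which the range map is injective permutes basis arrows partially.
\<close>

lemma arrows_lact_indicator:
  assumes A: "A \<subseteq> gpd G" "inj_on grange A" and t: "t \<in> arrows_to G x"
    and \<alpha>: "\<alpha> \<in> A" "grange \<alpha> = gsource t"
  shows "arrows_lact G x (indicator A) (Poly_Mapping.single t 1) = (Poly_Mapping.single (gmult \<alpha> t)
      1 :: _ \<Rightarrow>\<^sub>0 'k::field)"
proof (rule poly_mapping_eqI)
  fix y
  obtain q l where t': "t = (q, l, x)" using t by (cases t) auto
  obtain p k where \<alpha>': "\<alpha> = (p, k, q)" using \<alpha>(2) t' by (cases \<alpha>) auto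
  have "gmult \<alpha> t \<in> arrows_to G x"
    using A(1) \<alpha>(1) t gpd_mult by (auto simp: t' \<alpha>')
  moreover have "gmult y (ginv t) \<in> A \<longleftrightarrow> y = gmult \<alpha> t" if "y \<in> arrows_to G x"
  proof -
    obtain r j where y: "y = (r, j, x)" using \<open>y \<in> arrows_to G x\<close> by (cases y) auto
    have "gmult y (ginv t) \<in> A \<longleftrightarrow> gmult y (ginv t) = \<alpha>"
      using inj_onD[OF A(2), of "gmult y (ginv t)" \<alpha>] \<alpha> by (auto simp: y t')
    also have "\<dots> \<longleftrightarrow> y = gmult \<alpha> t" by (auto simp: y t' \<alpha>')
    finally show ?thesis .
  qed
  ultimately show "lookup (arrows_lact G x (indicator A) (Poly_Mapping.single t 1)) y =
      lookup (Poly_Mapping.single (gmult \<alpha> t) (1::'k)) y"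
    by (auto simp: lookup_arrows_lact_single[OF column_finite_indicator[OF A] t] lookup_single
        when_def indicator_def)
qed

lemma arrows_lact_indicator_none:
  assumes A: "A \<subseteq> gpd G" "inj_on grange A" and t: "t \<in> arrows_to G x"
    and none: "\<And>\<alpha>. \<alpha> \<in> A \<Longrightarrow> grange \<alpha> \<noteq> gsource t"
  shows "arrows_lact G x (indicator A) (Poly_Mapping.single t 1) = (0 :: _ \<Rightarrow>\<^sub>0 'k::field)"
proof (rule poly_mapping_eqI)
  fix y
  have "gmult y (ginv t) \<notin> A" using none[of "gmult y (ginv t)"] by (cases y; cases t) auto
  then show "lookup (arrows_lact G x (indicator A) (Poly_Mapping.single t 1)) y = lookup (0 :: _ \<Rightarrow>\<^sub>0
      'k) y"
    by (simp add: lookup_arrows_lact_single[OF column_finite_indicator[OF A] t])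
qed

definition arrow_op :: "('a, 'b) path \<Rightarrow> ('a, 'b) letter \<Rightarrow> (('a, 'b) garrow \<Rightarrow>\<^sub>0 'k::field) \<Rightarrow> (('a,
    'b) garrow \<Rightarrow>\<^sub>0 'k)"
  where "arrow_op x l = arrows_lact G x (steinberg_generator G l)"

lemma pm_linear_arrow_op: "pm_linear (arrow_op x l)"
  unfolding arrow_op_def by (rule pm_linear_arrows_lact)

lemma Zset_vertex:
  assumes "v \<in> verts G"
  shows "\<alpha> \<in> Zset G (v, []) (v, []) \<longleftrightarrow> (\<exists>y\<in>boundary_paths G. v = source G y \<and> \<alpha> = (y, 0, y))"
  using assms by (auto simp: Zset_iff)

lemma Zset_arc:
  assumes "e \<in> arcs G"
  shows "\<alpha> \<in> Zset G (arc_path G e) (head G e, []) \<longleftrightarrow>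
    (\<exists>y\<in>boundary_paths G. head G e = source G y \<and> \<alpha> = (conc (arc_path G e) y, 1, y))"
  using assms by (auto simp: Zset_iff) (auto simp: arc_path_def)

lemma Zset_ghost:
  assumes "e \<in> arcs G"
  shows "\<alpha> \<in> Zset G (head G e, []) (arc_path G e) \<longleftrightarrow>
    (\<exists>y\<in>boundary_paths G. head G e = source G y \<and> \<alpha> = (y, - 1, conc (arc_path G e) y))"
  using assms by (auto simp: Zset_iff) (auto simp: arc_path_def)

lemma generator_monomial: "l \<in> letters G \<Longrightarrow> steinberg_generator G l \<in> monomials"
  by (auto simp: letters_def intro!: monomialI)

lemma arrow_op_Vertex:
  assumes "v \<in> verts G" "(p, k, x) \<in> gpd G"
  shows "arrow_op x (Vertex v) (Poly_Mapping.single (p, k, x) 1) =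
    (if v = source G p then Poly_Mapping.single (p, k, x) 1 else 0)"
proof (cases "v = source G p")
  case True
  have "arrow_op x (Vertex v) (Poly_Mapping.single (p, k, x) 1) =
      Poly_Mapping.single (gmult (p, 0, p) (p, k, x)) 1"
    unfolding arrow_op_def steinberg_generator.simps
    using assms True gpd_boundary[OF assms(2)]
    by (intro arrows_lact_indicator Zset_subset_gpd Zset_inj) (auto simp: Zset_vertex)
  with True show ?thesis by simp
next
  case False
  have "arrow_op x (Vertex v) (Poly_Mapping.single (p, k, x) 1) = 0"
    unfolding arrow_op_def steinberg_generator.simps
    using assms False
    by (intro arrows_lact_indicator_none Zset_subset_gpd Zset_inj) (auto simp: Zset_vertex)
  with False show ?thesis by simp
qed

lemma arc_finite_paths: "e \<in> arcs G \<Longrightarrow> arc_path G e \<in> finite_paths G" "e \<in> arcs G \<Longrightarrow> (head G e, []) \<in>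
    finite_paths G"
  by simp_all

lemma arrow_op_Arc:
  assumes "e \<in> arcs G" "(p, k, x) \<in> gpd G"
  shows "arrow_op x (Arc e) (Poly_Mapping.single (p, k, x) 1) =
    (if head G e = source G p then Poly_Mapping.single (conc (arc_path G e) p, 1 + k, x) 1 else 0)"
proof (cases "head G e = source G p")
  case True
  then have \<alpha>: "(conc (arc_path G e) p, 1, p) \<in> Zset G (arc_path G e) (head G e, [])"
    unfolding Zset_arc[OF assms(1)] using gpd_boundary[OF assms(2)] by blast
  have "arrow_op x (Arc e) (Poly_Mapping.single (p, k, x) 1) =
      Poly_Mapping.single (gmult (conc (arc_path G e) p, 1, p) (p, k, x)) 1"
    unfolding arrow_op_def steinberg_generator.simps
    by (rule arrows_lact_indicator[OF Zset_subset_gpd Zset_inj[OF arc_finite_paths[OF assms(1)]] _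
        \<alpha>])
      (use assms(2) in simp_all)
  with True show ?thesis by simp
next
  case False
  then have none: "grange \<alpha> \<noteq> gsource (p, k, x)" if "\<alpha> \<in> Zset G (arc_path G e) (head G e, [])" for \<alpha>
    using that unfolding Zset_arc[OF assms(1)] by auto
  have "arrow_op x (Arc e) (Poly_Mapping.single (p, k, x) 1) = 0"
    unfolding arrow_op_def steinberg_generator.simps
    by (rule arrows_lact_indicator_none[OF Zset_subset_gpd Zset_inj[OF arc_finite_paths[OF
        assms(1)]] _ none])
      (use assms(2) in simp_all)
  with False show ?thesis by simp
qed

lemma arrow_op_Ghost:
  assumes "e \<in> arcs G" "(conc (arc_path G e) p, k, x) \<in> gpd G" "p \<in> boundary_paths G" "head G e =
      source G p"
  shows "arrow_op x (Ghost e) (Poly_Mapping.single (conc (arc_path G e) p, k, x) 1) =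
    Poly_Mapping.single (p, - 1 + k, x) 1"
proof -
  have \<alpha>: "(p, - 1, conc (arc_path G e) p) \<in> Zset G (head G e, []) (arc_path G e)"
    unfolding Zset_ghost[OF assms(1)] using assms(3,4) by blast
  have "arrow_op x (Ghost e) (Poly_Mapping.single (conc (arc_path G e) p, k, x) 1) =
      Poly_Mapping.single (gmult (p, - 1, conc (arc_path G e) p) (conc (arc_path G e) p, k, x)) 1"
    unfolding arrow_op_def steinberg_generator.simps
    by (rule arrows_lact_indicator[OF Zset_subset_gpd Zset_inj[OF arc_finite_paths(2,1)[OF
        assms(1)]] _ \<alpha>])
      (use assms(2) in simp_all)
  then show ?thesis by simp
qed

lemma arrow_op_Ghost_none:
  assumes "e \<in> arcs G" "(p, k, x) \<in> gpd G"
    and "\<And>p'. p' \<in> boundary_paths G \<Longrightarrow> head G e = source G p' \<Longrightarrow> p \<noteq> conc (arc_path G e) p'"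
  shows "arrow_op x (Ghost e) (Poly_Mapping.single (p, k, x) 1) = 0"
proof -
  have none: "grange \<alpha> \<noteq> gsource (p, k, x)" if \<alpha>: "\<alpha> \<in> Zset G (head G e, []) (arc_path G e)" for \<alpha>
  proof -
    obtain y where y: "y \<in> boundary_paths G" "head G e = source G y" "\<alpha> = (y, - 1, conc (arc_path G
        e) y)"
      using \<alpha> unfolding Zset_ghost[OF assms(1)] by blast
    show ?thesis using assms(3)[OF y(1,2)] unfolding y(3) by simp
  qed
  show ?thesis
    unfolding arrow_op_def steinberg_generator.simps
    by (rule arrows_lact_indicator_none[OF Zset_subset_gpd Zset_inj[OF arc_finite_paths(2,1)[OF
        assms(1)]] _ none])
      (use assms(2) in simp_all)
qed

lemma source_arc_conc: "e \<in> arcs G \<Longrightarrow> head G e = source G p \<Longrightarrow> source G (conc (arc_path G e) p) = tail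
    G e"
  using source_conc[OF arc_finite_paths(1), of e p] unfolding frange_arc_path by (simp add:
      arc_path_def)

lemma gpd_arc_mult:
  assumes "(p, k, x) \<in> gpd G" "e \<in> arcs G" "head G e = source G p"
  shows "(conc (arc_path G e) p, 1 + k, x) \<in> gpd G"
  using gpd_mult[OF gpd_arc assms(1)] assms gpd_boundary[OF assms(1)] by simp

lemma gpd_ghost_mult:
  assumes "(conc (arc_path G e) p, k, x) \<in> gpd G" "e \<in> arcs G" "head G e = source G p" "p \<in>
      boundary_paths G"
  shows "(p, - 1 + k, x) \<in> gpd G"
  using gpd_mult[OF gpd_inverse[OF gpd_arc] assms(1)] assms by simp

text \<open>
A boundary path may be trivial only at a vertex that is not regular, so one that starts at a regular
vertex has a first arc. This makes the relation \<open>v = \<Sum> e e\<^sup>*\<close> hold on arrows.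
\<close>

lemma regular_source_decomposition:
  assumes p: "p \<in> boundary_paths G" and reg: "regular G (source G p)"
  obtains e p' where "e \<in> arcs G" "p' \<in> boundary_paths G" "head G e = source G p'"
    "p = conc (arc_path G e) p'"
proof (cases p)
  case (FinPath \<mu>)
  obtain u es where \<mu>: "\<mu> = (u, es)" by force
  show thesis
  proof (cases es)
    case Nil
    then show thesis using p reg FinPath \<mu> by (simp add: fsource_def)
  next
    case (Cons e es')
    then show thesis using p FinPath \<mu>
      by (intro that[of e "FinPath (head G e, es')"]) (auto simp: fsource_def arc_path_def)
  qed
next
  case (InfPath w)
  then have w: "[shd w] @- stl w \<in> infinite_paths G" using p by simp
  from infinite_path_prefix[OF w] show thesis
    using InfPath by (intro that[of "shd w" "InfPath (stl w)"]) (auto simp: arc_path_def)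
qed

text \<open>
On a basis arrow \<open>(p, k, x)\<close> an arc is prefixed to \<open>p\<close> and a ghost arc removes the first arc of \<open>p\<close>, or
the result is zero. In the relation at a regular vertex \<open>v\<close>, if \<open>p\<close> starts at \<open>v\<close>, exactly one
summand survives, the one for the first arc of \<open>p\<close>.
\<close>

lemma arrow_op_relations:
  fixes z :: "('a, 'b) letter list \<Rightarrow>\<^sub>0 'k::field"
  assumes z: "z \<in> leavitt_relations G" and m: "keys m \<subseteq> arrows_to G x"
  shows "word_act (arrow_op x) z m = 0"
proof (rule pm_linear_eq_on[OF _ _ m])
  show "pm_linear (word_act (arrow_op x) z)" by (rule pm_linear_word_act_right[OF
      pm_linear_arrow_op])
  show "pm_linear (\<lambda>_ :: ('a, 'b) garrow \<Rightarrow>\<^sub>0 'k. 0 :: ('a, 'b) garrow \<Rightarrow>\<^sub>0 'k)" by (simp add: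
      pm_linear_iff)
  fix t assume "t \<in> arrows_to G x"
  then obtain p k where t: "t = (p, k, x)" and g: "(p, k, x) \<in> gpd G" by (cases t) auto
  have p: "p \<in> boundary_paths G" using gpd_boundary[OF g] by simp
  note zero = pm_linear_zero[OF pm_linear_arrow_op] and diff = pm_linear_diff[OF
      pm_linear_word_act_left]
    and sum = pm_linear_sum[OF pm_linear_word_act_left] and zero' = pm_linear_zero[OF
        pm_linear_word_act_left]
  have ghost: "(\<exists>p'. p' \<in> boundary_paths G \<and> head G e = source G p' \<and> p = conc (arc_path G e) p' \<and>
      arrow_op x (Ghost e) (Poly_Mapping.single (p, k, x) 1) = Poly_Mapping.single (p', - 1 + k, x)
          (1::'k) \<and>
      (p', - 1 + k, x) \<in> gpd G) \<or>
      arrow_op x (Ghost e) (Poly_Mapping.single (p, k, x) 1) = (0 :: _ \<Rightarrow>\<^sub>0 'k)" if "e \<in> arcs G" for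
          e
    using that g arrow_op_Ghost arrow_op_Ghost_none gpd_ghost_mult by metis
  show "word_act (arrow_op x) z (Poly_Mapping.single t 1) = 0"
    using z
  proof (cases rule: leavitt_relations_cases)
    case (vertices v w)
    then show ?thesis using g by (auto simp: t diff zero' arrow_op_Vertex zero)
  next
    case (tail_arc e)
    then show ?thesis using g gpd_arc_mult[OF g]
      by (auto simp: t diff arrow_op_Arc arrow_op_Vertex zero source_arc_conc)
  next
    case (arc_head e)
    then show ?thesis using g
      by (auto simp: t diff arrow_op_Arc arrow_op_Vertex zero)
  next
    case (head_ghost e)
    then show ?thesis using g ghost[of e]
      by (auto simp: t diff arrow_op_Vertex zero source_in_verts)
  next
    case (ghost_tail e)
    then show ?thesis using g ghost[of e]
      by (auto simp: t diff arrow_op_Vertex zero source_arc_conc)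
  next
    case (ghost_arc e f)
    have "arrow_op x (Ghost e) (Poly_Mapping.single (conc (arc_path G f) p, 1 + k, x) 1) =
        (if e = f then Poly_Mapping.single (p, k, x) 1 else (0 :: _ \<Rightarrow>\<^sub>0 'k))" if f: "head G f =
            source G p"
    proof (cases "e = f")
      case True
      then show ?thesis using arrow_op_Ghost[OF _ gpd_arc_mult[OF g _ f] p f] ghost_arc by simp
    next
      case False
      then show ?thesis
        using arrow_op_Ghost_none[OF _ gpd_arc_mult[OF g _ f], of e] ghost_arc f arc_conc_inj(1) by
            metis
    qed
    then show ?thesis using g ghost_arc
      by (auto simp: t diff arrow_op_Arc arrow_op_Vertex zero zero')
  next
    case (arc_sum v)
    have v: "v \<in> verts G" and fin: "finite (out_arcs G v)" using arc_sum by (auto simp: regular_def)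
    have "(\<Sum>e\<in>out_arcs G v. arrow_op x (Arc e) (arrow_op x (Ghost e) (Poly_Mapping.single (p, k, x)
        1))) =
        (if v = source G p then Poly_Mapping.single (p, k, x) 1 else (0 :: _ \<Rightarrow>\<^sub>0 'k))"
    proof (cases "v = source G p")
      case True
      then obtain e0 p0 where e0: "e0 \<in> arcs G" "p0 \<in> boundary_paths G" "head G e0 = source G p0"
        "p = conc (arc_path G e0) p0"
        using regular_source_decomposition p arc_sum by metis
      then have mem: "e0 \<in> out_arcs G v" using True by (simp add: source_arc_conc)
      have "arrow_op x (Arc e) (arrow_op x (Ghost e) (Poly_Mapping.single (p, k, x) 1)) =
        (if e = e0 then Poly_Mapping.single (p, k, x) 1 else (0 :: _ \<Rightarrow>\<^sub>0 'k))" if e: "e \<in> out_arcs G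
            v" for e
      proof (cases "e = e0")
        case True
        have g0: "(p0, - 1 + k, x) \<in> gpd G" using gpd_ghost_mult g e0 by simp
        have "arrow_op x (Ghost e) (Poly_Mapping.single (p, k, x) 1) =
            (Poly_Mapping.single (p0, - 1 + k, x) 1 :: _ \<Rightarrow>\<^sub>0 'k)"
          using arrow_op_Ghost[of e0 p0 k x] g e0 True by simp
        then show ?thesis using arrow_op_Arc[OF e0(1) g0] e0 True by simp
      next
        case False
        then have "arrow_op x (Ghost e) (Poly_Mapping.single (p, k, x) 1) = (0 :: _ \<Rightarrow>\<^sub>0 'k)"
          using e e0 by (intro arrow_op_Ghost_none[OF _ g]) (auto dest: arc_conc_inj(1))
        then show ?thesis using False by (simp add: zero)
      qed
      then show ?thesis using True mem fin by simp
    next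
      case False
      have "arrow_op x (Ghost e) (Poly_Mapping.single (p, k, x) 1) = (0 :: _ \<Rightarrow>\<^sub>0 'k)" if e: "e \<in>
          out_arcs G v" for e
        using e False by (intro arrow_op_Ghost_none[OF _ g]) (auto simp: source_arc_conc)
      then show ?thesis using False by (simp add: zero)
    qed
    then show ?thesis using g v
      by (simp add: arc_sum t diff sum arrow_op_Vertex)
  qed
qed

lemma leavitt_ideal_acts_zero_on_arrows:
  fixes z :: "('a, 'b) letter list \<Rightarrow>\<^sub>0 'k::field"
  assumes "z \<in> leavitt_ideal G" "m \<in> arrow_space G x"
  shows "word_act (arrow_op x) z m = 0"
proof (rule leavitt_ideal_word_act[OF assms(1) pm_linear_arrow_op, where Y = "arrows_to G x"])
  show "keys (arrow_op x l m) \<subseteq> arrows_to G x" for l and m :: "('a, 'b) garrow \<Rightarrow>\<^sub>0 'k"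
    using arrows_lact_arrow_space[of G x _ m] by (simp add: arrow_op_def arrow_space_iff)
qed (use assms(2) arrow_op_relations in \<open>auto simp: arrow_space_iff\<close>)

section \<open>The map from the Leavitt path algebra to the Steinberg algebra\<close>

abbreviation word_value :: "('a, 'b) letter list \<Rightarrow> ('a, 'b) garrow \<Rightarrow> 'k::field" where
  "word_value \<equiv> eval_word (steinberg G) (steinberg_generator G)"

definition steinberg_eval :: "(('a, 'b) letter list \<Rightarrow>\<^sub>0 'k::field) \<Rightarrow> ('a, 'b) garrow \<Rightarrow> 'k" where
  "steinberg_eval z = (\<lambda>\<gamma>. \<Sum>w\<in>keys z. lookup z w * word_value w \<gamma>)"

lemma word_value_Cons: "w \<noteq> [] \<Longrightarrow> word_value (l # w) = convolution G (steinberg_generator G l)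
    (word_value w)"
  by (cases w) auto

lemma word_value_monomial:
  "w \<in> letter_words G \<Longrightarrow> word_value w \<in> insert (\<lambda>_. 0) (monomials :: (_ \<Rightarrow> 'k::field) set)"
proof (induction w)
  case (Cons l w)
  then have l: "steinberg_generator G l \<in> (monomials :: (_ \<Rightarrow> 'k) set)"
    by (intro generator_monomial) (simp add: letter_words_def)
  show ?case
  proof (cases "w = []")
    case False
    then have "word_value w \<in> insert (\<lambda>_. 0) (monomials :: (_ \<Rightarrow> 'k) set)"
      using Cons by (simp add: letter_words_def)
    then show ?thesis using convolution_monomials[OF l] False by (auto simp: word_value_Cons)
  qed (use l in simp)
qed (simp add: letter_words_def)

lemma word_value_span: "w \<in> letter_words G \<Longrightarrow> word_value w \<in> steinberg_span G"
  using word_value_monomial[of w] steinberg_span_0 monomial_in_span by auto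

lemma word_value_act:
  fixes m :: "('a, 'b) garrow \<Rightarrow>\<^sub>0 'k::field"
  shows "w \<in> letter_words G \<Longrightarrow> m \<in> arrow_space G x \<Longrightarrow> arrows_lact G x (word_value w) m = foldr
      (arrow_op x) w m"
proof (induction w)
  case (Cons l w)
  then have l: "column_finite G (steinberg_generator G l :: _ \<Rightarrow> 'k)"
    by (intro monomial_column_finite generator_monomial) (simp add: letter_words_def)
  show ?case
  proof (cases "w = []")
    case False
    then have w: "w \<in> letter_words G" using Cons by (simp add: letter_words_def)
    have "arrows_lact G x (word_value (l # w)) m = arrows_lact G x (steinberg_generator G l)
        (arrows_lact G x (word_value w) m)"
      using False by (simp add: word_value_Cons arrows_lact_convolution[OF l
          steinberg_span_column_finite[OF word_value_span[OF w]] Cons.prems(2)])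
    then show ?thesis using Cons w by (simp add: arrow_op_def)
  qed (simp add: arrow_op_def)
qed (simp add: letter_words_def)

lemma abelian_monoid_steinberg: "abelian_monoid (steinberg G)"
  by (rule abelian_monoidI)
    (auto simp: steinberg_span_add steinberg_span_0 algebra_simps zero_fun_def)

text \<open>
Closure, the value of the sum in the record of the Steinberg algebra, and the action on arrows are proved
by one induction on the set of words, since each step adds the same summand to all three.
\<close>

lemma lincomb_words:
  assumes "finite S" "S \<subseteq> letter_words G"
  shows "(\<lambda>\<gamma>. \<Sum>w\<in>S. c w * word_value w \<gamma>) \<in> steinberg_span G \<and>
    (\<Oplus>\<^bsub>steinberg G\<^esub>w\<in>S. c w \<odot>\<^bsub>steinberg G\<^esub> word_value w) = (\<lambda>\<gamma>. \<Sum>w\<in>S. c w * word_value w \<gamma>) \<and>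
    (\<forall>m\<in>arrow_space G x. arrows_lact G x (\<lambda>\<gamma>. \<Sum>w\<in>S. c w * word_value w \<gamma>) m =
       (\<Sum>w\<in>S. pm_scale (c w) (foldr (arrow_op x) w m)))"
  using assms
proof (induction S)
  case empty
  then show ?case
    by (simp add: abelian_monoid.finsum_empty[OF abelian_monoid_steinberg] steinberg_span_0
        arrows_lact_zero_fun zero_fun_def)
next
  case (insert w S)
  then have w: "w \<in> letter_words G" by simp
  let ?f = "\<lambda>\<gamma>. \<Sum>w\<in>S. c w * word_value w \<gamma>"
  have f: "?f \<in> steinberg_span G" and sum: "(\<Oplus>\<^bsub>steinberg G\<^esub>w\<in>S. c w \<odot>\<^bsub>steinberg G\<^esub> word_value w) =
      ?f"
    and act: "\<And>m. m \<in> arrow_space G x \<Longrightarrow> arrows_lact G x ?f m = (\<Sum>w\<in>S. pm_scale (c w) (foldr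
        (arrow_op x) w m))"
    using insert by auto
  have eq: "(\<lambda>\<gamma>. \<Sum>w\<in>insert w S. c w * word_value w \<gamma>) = (\<lambda>\<gamma>. c w * word_value w \<gamma> + ?f \<gamma>)"
    using insert by simp
  have "(\<Oplus>\<^bsub>steinberg G\<^esub>w\<in>insert w S. c w \<odot>\<^bsub>steinberg G\<^esub> word_value w) = (\<lambda>\<gamma>. c w * word_value w \<gamma>) +
      ?f"
    unfolding sum[symmetric] using insert
    by (subst abelian_monoid.finsum_insert[OF abelian_monoid_steinberg])
      (auto intro!: steinberg_span_scale word_value_span)
  then show ?case unfolding eq
    using steinberg_span_lincomb[OF word_value_span[OF w] f] insert
    by (auto simp: plus_fun_def arrows_lact_linear_fun[OF steinberg_span_column_finite[OF
        word_value_span[OF w]]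
          steinberg_span_column_finite[OF f]] act word_value_act[OF w])
qed

lemma
  assumes "z \<in> free_space G"
  shows steinberg_eval_span: "steinberg_eval z \<in> steinberg_span G"
    and steinberg_eval_finsum: "(\<Oplus>\<^bsub>steinberg G\<^esub>w\<in>keys z. lookup z w \<odot>\<^bsub>steinberg G\<^esub> word_value w) =
        steinberg_eval z"
    and steinberg_eval_act: "m \<in> arrow_space G x \<Longrightarrow> arrows_lact G x (steinberg_eval z) m = word_act
        (arrow_op x) z m"
  using lincomb_words[of "keys z" "lookup z"] assms
  by (auto simp: steinberg_eval_def free_space_def word_act_def linear_extend_def)

lemma steinberg_eval_add: "steinberg_eval (z + z') = (\<lambda>\<gamma>. steinberg_eval z \<gamma> + steinberg_eval z' \<gamma>)"
  by (simp add: steinberg_eval_def sum_lookup_add)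

lemma steinberg_eval_single [simp]: "steinberg_eval (Poly_Mapping.single w c) = (\<lambda>\<gamma>. c * word_value
    w \<gamma>)"
  by (auto simp: steinberg_eval_def)

text \<open>
Such an element acts as zero on the arrows that end at any given boundary path, so its value is zero
by faithfulness. This makes the map from the Leavitt path algebra well defined.
\<close>

lemma steinberg_eval_leavitt_ideal:
  assumes "z \<in> leavitt_ideal G"
  shows "steinberg_eval z = (\<lambda>_. 0)"
proof (rule arrows_lact_faithful)
  have z: "z \<in> free_space G" by (rule leavitt_ideal_free_space[OF assms])
  show "column_finite G (steinberg_eval z)" by (rule steinberg_span_column_finite[OF
      steinberg_eval_span[OF z]])
  fix x assume "x \<in> boundary_paths G"
  then have u: "Poly_Mapping.single (gunit x) 1 \<in> arrow_space G x"
    using gpd_unit by (simp add: arrow_space_iff gunit_def)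
  show "arrows_lact G x (steinberg_eval z) (Poly_Mapping.single (gunit x) 1) = 0"
    using steinberg_eval_act[OF z u] leavitt_ideal_acts_zero_on_arrows[OF assms u] by simp
qed

lemma leavitt_to_steinberg_leavitt_class:
  fixes z :: "('a, 'b) letter list \<Rightarrow>\<^sub>0 'k::field"
  assumes z: "z \<in> free_space G"
  shows "leavitt_to_steinberg G (leavitt_class z) = steinberg_eval z"
  unfolding leavitt_to_steinberg_def leavitt_hom_def
proof (rule on_cosets_leavitt_class)
  fix i :: "('a, 'b) letter list \<Rightarrow>\<^sub>0 'k" assume i: "i \<in> leavitt_ideal G"
  have "steinberg_eval (i + z) = steinberg_eval z"
    by (simp add: steinberg_eval_add steinberg_eval_leavitt_ideal[OF i])
  then show "(\<Oplus>\<^bsub>steinberg G\<^esub>w\<in>keys (i + z). lookup (i + z) w \<odot>\<^bsub>steinberg G\<^esub> word_value w) =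
      steinberg_eval z"
    using steinberg_eval_finsum[OF free_space_add[OF leavitt_ideal_free_space[OF i] z]] by simp
qed

text \<open>
The word is \<open>\<mu>\<nu>\<^sup>*\<close>, written as the arcs of \<open>\<mu>\<close>, the ghosts of \<open>\<nu>\<close> in reverse order, and the vertex at
which \<open>\<nu>\<close> starts. Letters are multiplied from the left, so \<open>\<nu>\<close> grows at its end and \<open>\<mu>\<close> at its beginning.
\<close>

lemma monomial_is_word_value:
  assumes "\<mu> \<in> finite_paths G" "\<nu> \<in> finite_paths G" "frange G \<mu> = frange G \<nu>"
  shows "\<exists>w\<in>letter_words G. word_value w = (indicator (Zset G \<mu> \<nu>) :: _ \<Rightarrow> 'k::field)"
proof -
  have base: "\<exists>w\<in>letter_words G. word_value w = (indicator (Zset G (frange G (u, es), []) (u, es))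
      :: _ \<Rightarrow> 'k)"
    if "(u, es) \<in> finite_paths G" for u es
    using that
  proof (induction es rule: rev_induct)
    case Nil
    then show ?case by (intro bexI[of _ "[Vertex u]"]) (auto simp: letter_words_def letters_def)
  next
    case (snoc e es)
    have es: "(u, es) \<in> finite_paths G" "(frange G (u, es), [e]) \<in> finite_paths G"
      using fconc_pathD[OF snoc.prems] by auto
    then have e: "e \<in> arcs G" "arc_path G e = (frange G (u, es), [e])" by (auto simp: arc_path_def)
    obtain w where w: "w \<in> letter_words G" "word_value w = (indicator (Zset G (frange G (u, es), [])
        (u, es)) :: _ \<Rightarrow> 'k)"
      using snoc.IH[OF es(1)] by blast
    have F: "(frange G (u, es), []) \<in> finite_paths G" using frange_in_verts[OF es(1)] by simp
    have fst: "fst (arc_path G e) = frange G (u, es)" unfolding e(2) by simp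
    have "word_value (Ghost e # w) = convolution G (steinberg_generator G (Ghost e)) (word_value w
        :: _ \<Rightarrow> 'k)"
      by (rule word_value_Cons) (use w(1) in \<open>simp add: letter_words_def\<close>)
    also have "\<dots> = (indicator (gprod (Zset G (head G e, []) (arc_path G e))
        (Zset G (frange G (u, es), []) (u, es))) :: _ \<Rightarrow> 'k)"
      unfolding w(2) steinberg_generator.simps by (rule convolution_Zset[OF F es(1)])
    also have "gprod (Zset G (head G e, []) (arc_path G e)) (Zset G (frange G (u, es), []) (u, es))
        =
        Zset G (head G e, []) (u, es @ [e])"
    proof -
      have eqs: "fconc (frange G (u, es), []) (arc_path G e) = arc_path G e"
        "fconc (u, es) (arc_path G e) = (u, es @ [e])"
        by (simp_all only: e(2) fconc_def prod.sel append.simps)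
      have "gprod (Zset G (head G e, []) (fconc (frange G (u, es), []) (arc_path G e)))
          (Zset G (frange G (u, es), []) (u, es)) = Zset G (head G e, []) (fconc (u, es) (arc_path G
              e))"
        by (rule gprod_Zset_right[OF arc_finite_paths(2)[OF e(1)] F arc_finite_paths(1)[OF e(1)]
            es(1)])
          (simp_all only: fst frange_Nil)
      then show ?thesis by (simp only: eqs)
    qed
    also have "head G e = frange G (u, es @ [e])" by (simp add: frange_def)
    finally show ?case using w e
      by (intro bexI[of _ "Ghost e # w"]) (auto simp: letter_words_def letters_def)
  qed
  have "\<exists>w\<in>letter_words G. word_value w = (indicator (Zset G (u, es) \<nu>) :: _ \<Rightarrow> 'k)"
    if "(u, es) \<in> finite_paths G" "frange G (u, es) = frange G \<nu>" for u es
    using that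
  proof (induction es arbitrary: u)
    case Nil
    then show ?case using base[of "fst \<nu>" "snd \<nu>"] assms(2) by simp
  next
    case (Cons e es)
    obtain w where w: "w \<in> letter_words G" "word_value w = (indicator (Zset G (head G e, es) \<nu>) :: _
        \<Rightarrow> 'k)"
      using Cons.IH[of "head G e"] Cons.prems by auto
    have "word_value (Arc e # w) = (indicator (gprod (Zset G (arc_path G e) (head G e, []))
        (Zset G (head G e, es) \<nu>)) :: _ \<Rightarrow> 'k)"
      using w Cons.prems assms(2) by (simp add: word_value_Cons letter_words_def convolution_Zset)
    also have "gprod (Zset G (arc_path G e) (head G e, [])) (Zset G (head G e, es) \<nu>) = Zset G (u, e
        # es) \<nu>"
      using gprod_Zset_left[of "arc_path G e" "(head G e, [])" "(head G e, es)" \<nu>] Cons.prems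
          assms(2)
      by (simp add: fconc_def arc_path_def)
    finally show ?case using w Cons.prems
      by (intro bexI[of _ "Arc e # w"]) (auto simp: letter_words_def letters_def)
  qed
  from this[of "fst \<mu>" "snd \<mu>"] show ?thesis using assms by simp
qed

lemma leavitt_to_steinberg_surj:
  "steinberg_span G \<subseteq> leavitt_to_steinberg G ` carrier (leavitt G)"
proof
  fix f :: "('a, 'b) garrow \<Rightarrow> 'k::field" assume "f \<in> steinberg_span G"
  then have "\<exists>z\<in>free_space G. steinberg_eval z = f"
  proof (induction rule: steinberg_span_induct)
    case zero
    show ?case by (rule bexI[of _ 0]) (simp_all add: free_space_0 steinberg_eval_def)
  next
    case (step c f g)
    then obtain w z where "w \<in> letter_words G" "word_value w = f" "z \<in> free_space G" "steinberg_eval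
        z = g"
      using monomial_is_word_value unfolding monomials_def by blast
    then show ?case
      by (intro bexI[of _ "Poly_Mapping.single w c + z"])
        (simp_all add: steinberg_eval_add free_space_add free_space_single)
  qed
  then show "f \<in> leavitt_to_steinberg G ` carrier (leavitt G)"
    using leavitt_to_steinberg_leavitt_class unfolding leavitt_carrier by force
qed

section \<open>Twisted Chen modules\<close>

definition chen_op :: "('a, 'b) letter \<Rightarrow> (('a, 'b) path \<Rightarrow>\<^sub>0 'k::field) \<Rightarrow> (('a, 'b) path \<Rightarrow>\<^sub>0 'k)"
    where
  "chen_op l = linear_extend (letter_act G l)"

text \<open>
The intertwiner \<open>(p, k, x) \<mapsto> b p \<cdot> p\<close> from arrows to paths.
\<close>

definition weighted_source :: "('b \<Rightarrow> 'k::field) \<Rightarrow> ('a, 'b) path \<Rightarrow> (('a, 'b) garrow \<Rightarrow>\<^sub>0 'k) \<Rightarrow> (('a,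
    'b) path \<Rightarrow>\<^sub>0 'k)" where
  "weighted_source a x = linear_extend (\<lambda>t. Poly_Mapping.single (gsource t) (path_weight G a x
      (gsource t)))"

lemma pm_linear_chen_op: "pm_linear (chen_op l)"
  unfolding chen_op_def by (rule pm_linear_linear_extend)

lemma pm_linear_weighted_source: "pm_linear (weighted_source a x)"
  unfolding weighted_source_def by (rule pm_linear_linear_extend)

lemma weighted_source_single [simp]:
  "weighted_source a x (Poly_Mapping.single t c) = Poly_Mapping.single (gsource t) (c * path_weight
      G a x (gsource t))"
  by (simp add: weighted_source_def)

lemma free_algebra_act_conv: "free_algebra_act G z m = word_act chen_op z m"
  by (simp add: free_algebra_act_def word_act_def linear_extend_def[of _ z] chen_op_def[abs_def])

lemma ghost_letter_act:
  assumes "head G e = source G p" "p \<in> boundary_paths G"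
  shows "letter_act G (Ghost e) (conc (arc_path G e) p) = Poly_Mapping.single p 1"
proof -
  have "(THE p'. p' \<in> boundary_paths G \<and> head G e = source G p' \<and>
      conc (arc_path G e) p = conc (arc_path G e) p') = p"
  proof (rule the_equality)
    fix p' assume "p' \<in> boundary_paths G \<and> head G e = source G p' \<and>
      conc (arc_path G e) p = conc (arc_path G e) p'"
    then show "p' = p" using arc_conc_inj(2)[of e p e p'] assms(1) by blast
  qed (use assms in simp)
  then show ?thesis using assms by auto
qed

text \<open>
For an arc this is \<open>path_weight_arc\<close>, for a ghost arc the same identity read backwards; vertices
neither change the path nor carry a scalar.
\<close>

lemma weighted_source_op:
  fixes m :: "('a, 'b) garrow \<Rightarrow>\<^sub>0 'k::field"
  assumes a: "\<And>e. e \<in> arcs G \<Longrightarrow> a e \<noteq> 0" and x: "x \<notin> rational_paths G"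
    and l: "l \<in> letters G" and m: "m \<in> arrow_space G x"
  shows "pm_scale (letter_weight a l) (chen_op l (weighted_source a x m)) = weighted_source a x
      (arrow_op x l m)"
proof (rule pm_linear_eq_on[of _ _ m "arrows_to G x"])
  show "pm_linear (\<lambda>m. pm_scale (letter_weight a l) (chen_op l (weighted_source a x m)))"
  proof -
    have "pm_linear (\<lambda>m. chen_op l (weighted_source a x m))"
      by (rule pm_linear_comp[OF pm_linear_chen_op pm_linear_weighted_source])
    then show ?thesis by (simp add: pm_linear_iff pm.scale_right_distrib mult.commute)
  qed
  show "pm_linear (\<lambda>m. weighted_source a x (arrow_op x l m))"
    by (rule pm_linear_comp[OF pm_linear_weighted_source pm_linear_arrow_op])
  show "keys m \<subseteq> arrows_to G x" using m by (simp add: arrow_space_iff)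
  fix t assume "t \<in> arrows_to G x"
  then obtain p k where t: "t = (p, k, x)" and g: "(p, k, x) \<in> gpd G" by (cases t) auto
  have p: "p \<in> boundary_paths G" using gpd_boundary[OF g] by simp
  note zero = pm_linear_zero[OF pm_linear_weighted_source]
  show "pm_scale (letter_weight a l) (chen_op l (weighted_source a x (Poly_Mapping.single t 1))) =
      weighted_source a x (arrow_op x l (Poly_Mapping.single t (1::'k)))"
  proof (cases l)
    case (Vertex v)
    then show ?thesis using l g
      by (auto simp: t chen_op_def arrow_op_Vertex zero letters_def)
  next
    case (Arc e)
    then have e: "e \<in> arcs G" using l by (auto simp: letters_def)
    show ?thesis using Arc path_weight_arc[OF a x g e]
      by (auto simp: t chen_op_def arrow_op_Arc[OF e g] zero)
  next
    case (Ghost e)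
    then have e: "e \<in> arcs G" using l by (auto simp: letters_def)
    show ?thesis
    proof (cases "\<exists>p'\<in>boundary_paths G. head G e = source G p' \<and> p = conc (arc_path G e) p'")
      case True
      then obtain p' where p': "p' \<in> boundary_paths G" "head G e = source G p'" "p = conc (arc_path
          G e) p'"
        by blast
      have g': "(conc (arc_path G e) p', k, x) \<in> gpd G" using g p' by simp
      have "arrow_op x (Ghost e) (Poly_Mapping.single t (1::'k)) = Poly_Mapping.single (p', - 1 + k,
          x) 1"
        using arrow_op_Ghost[OF e g' p'(1,2)] by (simp only: t p'(3))
      moreover have "letter_act G (Ghost e) p = (Poly_Mapping.single p' 1 :: _ \<Rightarrow>\<^sub>0 'k)"
        unfolding p'(3) by (rule ghost_letter_act[OF p'(2,1)])
      moreover have "path_weight G a x p = a e * path_weight G a x p'"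
        unfolding p'(3) by (rule path_weight_arc[OF a x gpd_ghost_mult[OF g' e p'(2,1)] e p'(2)])
      ultimately show ?thesis using a[OF e] Ghost
        by (simp add: t chen_op_def mult.assoc[symmetric] del: letter_act.simps)
    next
      case False
      then have "arrow_op x (Ghost e) (Poly_Mapping.single t (1::'k)) = 0"
        unfolding t by (intro arrow_op_Ghost_none[OF e g]) blast
      moreover have "letter_act G (Ghost e) p = (0 :: _ \<Rightarrow>\<^sub>0 'k)"
        unfolding letter_act.simps using False by (simp only: if_False)
      ultimately show ?thesis using Ghost
        by (simp add: t chen_op_def zero del: letter_act.simps)
    qed
  qed
qed

lemma arrow_op_words_space:
  "m \<in> arrow_space G x \<Longrightarrow> foldr (arrow_op x) w m \<in> arrow_space G x"
  by (induction w) (simp_all add: arrow_op_def arrows_lact_arrow_space)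

lemma weighted_source_word:
  fixes m :: "('a, 'b) garrow \<Rightarrow>\<^sub>0 'k::field"
  assumes a: "\<And>e. e \<in> arcs G \<Longrightarrow> a e \<noteq> 0" and x: "x \<notin> rational_paths G"
    and m: "m \<in> arrow_space G x" and w: "set w \<subseteq> letters G"
  shows "pm_scale (word_weight a w) (foldr chen_op w (weighted_source a x m)) =
    weighted_source a x (foldr (arrow_op x) w m)"
  using w
proof (induction w)
  case (Cons l w)
  have "pm_scale (word_weight a (l # w)) (foldr chen_op (l # w) (weighted_source a x m)) =
      pm_scale (letter_weight a l) (chen_op l (pm_scale (word_weight a w) (foldr chen_op w
          (weighted_source a x m))))"
    by (simp add: pm_linear_scale[OF pm_linear_chen_op] word_weight_def)
  also have "\<dots> = pm_scale (letter_weight a l) (chen_op l (weighted_source a x (foldr (arrow_op x) w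
      m)))"
    using Cons by simp
  also have "\<dots> = weighted_source a x (arrow_op x l (foldr (arrow_op x) w m))"
    using Cons.prems by (intro weighted_source_op[OF a x] arrow_op_words_space[OF m]) auto
  finally show ?case by simp
qed (simp add: word_weight_def)

lemma weighted_source_act:
  fixes m :: "('a, 'b) garrow \<Rightarrow>\<^sub>0 'k::field"
  assumes a: "\<And>e. e \<in> arcs G \<Longrightarrow> a e \<noteq> 0" and x: "x \<notin> rational_paths G"
    and m: "m \<in> arrow_space G x" and z: "z \<in> free_space G"
  shows "word_act chen_op (rescale a z) (weighted_source a x m) = weighted_source a x (word_act
      (arrow_op x) z m)"
proof -
  have "word_act chen_op (rescale a z) (weighted_source a x m) =
      linear_extend (\<lambda>w. weighted_source a x (foldr (arrow_op x) w m)) z"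
    unfolding word_act_rescale using z
    by (intro linear_extend_cong weighted_source_word[OF a x m]) (auto simp: free_space_def
        letter_words_def)
  also have "\<dots> = weighted_source a x (word_act (arrow_op x) z m)"
    unfolding word_act_def by (rule pm_linear_linear_extend_comp[OF pm_linear_weighted_source,
        symmetric])
  finally show ?thesis .
qed

lemma tail_class_iff: "p \<in> tail_class G x \<longleftrightarrow> (\<exists>k. (p, k, x) \<in> gpd G)"
  unfolding tail_class_def mem_Collect_eq tail_equiv_iff
  using gpd_inverse[of x _ p] gpd_inverse[of p _ x] by blast

lemma weighted_source_bij:
  assumes a: "\<And>e. e \<in> arcs G \<Longrightarrow> a e \<noteq> 0" and x: "x \<notin> rational_paths G"
  shows "bij_betw (weighted_source a x :: _ \<Rightarrow> (_ \<Rightarrow>\<^sub>0 'k::field)) (arrow_space G x) {n. keys n \<subseteq>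
      tail_class G x}"
proof -
  \<comment> \<open>The inverse sends \<open>p\<close> to the unique arrow from \<open>p\<close> to \<open>x\<close>, divided by the weight of \<open>p\<close>.\<close>
  define arr where "arr p = (p, SOME k. (p, k, x) \<in> gpd G, x)" for p
  have arr: "arr p = (p, k, x)" if "(p, k, x) \<in> gpd G" for p k
    unfolding arr_def using that someI[of "\<lambda>k. (p, k, x) \<in> gpd G" k] arrow_degree_unique[OF x] by
        blast
  define \<psi> :: "(('a, 'b) path \<Rightarrow>\<^sub>0 'k) \<Rightarrow> _" where
    "\<psi> = linear_extend (\<lambda>p. Poly_Mapping.single (arr p) (inverse (path_weight G a x p)))"
  have lin: "pm_linear \<psi>" unfolding \<psi>_def by (rule pm_linear_linear_extend)
  have id: "pm_linear (\<lambda>m :: 'z \<Rightarrow>\<^sub>0 'k. m)" by (simp add: pm_linear_iff)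
  show ?thesis
  proof (rule bij_betw_byWitness[of _ \<psi>])
    show "\<forall>m\<in>arrow_space G x. \<psi> (weighted_source a x m) = m"
    proof
      fix m :: "('a, 'b) garrow \<Rightarrow>\<^sub>0 'k" assume "m \<in> arrow_space G x"
      then have m: "keys m \<subseteq> arrows_to G x" by (simp add: arrow_space_iff)
      show "\<psi> (weighted_source a x m) = m"
      proof (rule pm_linear_eq_on[OF pm_linear_comp[OF lin pm_linear_weighted_source] id m])
        fix t assume "t \<in> arrows_to G x"
        then obtain p k where "t = (p, k, x)" "(p, k, x) \<in> gpd G" by (cases t) auto
        then show "\<psi> (weighted_source a x (Poly_Mapping.single t 1)) = Poly_Mapping.single t 1"
          using path_weight_nonzero[OF a x] arr by (simp add: \<psi>_def)
      qed
    qed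
    show "\<forall>n\<in>{n. keys n \<subseteq> tail_class G x}. weighted_source a x (\<psi> n) = n"
    proof
      fix n :: "('a, 'b) path \<Rightarrow>\<^sub>0 'k" assume "n \<in> {n. keys n \<subseteq> tail_class G x}"
      then have n: "keys n \<subseteq> tail_class G x" by simp
      show "weighted_source a x (\<psi> n) = n"
      proof (rule pm_linear_eq_on[OF pm_linear_comp[OF pm_linear_weighted_source lin] id n])
        fix p assume "p \<in> tail_class G x"
        then obtain k where "(p, k, x) \<in> gpd G" by (auto simp: tail_class_iff)
        then show "weighted_source a x (\<psi> (Poly_Mapping.single p 1)) = Poly_Mapping.single p 1"
          using path_weight_nonzero[OF a x] arr by (simp add: \<psi>_def)
      qed
    qed
    show "weighted_source a x ` arrow_space G x \<subseteq> {n. keys n \<subseteq> tail_class G x}"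
    proof clarify
      fix m :: "('a, 'b) garrow \<Rightarrow>\<^sub>0 'k" and p
      assume m: "m \<in> arrow_space G x" and p: "p \<in> keys (weighted_source a x m)"
      have "keys (weighted_source a x m) \<subseteq> tail_class G x"
        unfolding weighted_source_def
      proof (rule keys_linear_extend)
        fix t assume "t \<in> keys m"
        then have "t \<in> arrows_to G x" using m by (auto simp: arrow_space_iff)
        then show "keys (Poly_Mapping.single (gsource t) (path_weight G a x (gsource t))) \<subseteq>
            tail_class G x"
          by (cases t) (auto simp: tail_class_iff split: if_splits)
      qed
      then show "p \<in> tail_class G x" using p by blast
    qed
    show "\<psi> ` {n. keys n \<subseteq> tail_class G x} \<subseteq> arrow_space G x"
    proof clarify
      fix n :: "('a, 'b) path \<Rightarrow>\<^sub>0 'k" assume n: "keys n \<subseteq> tail_class G x"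
      show "\<psi> n \<in> arrow_space G x"
        unfolding arrow_space_iff \<psi>_def
      proof (rule keys_linear_extend)
        fix p assume "p \<in> keys n"
        then have "p \<in> tail_class G x" using n by blast
        then obtain k where "(p, k, x) \<in> gpd G" unfolding tail_class_iff by blast
        then show "keys (Poly_Mapping.single (arr p) (inverse (path_weight G a x p))) \<subseteq> arrows_to G
            x"
          by (simp add: arr)
      qed
    qed
  qed
qed

text \<open>
The intertwiner for the trivial weights \<open>a = 1\<close> identifies the untwisted Chen module with the space of
arrows, where the ideal is already known to act as zero.
\<close>

lemma leavitt_ideal_acts_zero_on_paths:
  fixes z :: "('a, 'b) letter list \<Rightarrow>\<^sub>0 'k::field"
  assumes x: "x \<notin> rational_paths G" and z: "z \<in> leavitt_ideal G" and n: "keys n \<subseteq> tail_class G x"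
  shows "word_act chen_op z n = 0"
proof -
  let ?a = "\<lambda>_ :: 'b. 1 :: 'k"
  have a: "\<And>e. e \<in> arcs G \<Longrightarrow> ?a e \<noteq> 0" by simp
  have "bij_betw (weighted_source ?a x) (arrow_space G x) {n. keys n \<subseteq> tail_class G x}"
    by (rule weighted_source_bij) (use x in simp_all)
  then have "n \<in> weighted_source ?a x ` arrow_space G x"
    using n by (simp add: bij_betw_imp_surj_on)
  then obtain m where m: "m \<in> arrow_space G x" "n = weighted_source ?a x m" by blast
  have "word_act chen_op z n = weighted_source ?a x (word_act (arrow_op x) z m)"
    using weighted_source_act[of ?a x m z] x m leavitt_ideal_free_space[OF z] by (simp add:
        rescale_one)
  then show ?thesis
    by (simp add: leavitt_ideal_acts_zero_on_arrows[OF z m(1)] pm_linear_zero[OF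
        pm_linear_weighted_source])
qed

lemma chen_module_lact:
  fixes z :: "('a, 'b) letter list \<Rightarrow>\<^sub>0 'k::field"
  assumes x: "x \<notin> rational_paths G" and n: "keys n \<subseteq> tail_class G x"
  shows "lact (chen_module G x) (leavitt_class z) n = word_act chen_op z n"
proof -
  have "on_cosets (\<lambda>z. word_act chen_op z n) (leavitt_class z) = word_act chen_op z n"
    by (rule on_cosets_leavitt_class) (simp add: pm_linear_add[OF pm_linear_word_act_left]
        leavitt_ideal_acts_zero_on_paths[OF x _ n])
  then show ?thesis by (simp add: chen_module_def free_algebra_act_conv)
qed

text \<open>
The action of \<open>f\<close> on the twisted Chen module goes through a preimage \<open>leavitt_class z\<close> of \<open>f\<close>. By
\<open>weighted_source_act\<close> it is the image of the action of \<open>z\<close> on arrows, which depends on \<open>f\<close> only.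
\<close>

lemma twisted_chen_isomorphic:
  fixes a :: "'b \<Rightarrow> 'k::field"
  assumes a: "\<And>e. e \<in> arcs G \<Longrightarrow> a e \<noteq> 0" and x: "x \<notin> rational_paths G"
  shows "isomorphic_modules (steinberg G) (arrows_bimodule G x)
     (as_steinberg_module G (twisted_chen_module G a x))"
proof (rule isomorphic_modules_transport[OF arrows_left_module, where \<phi> = "weighted_source a x"])
  let ?N = "as_steinberg_module G (twisted_chen_module G a x)"
  have N: "carrier ?N = {n. keys n \<subseteq> tail_class G x}" "\<zero>\<^bsub>?N\<^esub> = 0" "\<And>n n'. n \<oplus>\<^bsub>?N\<^esub> n' = n + n'"
    "\<And>c n. c \<odot>\<^bsub>?N\<^esub> n = pm_scale c n"
    "\<And>f n. lact ?N f n = lact (chen_module G x) (twist G a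
       (inv_into (carrier (leavitt G)) (leavitt_to_steinberg G) f)) n"
    by (simp_all add: as_steinberg_module_def twisted_chen_module_def restrict_scalars_def
        chen_module_def)
  show bij: "bij_betw (weighted_source a x) (carrier (arrows_bimodule G x)) (carrier ?N)"
    using weighted_source_bij[OF a x] by (simp add: N)
  show "weighted_source a x \<zero>\<^bsub>arrows_bimodule G x\<^esub> = \<zero>\<^bsub>?N\<^esub>"
    by (simp add: N pm_linear_zero[OF pm_linear_weighted_source])
  fix m :: "('a, 'b) garrow \<Rightarrow>\<^sub>0 'k" assume "m \<in> carrier (arrows_bimodule G x)"
  then have m: "m \<in> arrow_space G x" by simp
  show "weighted_source a x m \<oplus>\<^bsub>?N\<^esub> weighted_source a x m' =
      weighted_source a x (m \<oplus>\<^bsub>arrows_bimodule G x\<^esub> m')" for m'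
    by (simp add: N pm_linear_add[OF pm_linear_weighted_source])
  show "c \<odot>\<^bsub>?N\<^esub> weighted_source a x m = weighted_source a x (c \<odot>\<^bsub>arrows_bimodule G x\<^esub> m)" for c
    by (simp add: N pm_linear_scale[OF pm_linear_weighted_source])
  fix f :: "('a, 'b) garrow \<Rightarrow> 'k" assume "f \<in> carrier (steinberg G)"
  then have f: "f \<in> leavitt_to_steinberg G ` carrier (leavitt G)"
    using leavitt_to_steinberg_surj by auto
  let ?C = "inv_into (carrier (leavitt G)) (leavitt_to_steinberg G) f"
  have "?C \<in> carrier (leavitt G)" by (rule inv_into_into[OF f])
  then obtain z where z: "z \<in> free_space G" "?C = leavitt_class z" by (auto simp: leavitt_carrier)
  have fz: "steinberg_eval z = f"
    using f_inv_into_f[OF f] leavitt_to_steinberg_leavitt_class[OF z(1)] z(2) by simp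
  have n: "keys (weighted_source a x m) \<subseteq> tail_class G x"
    using bij_betwE[OF weighted_source_bij[of a x, OF a x]] m by blast
  show "lact ?N f (weighted_source a x m) = weighted_source a x (lact (arrows_bimodule G x) f m)"
  proof -
    have "twist G a (leavitt_class z) = leavitt_class (rescale a z)" by (rule twist_leavitt_class[OF
        a z(1)])
    moreover have "word_act chen_op (rescale a z) (weighted_source a x m) =
        weighted_source a x (word_act (arrow_op x) z m)"
      by (rule weighted_source_act[OF a x m z(1)])
    ultimately show ?thesis
      by (simp add: N z(2) chen_module_lact[OF x n] fz flip: steinberg_eval_act[OF z(1) m])
  qed
qed (simp_all add: steinberg_span_add steinberg_span_scale steinberg_span_convolution)

end

theorem proposition4:
  fixes E :: "('v, 'e) pre_digraph" and x :: "('v, 'e) path"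
  assumes "wf_digraph E"
    and "x \<in> boundary_paths E - rational_paths E"
  shows "carrier (isotropy E x) = {gunit x} \<and>
    (coefficient_sum :: _ \<Rightarrow> 'k::field) \<in> ring_iso (isotropy_algebra E x) field_ring \<and>
    (\<forall>a :: 'e \<Rightarrow> 'k. (\<forall>e\<in>arcs E. a e \<noteq> 0) \<longrightarrow>
       isomorphic_modules (steinberg E) (Ind E x scalar_module)
         (as_steinberg_module E (twisted_chen_module E a x)))"
proof -
  interpret wf_digraph E by (rule assms(1))
  interpret trivial_isotropy E x
    by unfold_locales (rule isotropy_trivial[OF assms(2)])
  have "isomorphic_modules (steinberg E) (Ind E x scalar_module)
         (as_steinberg_module E (twisted_chen_module E a x))"
    if "\<forall>e\<in>arcs E. a e \<noteq> 0" for a :: "'e \<Rightarrow> 'k"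
    using isomorphic_modules_trans[OF isomorphic_modules_sym[OF Ind_isomorphic]
        twisted_chen_isomorphic]
      that assms(2) by blast
  then show ?thesis
    using isotropy_trivial[OF assms(2)] isotropy_algebra_iso[OF assms(2)] by blast
qed

end
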